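(* Let $g=[z^2,z^4;z^4,z]$ and $C=\langle g\rangle\le \mathrm{SL}(2,8)$. Let $$D_1=\{\mathbb 1,\ [z^5,1;z^5,z^6],\ [z^4,z^2;1,z^2],\ [0,z;z^6,z^2],\ [1,z^4;z^2,z^2],\ [1,z;z^6,0],\ [1,z^2;1,z^6],\ [z^4,1;z^5,1],\ [z^5,0;0,z^2]\},$$ $D_2=D_1\cdot\varphi$, $D_3=D_1\cdot\varphi^2$, $$D_4=\{\mathbb 1,\ [z^5,0;z^6,z^2],\ [z,z^6;z^4,1],\ [0,z;z^6,z^5],\ [z^4,0;z^2,z^3],\ [z^5,z^2;z^3,z^6],\ [0,z^2;z^5,z^5],\ [0,z^4;z^3,z^4],\ [z^2,z^5;z^5,z^6]\},$$ $D_5=D_4\cdot\varphi$, $D_6=D_4\cdot\varphi^2$, and $\mathcal D=\{D_1,\dots,D_6\}$. Then $\mathbb{WU}:=\mathbb U_{C,\mathcal D}$ is an affine $\mathrm{SL}(2,8)$-unital. The stabilizer of the point $\mathbb 1$ in $\mathrm{Aut}(\mathbb{WU})$ is $$\mathrm{Aut}(\mathbb{WU})_{\mathbb 1}=U\rtimes(F\times L)=\langle\gamma_{g^3}\rangle\rtimes\langle\gamma_f\cdot\varphi\rangle\cong C_3\rtimes C_6,$$ and the full automorphism group $$\mathrm{Aut}(\mathbb{WU})=\mathrm{Aut}(\mathbb{WU})_{\mathbb 1}\ltimes R$$ has index $3$ in $\mathrm{Aut}(\mathbb U_{C,\mathcal H})=\mathfrak A_C\ltimes R$.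
   Context: Field and matrices: $\mathbb F_8^\times=\langle z\rangle$ with $z^3=z+1$. Write $[a,b;c,d]$ for the $2\times2$ matrix with rows $(a,b)$ and $(c,d)$; $\mathbb 1=[1,0;0,1]$. Let $f=[0,1;1,0]$. Let $\varphi:x\mapsto x^2$ be the Frobenius automorphism of $\mathbb F_8$, acting entrywise on matrices, and $D\cdot\varphi$ the image of a set $D$ of matrices. Maps act from the right. For $x\in\mathrm{SL}(2,8)$, $\gamma_x$ denotes conjugation $h\mapsto h^x:=x^{-1}hx$. $C_n$ denotes a cyclic group of order $n$. Affine $\mathrm{SL}(2,8)$-unitals: Let $S\le\mathrm{SL}(2,8)$ be a subgroup of order $9$ and $T$ a Sylow $2$-subgroup of $\mathrm{SL}(2,8)$ (of order $8$; it has $9$ conjugates $T^h=h^{-1}Th$). Let $\mathcal D$ be a collection of subsets of $\mathrm{SL}(2,8)$, each containing $\mathbb 1$ and having exactly $9$ elements, such that: (Q) for each $D\in\mathcal D$ the map $(x,y)\mapsto xy^{-1}$ on pairs $(x,y)\in D\times D$ with $x\ne y$ is injective, i.e. $D^*:=\{xy^{-1}\mid x,y\in D,\ x\neq y\}$ has $72$ elements; (P) the system consisting of $S\setminus\{\mathbb 1\}$, all conjugates of $T\setminus\{\mathbb 1\}$ and all sets $D^*$ ($D\in\mathcal D$) is a partition of $\mathrm{SL}(2,8)\setminus\{\mathbb 1\}$. Then the incidence structure $\mathbb U_{S,\mathcal D}$ with point set $\mathrm{SL}(2,8)$, block set $\{Sx\mid x\in \mathrm{SL}(2,8)\}\cup\{T^hx\mid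 h,x\in \mathrm{SL}(2,8)\}\cup\{Dx\mid D\in\mathcal D,\ x\in \mathrm{SL}(2,8)\}$ and containment as incidence is called an affine $\mathrm{SL}(2,8)$-unital. Automorphisms: $\mathrm{Aut}(\mathbb U_{S,\mathcal D})$ is the group of bijections of the point set leaving the block set invariant. $R=\{\rho_h\mid h\in\mathrm{SL}(2,8)\}$, where $\rho_h$ is right multiplication by $h$. $\mathfrak A$ is the permutation group on $\mathrm{SL}(2,8)$ given by all automorphisms of the group $\mathrm{SL}(2,8)$, and $\mathfrak A_C=\{\alpha\in\mathfrak A\mid C\cdot\alpha=C\}$. One has $\mathfrak A_C=\langle\gamma_g\rangle\rtimes\langle\gamma_f\cdot\varphi\rangle\cong C_9\rtimes C_6$. Put $F=\langle\gamma_f\rangle\cong C_2$, $U=\langle\gamma_{g^3}\rangle\cong C_3$, $L=\langle\varphi\rangle\cong C_3$. Classical affine unital of order $8$: $\mathbb U_{C,\mathcal H}$, where $C=\langle g\rangle$ and $\mathcal H=\{H_1,\dots,H_6\}$ with $H_1=\{\mathbb 1,[z^5,1;z^5,z^6],[z^4,z^2;1,z^2],[0,z;z^6,z^5],[z^3,z^6;z^4,z^5],[z^3,z;z^6,0],[1,z^2;1,z^6],[z^4,1;z^5,1],[z^5,0;0,z^2]\}$, $H_2=H_1\cdot\varphi$, $H_3=H_1\cdot\varphi^2$, $H_4=\{\mathbb 1,[z^5,0;z^6,z^2],[z,z^6;z^4,1],[1,z^5;z^6,z^5],[z,z^4;0,z^6],[z^5,z^2;z^4,z^4],[0,z^2;z^5,z^5],[0,z^4;z^3,z^4],[z^2,z^5;z^5,z^6]\}$,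 $H_5=H_4\cdot\varphi$, $H_6=H_4\cdot\varphi^2$. *)

theory Defs
  imports
    "HOL-Analysis.Determinants"
    "HOL-Algebra.Bij"
    "HOL-Algebra.Group_Action"
    "HOL-Algebra.Elementary_Groups"
    "HOL-Library.Disjoint_Sets"
    "HOL-Computational_Algebra.Primes"
begin

section \<open>The group \<open>SL(2, F)\<close>\<close>

definition SL2 :: "('a::field ^ 2 ^ 2) monoid" where
  "SL2 = \<lparr>carrier = {A. det A = 1}, mult = (**), one = mat 1\<rparr>"

definition mat2 :: "'a::zero \<Rightarrow> 'a \<Rightarrow> 'a \<Rightarrow> 'a \<Rightarrow> 'a ^ 2 ^ 2" where
  "mat2 a b c d = vector [vector [a, b], vector [c, d]]"


section \<open>General group-theoretic notions\<close>

definition sylow_subgroup :: "nat \<Rightarrow> ('g, 'm) monoid_scheme \<Rightarrow> 'g set \<Rightarrow> bool" where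
  "sylow_subgroup p G T \<longleftrightarrow> subgroup T G \<and> card T = p ^ multiplicity p (order G)"

text \<open>Conjugation is \<open>x\<^sup>h = h\<^sup>-\<^sup>1 x h\<close>. The maps below are restricted to the carrier, so that
  they are elements of \<^const>\<open>BijGroup\<close>, whose elements are extensional.\<close>

definition conj_map :: "('g, 'm) monoid_scheme \<Rightarrow> 'g \<Rightarrow> 'g \<Rightarrow> 'g" where
  "conj_map G h = (\<lambda>x \<in> carrier G. inv\<^bsub>G\<^esub> h \<otimes>\<^bsub>G\<^esub> x \<otimes>\<^bsub>G\<^esub> h)"

definition right_mult_map :: "('g, 'm) monoid_scheme \<Rightarrow> 'g \<Rightarrow> 'g \<Rightarrow> 'g" where
  "right_mult_map G h = (\<lambda>x \<in> carrier G. x \<otimes>\<^bsub>G\<^esub> h)"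

text \<open>\<open>A = N \<rtimes> H\<close> and \<open>A = N \<times> H\<close>, as internal products of subgroups of \<open>G\<close>.\<close>

definition internal_semidirect ::
    "('g, 'm) monoid_scheme \<Rightarrow> 'g set \<Rightarrow> 'g set \<Rightarrow> 'g set \<Rightarrow> bool" where
  "internal_semidirect G A N H \<longleftrightarrow>
     subgroup A G \<and> N \<lhd> G\<lparr>carrier := A\<rparr> \<and> subgroup H (G\<lparr>carrier := A\<rparr>) \<and>
     N \<inter> H = {\<one>\<^bsub>G\<^esub>} \<and> N <#>\<^bsub>G\<^esub> H = A"

definition internal_direct ::
    "('g, 'm) monoid_scheme \<Rightarrow> 'g set \<Rightarrow> 'g set \<Rightarrow> 'g set \<Rightarrow> bool" where
  "internal_direct G A N H \<longleftrightarrow>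
     internal_semidirect G A N H \<and> H \<lhd> G\<lparr>carrier := A\<rparr>"

definition semidirect_product ::
    "('g, 'm) monoid_scheme \<Rightarrow> ('h, 'n) monoid_scheme \<Rightarrow> ('h \<Rightarrow> 'g \<Rightarrow> 'g) \<Rightarrow> ('g \<times> 'h) monoid" where
  "semidirect_product N H \<theta> =
     \<lparr>carrier = carrier N \<times> carrier H,
      mult = (\<lambda>(n, h) (n', h'). (n \<otimes>\<^bsub>N\<^esub> \<theta> h n', h \<otimes>\<^bsub>H\<^esub> h')),
      one = (\<one>\<^bsub>N\<^esub>, \<one>\<^bsub>H\<^esub>)\<rparr>"


section \<open>Incidence structures and affine \<open>SL(2, 8)\<close>-unitals\<close>

text \<open>A pair of a point set and a set of blocks, each block being the set of its points.\<close>

type_synonym 'p incidence_structure = "'p set \<times> 'p set set"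

definition aut_incidence :: "'p incidence_structure \<Rightarrow> ('p \<Rightarrow> 'p) set" where
  "aut_incidence I = {\<alpha> \<in> Bij (fst I). (`) \<alpha> ` snd I = snd I}"

definition quotients :: "('a::field ^ 2 ^ 2) set \<Rightarrow> ('a ^ 2 ^ 2) set" where
  "quotients D = {x \<otimes>\<^bsub>SL2\<^esub> inv\<^bsub>SL2\<^esub> y | x y. x \<in> D \<and> y \<in> D \<and> x \<noteq> y}"

definition conjugates :: "('a::field ^ 2 ^ 2) set \<Rightarrow> ('a ^ 2 ^ 2) set set" where
  "conjugates T = {conj_map SL2 h ` T | h. h \<in> carrier SL2}"

text \<open>The field is meant to have \<open>8\<close> elements. The sets \<^term>\<open>quotients D\<close>, \<open>D \<in> \<D>\<close>, form an indexed
  family, so \<^const>\<open>partition_on\<close>, which sees only the set of its members, is accompanied by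
  injectivity of \<^const>\<open>quotients\<close> on \<open>\<D>\<close>.\<close>

definition affine_unital_data ::
    "('a::field ^ 2 ^ 2) set \<Rightarrow> ('a ^ 2 ^ 2) set \<Rightarrow> ('a ^ 2 ^ 2) set set \<Rightarrow> bool" where
  "affine_unital_data S T \<D> \<longleftrightarrow>
     subgroup S SL2 \<and> card S = 9 \<and>
     sylow_subgroup 2 SL2 T \<and>
     (\<forall>D \<in> \<D>. D \<subseteq> carrier SL2 \<and> \<one>\<^bsub>SL2\<^esub> \<in> D \<and> card D = 9 \<and>
        inj_on (\<lambda>(x, y). x \<otimes>\<^bsub>SL2\<^esub> inv\<^bsub>SL2\<^esub> y) {(x, y). x \<in> D \<and> y \<in> D \<and> x \<noteq> y}) \<and>
     inj_on quotients \<D> \<and>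
     partition_on (carrier SL2 - {\<one>\<^bsub>SL2\<^esub>})
       ({S - {\<one>\<^bsub>SL2\<^esub>}} \<union> {T' - {\<one>\<^bsub>SL2\<^esub>} | T'. T' \<in> conjugates T} \<union> quotients ` \<D>)"

definition unital ::
    "('a::field ^ 2 ^ 2) set \<Rightarrow> ('a ^ 2 ^ 2) set \<Rightarrow> ('a ^ 2 ^ 2) set set \<Rightarrow> ('a ^ 2 ^ 2) incidence_structure"
  where
  "unital S T \<D> =
     (carrier SL2,
      {S #>\<^bsub>SL2\<^esub> x | x. x \<in> carrier SL2} \<union>
      {T' #>\<^bsub>SL2\<^esub> x | T' x. T' \<in> conjugates T \<and> x \<in> carrier SL2} \<union>
      {D #>\<^bsub>SL2\<^esub> x | D x. D \<in> \<D> \<and> x \<in> carrier SL2})"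


section \<open>Permutations of \<open>SL(2, 8)\<close>\<close>

text \<open>Products in \<^const>\<open>BijGroup\<close> are \<open>\<alpha> \<otimes> \<beta> = \<alpha> \<circ> \<beta>\<close>, whereas maps acting from the right are
  composed in the opposite order. None of the notions used (subgroups, generated subgroups,
  normality, complements, index, isomorphism type) depends on this choice, since a group is
  isomorphic to its opposite.\<close>

abbreviation Perm_SL2 :: "('a::field ^ 2 ^ 2 \<Rightarrow> 'a ^ 2 ^ 2) monoid" where
  "Perm_SL2 \<equiv> BijGroup (carrier SL2)"

abbreviation perm_subgroup ::
    "('a::field ^ 2 ^ 2 \<Rightarrow> 'a ^ 2 ^ 2) set \<Rightarrow> ('a ^ 2 ^ 2 \<Rightarrow> 'a ^ 2 ^ 2) monoid" where
  "perm_subgroup A \<equiv> Perm_SL2\<lparr>carrier := A\<rparr>"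

definition Aut_stabilizer ::
    "('a::field ^ 2 ^ 2) incidence_structure \<Rightarrow> 'a ^ 2 ^ 2 \<Rightarrow> ('a ^ 2 ^ 2 \<Rightarrow> 'a ^ 2 ^ 2) set" where
  "Aut_stabilizer I x = stabilizer (perm_subgroup (aut_incidence I)) (\<lambda>\<alpha>. \<alpha>) x"

definition frob_mat :: "'a::field ^ 2 ^ 2 \<Rightarrow> 'a ^ 2 ^ 2" where
  "frob_mat A = (\<chi> i j. (A $ i $ j)\<^sup>2)"

definition frob :: "'a::field ^ 2 ^ 2 \<Rightarrow> 'a ^ 2 ^ 2" where
  "frob = restrict frob_mat (carrier SL2)"

definition mat_f :: "'a::field ^ 2 ^ 2" where
  "mat_f = mat2 0 1 1 0"

definition mat_g :: "'a::field \<Rightarrow> 'a ^ 2 ^ 2" where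
  "mat_g z = mat2 (z^2) (z^4) (z^4) z"

definition group_C :: "'a::field \<Rightarrow> ('a ^ 2 ^ 2) set" where
  "group_C z = generate SL2 {mat_g z}"

definition group_R :: "('a::field ^ 2 ^ 2 \<Rightarrow> 'a ^ 2 ^ 2) set" where
  "group_R = right_mult_map SL2 ` carrier SL2"

definition group_F :: "('a::field ^ 2 ^ 2 \<Rightarrow> 'a ^ 2 ^ 2) set" where
  "group_F = generate Perm_SL2 {conj_map SL2 mat_f}"

definition group_U :: "'a::field \<Rightarrow> ('a ^ 2 ^ 2 \<Rightarrow> 'a ^ 2 ^ 2) set" where
  "group_U z = generate Perm_SL2 {conj_map SL2 (mat_g z [^]\<^bsub>SL2\<^esub> (3::nat))}"

definition group_L :: "('a::field ^ 2 ^ 2 \<Rightarrow> 'a ^ 2 ^ 2) set" where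
  "group_L = generate Perm_SL2 {frob}"

text \<open>\<open>\<langle>\<gamma>\<^sub>f \<cdot> \<phi>\<rangle>\<close>, where \<open>\<gamma>\<^sub>f\<close> is applied first.\<close>

definition group_FL :: "('a::field ^ 2 ^ 2 \<Rightarrow> 'a ^ 2 ^ 2) set" where
  "group_FL = generate Perm_SL2 {compose (carrier SL2) frob (conj_map SL2 mat_f)}"

definition auto_stab :: "('a::field ^ 2 ^ 2) set \<Rightarrow> ('a ^ 2 ^ 2 \<Rightarrow> 'a ^ 2 ^ 2) set" where
  "auto_stab S = {\<alpha> \<in> auto SL2. \<alpha> ` S = S}"


section \<open>The two systems of blocks\<close>

definition H1 :: "'a::field \<Rightarrow> ('a ^ 2 ^ 2) set" where
  "H1 z = {mat 1, mat2 (z^5) 1 (z^5) (z^6), mat2 (z^4) (z^2) 1 (z^2),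
     mat2 0 z (z^6) (z^5), mat2 (z^3) (z^6) (z^4) (z^5), mat2 (z^3) z (z^6) 0,
     mat2 1 (z^2) 1 (z^6), mat2 (z^4) 1 (z^5) 1, mat2 (z^5) 0 0 (z^2)}"

definition H4 :: "'a::field \<Rightarrow> ('a ^ 2 ^ 2) set" where
  "H4 z = {mat 1, mat2 (z^5) 0 (z^6) (z^2), mat2 z (z^6) (z^4) 1,
     mat2 1 (z^5) (z^6) (z^5), mat2 z (z^4) 0 (z^6), mat2 (z^5) (z^2) (z^4) (z^4),
     mat2 0 (z^2) (z^5) (z^5), mat2 0 (z^4) (z^3) (z^4), mat2 (z^2) (z^5) (z^5) (z^6)}"

definition D1 :: "'a::field \<Rightarrow> ('a ^ 2 ^ 2) set" where
  "D1 z = {mat 1, mat2 (z^5) 1 (z^5) (z^6), mat2 (z^4) (z^2) 1 (z^2),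
     mat2 0 z (z^6) (z^2), mat2 1 (z^4) (z^2) (z^2), mat2 1 z (z^6) 0,
     mat2 1 (z^2) 1 (z^6), mat2 (z^4) 1 (z^5) 1, mat2 (z^5) 0 0 (z^2)}"

definition D4 :: "'a::field \<Rightarrow> ('a ^ 2 ^ 2) set" where
  "D4 z = {mat 1, mat2 (z^5) 0 (z^6) (z^2), mat2 z (z^6) (z^4) 1,
     mat2 0 z (z^6) (z^5), mat2 (z^4) 0 (z^2) (z^3), mat2 (z^5) (z^2) (z^3) (z^6),
     mat2 0 (z^2) (z^5) (z^5), mat2 0 (z^4) (z^3) (z^4), mat2 (z^2) (z^5) (z^5) (z^6)}"

text \<open>\<open>X\<close>, \<open>X \<cdot> \<phi>\<close>, \<open>X \<cdot> \<phi>\<^sup>2\<close>\<close>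

definition frob_orbit :: "('a::field ^ 2 ^ 2) set \<Rightarrow> ('a ^ 2 ^ 2) set set" where
  "frob_orbit X = {X, frob_mat ` X, frob_mat ` frob_mat ` X}"

definition system_H :: "'a::field \<Rightarrow> ('a ^ 2 ^ 2) set set" where
  "system_H z = frob_orbit (H1 z) \<union> frob_orbit (H4 z)"

definition system_D :: "'a::field \<Rightarrow> ('a ^ 2 ^ 2) set set" where
  "system_D z = frob_orbit (D1 z) \<union> frob_orbit (D4 z)"

definition WU :: "'a::field \<Rightarrow> ('a ^ 2 ^ 2) set \<Rightarrow> ('a ^ 2 ^ 2) incidence_structure" where
  "WU z T = unital (group_C z) T (system_D z)"

definition classical_unital :: "'a::field \<Rightarrow> ('a ^ 2 ^ 2) set \<Rightarrow> ('a ^ 2 ^ 2) incidence_structure" where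
  "classical_unital z T = unital (group_C z) T (system_H z)"

end

theory Submission
  imports Defs "HOL-Algebra.Multiplicative_Group"
begin

text \<open>The cosets of the Sylow \<open>2\<close>-subgroups are the affine lines on the quadric \<open>det = 1\<close>, and they are
  the only blocks with \<open>8\<close> points. Such a line has two directions, the Sylow subgroup \<open>P\<close> of which it
  is a right coset \<open>P x\<close> and the one, \<open>P\<^sup>x\<close>, of which it is a left coset; that two lines share
  exactly one direction can be read off from collinearity. Hence an automorphism \<open>\<alpha>\<close> fixing \<open>1\<close>
  permutes the Sylow subgroups and preserves or interchanges the two kinds of directions. As \<open>x\<close> is
  determined by the pairs \<open>(P, P\<^sup>x)\<close>, \<open>\<alpha>\<close> is an automorphism or an anti-automorphism of the group. It
  fixes \<open>C\<close>, the only block through \<open>1\<close> with \<open>9\<close> points that contains the square of one of its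
  elements other than \<open>1\<close>, and is not an anti-automorphism, because \<open>C\<close> is not normal. The automorphisms
  of \<open>SL(2, 8)\<close> that fix \<open>C\<close> are products of a \<open>\<gamma>\<close> of a power of \<open>g\<close> and a power of \<open>\<gamma>\<^sub>f \<cdot> \<phi>\<close>, since
  one that fixes \<open>g\<close> and one Sylow subgroup fixes all nine; which of them preserve the blocks is
  computed.\<close>

text \<open>In characteristic 2 a matrix of determinant 1 lies in a Sylow 2-subgroup exactly when
  its trace is 0. Collinearity of points on two lines is thus one equation, bilinear in the two line
  parameters, whose mixed coefficient is a product of two symplectic forms, one for each kind of
  direction. This is why collinearity can tell that exactly one direction is shared, but not which
  one. Inversion permutes the lines and interchanges the directions, so the lines alone cannot
  exclude anti-automorphisms; the blocks with 9 points have to do that. The trace also organizes the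
  partition. There are 504 - 64 = 440 elements of nonzero trace, and 440 = 8 + 6 * 72, so a
  repetition-free list of the quotients and of the nontrivial elements of C, all of nonzero trace,
  must exhaust them. Few maps need testing: \<gamma>_f and \<phi> for both systems, \<gamma>_g for
  the classical one, \<gamma>_(g^3) and \<gamma>_g for the other. Since every \<gamma>_(g^i) with i
  prime to 3 has \<gamma>_g among its powers, the failure of \<gamma>_g leaves only \<gamma>_(g^3).
  The stabilizers then have orders 3 * 6 and 9 * 6, whence the index 3.\<close>

lemma ex1_image_iff:
  assumes inj: "inj_on f A" and eq: "\<And>v. v \<in> A \<Longrightarrow> P (f v) \<longleftrightarrow> Q v"
  shows "(\<exists>!v. v \<in> f ` A \<and> P v) \<longleftrightarrow> (\<exists>!v. v \<in> A \<and> Q v)"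
proof
  assume "\<exists>!v. v \<in> f ` A \<and> P v"
  then obtain w where w: "w \<in> f ` A \<and> P w" and uniq: "\<forall>v. v \<in> f ` A \<and> P v \<longrightarrow> v = w"
    by (rule ex1E) (rule that)
  from w obtain a where a: "a \<in> A" "w = f a"
    by blast
  show "\<exists>!v. v \<in> A \<and> Q v"
  proof (rule ex1I)
    show "a \<in> A \<and> Q a"
      using a w eq[of a] by simp
  next
    fix v assume v: "v \<in> A \<and> Q v"
    then have "f v = f a"
      using uniq[rule_format, of "f v"] a(2) eq[of v] by simp
    then show "v = a"
      using inj v a(1) by (simp add: inj_on_eq_iff)
  qed
next
  assume "\<exists>!v. v \<in> A \<and> Q v"
  then obtain a where a: "a \<in> A \<and> Q a" and uniq: "\<forall>v. v \<in> A \<and> Q v \<longrightarrow> v = a"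
    by (rule ex1E) (rule that)
  show "\<exists>!v. v \<in> f ` A \<and> P v"
  proof (rule ex1I)
    show "f a \<in> f ` A \<and> P (f a)"
      using a eq[of a] by simp
  next
    fix v assume v: "v \<in> f ` A \<and> P v"
    then obtain b where b: "b \<in> A" "v = f b"
      by blast
    then have "b = a"
      using uniq[rule_format, of b] v eq[of b] by simp
    with b show "v = f a"
      by simp
  qed
qed

section \<open>Two by two matrices\<close>

lemma mat2_nth [simp]:
  "mat2 a b c d $ 1 $ 1 = a" "mat2 a b c d $ 1 $ 2 = b"
  "mat2 a b c d $ 2 $ 1 = c" "mat2 a b c d $ 2 $ 2 = d"
  by (simp_all add: mat2_def)

lemma mat2_eqI:
  "A $ 1 $ 1 = B $ 1 $ 1 \<Longrightarrow> A $ 1 $ 2 = B $ 1 $ 2 \<Longrightarrow> A $ 2 $ 1 = B $ 2 $ 1 \<Longrightarrow>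
    A $ 2 $ 2 = B $ 2 $ 2 \<Longrightarrow> A = (B :: 'b::zero ^ 2 ^ 2)"
  by (simp add: vec_eq_iff forall_2)

lemma mat2_eta: "mat2 (A $ 1 $ 1) (A $ 1 $ 2) (A $ 2 $ 1) (A $ 2 $ 2) = A"
  by (rule mat2_eqI) simp_all

lemma mat2_cases [cases type]:
  obtains a b c d where "A = mat2 a b c d"
  by (metis mat2_eta)

lemma mat2_inject [simp]:
  "mat2 a b c d = mat2 a' b' c' d' \<longleftrightarrow> a = a' \<and> b = b' \<and> c = c' \<and> d = d'"
  by (metis mat2_nth)

lemma mat2_mult [simp]:
  "mat2 a b c d ** mat2 a' b' c' d' =
    mat2 (a * a' + b * c') (a * b' + b * d') (c * a' + d * c') (c * b' + d * d' :: 'b::semiring_1)"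
  by (rule mat2_eqI) (simp_all add: matrix_matrix_mult_def sum_2)

lemma mat2_one: "mat 1 = mat2 1 0 0 (1::'b::semiring_1)"
  by (rule mat2_eqI) (simp_all add: mat_def)

lemma det_mat2 [simp]: "det (mat2 a b c d) = a * d - b * (c::'b::comm_ring_1)"
  by (simp add: det_2)

lemma trace_mat2 [simp]: "trace (mat2 a b c d) = a + d"
  by (simp add: trace_def sum_2)

lemma carrier_SL2 [simp]: "A \<in> carrier SL2 \<longleftrightarrow> det A = 1"
  and mult_SL2: "A \<otimes>\<^bsub>SL2\<^esub> B = A ** B"
  and one_SL2: "\<one>\<^bsub>SL2\<^esub> = mat 1"
  by (simp_all add: SL2_def)

lemma mat2_adjugate:
  assumes "det (mat2 a b c d) = (1::'b::comm_ring_1)"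
  shows "mat2 d (-b) (-c) a ** mat2 a b c d = mat 1"
  using assms by (simp add: mat2_one algebra_simps)

lemma group_SL2: "group (SL2 :: ('b::field ^ 2 ^ 2) monoid)"
proof (rule groupI)
  fix A :: "'b ^ 2 ^ 2" assume "A \<in> carrier SL2"
  then have "det A = 1" by simp
  moreover obtain a b c d where A: "A = mat2 a b c d" by (cases A)
  ultimately have "mat2 d (-b) (-c) a ** A = mat 1" "det (mat2 d (-b) (-c) a) = 1"
    using mat2_adjugate[of a b c d] by (simp_all add: algebra_simps)
  then show "\<exists>B\<in>carrier SL2. B \<otimes>\<^bsub>SL2\<^esub> A = \<one>\<^bsub>SL2\<^esub>"
    by (intro bexI[of _ "mat2 d (-b) (-c) a"]) (simp_all only: mult_SL2 one_SL2 carrier_SL2)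
qed (simp_all add: mult_SL2 one_SL2 det_mul matrix_mul_assoc)

interpretation SL2: group "SL2 :: ('b::field ^ 2 ^ 2) monoid"
  by (rule group_SL2)

abbreviation SL2_mult :: "'b::field ^ 2 ^ 2 \<Rightarrow> 'b ^ 2 ^ 2 \<Rightarrow> 'b ^ 2 ^ 2"  (infixl "\<cdot>" 70) where
  "x \<cdot> y \<equiv> x \<otimes>\<^bsub>SL2\<^esub> y"

abbreviation SL2_one :: "'b::field ^ 2 ^ 2"  ("\<one>\<^sub>S") where
  "\<one>\<^sub>S \<equiv> \<one>\<^bsub>SL2\<^esub>"

abbreviation SL2_inv :: "'b::field ^ 2 ^ 2 \<Rightarrow> 'b ^ 2 ^ 2"  ("inv\<^sub>S _" [81] 80) where
  "inv\<^sub>S x \<equiv> inv\<^bsub>SL2\<^esub> x"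

abbreviation SL2_pow :: "'b::field ^ 2 ^ 2 \<Rightarrow> nat \<Rightarrow> 'b ^ 2 ^ 2"  (infixl "\<up>" 75) where
  "x \<up> n \<equiv> x [^]\<^bsub>SL2\<^esub> n"

abbreviation SL2_coset :: "('b::field ^ 2 ^ 2) set \<Rightarrow> 'b ^ 2 ^ 2 \<Rightarrow> ('b ^ 2 ^ 2) set"  (infixl "#>\<^sub>S" 60) where
  "D #>\<^sub>S x \<equiv> D #>\<^bsub>SL2\<^esub> x"

lemma inv_SL2:
  assumes "det (mat2 a b c d) = (1::'b::field)"
  shows "inv\<^sub>S (mat2 a b c d) = mat2 d (-b) (-c) a"
  using assms mat2_adjugate[OF assms]
  by (intro SL2.inv_equality) (simp_all add: mult_SL2 one_SL2 algebra_simps del: mat2_mult)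

lemma conj_map_SL2:
  assumes "det h = 1" "det x = (1 :: 'b::field)"
  shows "conj_map SL2 h x = inv\<^sub>S h ** x ** h"
  using assms by (simp add: conj_map_def mult_SL2)

lemma inv_SL2_mult_cancel:
  assumes "det h = (1 :: 'b::field)"
  shows "inv\<^sub>S h ** h = mat 1" "h ** inv\<^sub>S h = mat 1"
  using assms SL2.l_inv[of h] SL2.r_inv[of h] by (simp_all add: mult_SL2 one_SL2)

lemma conj_map_eqI:
  assumes "det h = 1" "det x = (1 :: 'b::field)" "x ** h = h ** y"
  shows "conj_map SL2 h x = y"
  using assms inv_SL2_mult_cancel[of h]
  by (metis conj_map_SL2 matrix_mul_assoc matrix_mul_lid)

section \<open>The field with eight elements\<close>

text \<open>\<open>z_cubed\<close> singles out one of the two irreducible cubics over the prime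
  field; the exponents of \<open>z\<close> in the given matrices refer to this choice.\<close>

locale gf8 =
  fixes z :: "'a::field"
  assumes card_field: "CARD('a) = 8"
    and range_power: "range (\<lambda>n::nat. z ^ n) = UNIV - {0}"
    and z_cubed: "z ^ 3 = z + 1"
begin

lemma finite_field [simp]: "finite (UNIV :: 'a set)"
  using card_field by (rule_tac ccontr) simp

text \<open>Translation by 1 permutes the field, so the sum of all elements absorbs 8 = 2 ^ 3 copies
  of 1 without changing.\<close>

lemma two_eq_0: "(1::'a) + 1 = 0"
proof -
  have "(\<Sum>x\<in>UNIV. x) = (\<Sum>x\<in>UNIV. x + (1::'a))"
    by (rule sum.reindex_bij_witness[of _ "\<lambda>x. x + 1" "\<lambda>x. x - 1"]) auto
  also have "\<dots> = (\<Sum>x\<in>UNIV. x) + of_nat CARD('a)"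
    by (simp add: sum.distrib)
  finally have "(2::'a) ^ 3 = 0"
    using card_field by simp
  then show ?thesis
    by (simp only: power_eq_0_iff one_add_one)
qed

lemma add_self [simp]: "(x::'a) + x = 0"
  using two_eq_0 by (metis distrib_left mult.right_neutral mult_zero_right)

lemma numeral_char2 [simp]: "(numeral (num.Bit0 k) :: 'a) = 0" "(numeral (num.Bit1 k) :: 'a) = 1"
  unfolding numeral.simps by simp_all

lemma add_self_left [simp]: "(x::'a) + (x + y) = y"
  by (simp flip: add.assoc)

lemma uminus_eq [simp]: "- (x::'a) = x"
  by (metis add_self minus_unique)

lemma minus_eq [simp]: "(x::'a) - y = x + y"
  by (metis uminus_eq diff_conv_add_uminus)

lemma add_eq_0_iff2: "(x::'a) + y = 0 \<longleftrightarrow> x = y"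
  by (metis add_self add_left_imp_eq)

lemma z_power7: "z ^ 7 = 1"
proof -
  have step: "z ^ Suc n = z * z ^ n" for n
    by simp
  have 4: "z ^ 4 = z\<^sup>2 + z"
    using step[of 3] by (simp add: z_cubed power2_eq_square distrib_left)
  have 5: "z ^ 5 = z\<^sup>2 + z + 1"
    using step[of 4] z_cubed
    by (simp add: 4 mult.assoc power2_eq_square power3_eq_cube distrib_left add.commute add.left_commute)
  have 6: "z ^ 6 = z\<^sup>2 + 1"
    using step[of 5] z_cubed
    by (simp add: 5 mult.assoc power2_eq_square power3_eq_cube distrib_left add.commute add.left_commute)
  show "z ^ 7 = 1"
    using step[of 6] z_cubed
    by (simp add: 6 mult.assoc power2_eq_square power3_eq_cube distrib_left add.commute add.left_commute)
qed

text \<open>A nonzero element is a power of \<open>z\<close>, and \<open>z ^ 7 = 1\<close>. Below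
  this supplies square roots: that of \<open>x\<close> is \<open>x ^ 4\<close>.\<close>

lemma power8 [simp]: "(x::'a) ^ 8 = x"
proof (cases "x = 0")
  case False
  then have "x \<in> range (\<lambda>n::nat. z ^ n)"
    unfolding range_power by simp
  then obtain n where n: "x = z ^ n"
    by (rule rangeE)
  have "x ^ 7 = (z ^ 7) ^ n"
    unfolding n power_mult[symmetric] by (simp only: mult.commute)
  then have "x ^ 7 = 1"
    by (simp only: z_power7 power_one)
  then have "x ^ Suc 7 = x"
    by (simp only: power_Suc mult_1_right)
  moreover have "(8::nat) = Suc 7"
    by simp
  ultimately show ?thesis
    by (simp only:)
qed simp

lemma UNIV_eq: "UNIV = {0, 1, z, z ^ 2, z ^ 3, z ^ 4, z ^ 5, z ^ 6}"
proof -
  have *: "z ^ n \<in> {1, z, z ^ 2, z ^ 3, z ^ 4, z ^ 5, z ^ 6}" for n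
  proof -
    have "z ^ n = z ^ (n mod 7 + 7 * (n div 7))"
      by simp
    also have "\<dots> = z ^ (n mod 7)"
      by (simp only: power_add power_mult z_power7 power_one mult_1_right)
    finally have n: "z ^ n = z ^ (n mod 7)" .
    have "n mod 7 < 7"
      by simp
    then consider "n mod 7 = 0" | "n mod 7 = 1" | "n mod 7 = 2" | "n mod 7 = 3" | "n mod 7 = 4"
      | "n mod 7 = 5" | "n mod 7 = 6"
      by linarith
    then show ?thesis
      unfolding n by cases (simp_all del: z_power7)
  qed
  have "x \<in> {0, 1, z, z ^ 2, z ^ 3, z ^ 4, z ^ 5, z ^ 6}" for x
  proof (cases "x = 0")
    case False
    then have "x \<in> range (\<lambda>n::nat. z ^ n)"
      unfolding range_power by simp
    then obtain n where "x = z ^ n"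
      by (rule rangeE)
    with *[of n] show ?thesis
      by simp
  qed simp
  then show ?thesis
    by blast
qed

lemma inv_SL2_char2:
  assumes "a * d + b * c = (1::'a)"
  shows "inv\<^sub>S (mat2 a b c d) = mat2 d b c a"
  using inv_SL2[of a b c d] assms by simp

section \<open>The Sylow 2-subgroups\<close>

text \<open>The rank one nilpotent matrices are \<open>v v\<^sup>T J\<close> for \<open>v = (p, q)\<close> and \<open>J\<close> the symplectic form;
  \<open>root_elt p q k\<close> is \<open>1 + k v v\<^sup>T J\<close>.\<close>

definition root_elt :: "'a \<Rightarrow> 'a \<Rightarrow> 'a \<Rightarrow> 'a ^ 2 ^ 2" where
  "root_elt p q k = mat2 (1 + k * (p * q)) (k * p\<^sup>2) (k * q\<^sup>2) (1 + k * (p * q))"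

definition root_group :: "'a \<Rightarrow> 'a \<Rightarrow> ('a ^ 2 ^ 2) set" where
  "root_group p q = range (root_elt p q)"

text \<open>The nonzero pair \<open>(p, q)\<close> serves as homogeneous coordinates of a point of
  the projective line. No normal form is chosen; equality of the groups is decided by
  \<open>root_group_eq_iff\<close>.\<close>

definition root_groups :: "('a ^ 2 ^ 2) set set" where
  "root_groups = {root_group p q | p q. p \<noteq> 0 \<or> q \<noteq> 0}"

lemma root_groupsI [intro]: "p \<noteq> 0 \<or> q \<noteq> 0 \<Longrightarrow> root_group p q \<in> root_groups"
  by (auto simp: root_groups_def)

lemma root_groupsE [elim]:
  assumes "P \<in> root_groups"
  obtains p q where "P = root_group p q" "p \<noteq> 0 \<or> q \<noteq> 0"
  using assms by (auto simp: root_groups_def)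

lemma root_elt_0 [simp]: "root_elt p q 0 = mat 1"
  by (simp add: root_elt_def mat2_one)

lemma root_elt_add: "root_elt p q (k + l) = root_elt p q k ** root_elt p q l"
  by (simp add: root_elt_def algebra_simps power2_eq_square)

lemma det_root_elt [simp]: "det (root_elt p q k) = 1"
  by (simp add: root_elt_def algebra_simps power2_eq_square)

lemma trace_root_elt [simp]: "trace (root_elt p q k) = 0"
  by (simp add: root_elt_def)

lemma inj_root_elt: "p \<noteq> 0 \<or> q \<noteq> 0 \<Longrightarrow> inj (root_elt p q)"
  by (auto simp: inj_def root_elt_def)

lemma subgroup_root_group: "subgroup (root_group p q) SL2"
proof (rule SL2.subgroupI)
  fix x assume "x \<in> root_group p q"
  then obtain k where x: "x = root_elt p q k"
    by (auto simp: root_group_def)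
  have "inv\<^sub>S x = x"
    unfolding x by (rule SL2.inv_equality)
      (simp_all add: mult_SL2 one_SL2 flip: root_elt_add)
  then show "inv\<^sub>S x \<in> root_group p q"
    unfolding x by (auto simp: root_group_def)
qed (auto simp: root_group_def mult_SL2 simp flip: root_elt_add)

lemma card_root_group: "p \<noteq> 0 \<or> q \<noteq> 0 \<Longrightarrow> card (root_group p q) = 8"
  unfolding root_group_def using card_image[OF inj_root_elt] card_field by metis

text \<open>Scaling the vector by \<open>m\<close> multiplies the parameter by the square of
  \<open>m\<close>, and this is a bijection of the field.\<close>

lemma root_group_scale:
  assumes "m \<noteq> 0"
  shows "root_group (m * p) (m * q) = root_group p q"
proof -
  have "root_elt (m * p) (m * q) k = root_elt p q (m\<^sup>2 * k)" for k
    by (simp add: root_elt_def algebra_simps power2_eq_square)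
  moreover have "range (\<lambda>k. root_elt p q (m\<^sup>2 * k)) = range (root_elt p q)"
  proof -
    have "root_elt p q k = root_elt p q (m\<^sup>2 * (k / m\<^sup>2))" for k
      using assms by simp
    then show ?thesis
      by blast
  qed
  ultimately show ?thesis
    by (simp add: root_group_def)
qed

lemma proportional:
  assumes "p * s = q * (r::'a)" "p \<noteq> 0 \<or> q \<noteq> 0" "r \<noteq> 0 \<or> s \<noteq> 0"
  obtains m where "m \<noteq> 0" "r = m * p" "s = m * q"
proof (cases "p = 0")
  case True
  then show ?thesis using assms that[of "s / q"] by auto
next
  case False
  then have "r \<noteq> 0" using assms by auto
  then show ?thesis using assms False that[of "r / p"] by (auto simp: field_simps)
qed

text \<open>The expression \<open>p * s + q * r\<close> is the symplectic form of the two vectors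
  and vanishes iff they are proportional. The matrix entries give access to squares of coordinates,
  so what is shown to vanish is the square of the form, which is additive in characteristic
  2.\<close>

lemma root_group_eq_iff:
  assumes "p \<noteq> 0 \<or> q \<noteq> 0" "r \<noteq> 0 \<or> s \<noteq> 0"
  shows "root_group p q = root_group r s \<longleftrightarrow> p * s + q * r = 0"
proof
  assume "root_group p q = root_group r s"
  then have "root_elt p q 1 \<in> root_group r s"
    by (auto simp: root_group_def)
  then obtain k where "root_elt p q 1 = root_elt r s k"
    unfolding root_group_def by blast
  then have "p\<^sup>2 = k * r\<^sup>2" "q\<^sup>2 = k * s\<^sup>2"
    by (simp_all add: root_elt_def)
  moreover have "(p * s + q * r)\<^sup>2 = p\<^sup>2 * s\<^sup>2 + q\<^sup>2 * r\<^sup>2"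
    by (simp add: power2_eq_square algebra_simps)
  ultimately have "(p * s + q * r)\<^sup>2 = 0"
    by (simp add: mult.commute mult.left_commute)
  then show "p * s + q * r = 0"
    by simp
next
  assume "p * s + q * r = 0"
  then have "p * s = q * r"
    by (simp add: add_eq_0_iff2)
  then show "root_group p q = root_group r s"
    using proportional[OF _ assms] root_group_scale by metis
qed

lemma root_group_Int:
  assumes "p \<noteq> 0 \<or> q \<noteq> 0" "r \<noteq> 0 \<or> s \<noteq> 0" "root_group p q \<noteq> root_group r s"
  shows "root_group p q \<inter> root_group r s = {mat 1}"
proof -
  have "x = mat 1" if x: "x \<in> root_group p q" "x \<in> root_group r s" for x
  proof -
    obtain k l where kl: "x = root_elt p q k" "x = root_elt r s l"
      using x unfolding root_group_def by blast
    then have "k * p\<^sup>2 = l * r\<^sup>2" "k * q\<^sup>2 = l * s\<^sup>2"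
      by (simp_all add: root_elt_def)
    moreover have "k * (p * s + q * r)\<^sup>2 = k * p\<^sup>2 * s\<^sup>2 + k * q\<^sup>2 * r\<^sup>2"
      by (simp add: power2_eq_square algebra_simps)
    ultimately have "k * (p * s + q * r)\<^sup>2 = 0"
      by (simp add: mult.commute mult.left_commute)
    then have "k = 0"
      using assms root_group_eq_iff by auto
    then show ?thesis
      using kl by simp
  qed
  moreover have "mat 1 \<in> root_group p q" for p q
    by (metis root_elt_0 root_group_def rangeI)
  ultimately show ?thesis
    by blast
qed

text \<open>Trace 0 makes the diagonal constant, and the determinant then says that
  \<open>b * c\<close> is the square of \<open>1 + a\<close>. The square roots of \<open>b\<close>
  and \<open>c\<close> are the coordinates, so the parameter can be taken to be 1.\<close>

lemma trace0_root_elt: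
  assumes "det x = 1" "trace x = 0"
  obtains p q where "x = root_elt p q 1"
proof -
  obtain a b c d where x: "x = mat2 a b c d" by (cases x)
  have d: "d = a"
    using assms(2) unfolding x by (simp add: add_eq_0_iff2)
  have "a * a + b * c = 1"
    using assms(1) unfolding x d by simp
  then have bc: "b * c = (1 + a)\<^sup>2"
    using add_self_left[of "a * a" "b * c"]
    by (simp add: power2_eq_square distrib_left distrib_right add.commute)
  have sq: "(y ^ 4)\<^sup>2 = y" for y :: 'a
    by (simp flip: power_mult)
  have "b ^ 4 * c ^ 4 = ((1 + a)\<^sup>2) ^ 4"
    by (simp only: bc flip: power_mult_distrib)
  also have "\<dots> = 1 + a"
    by (simp only: power_mult[symmetric]) simp
  finally have "b ^ 4 * c ^ 4 = 1 + a" .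
  then have "x = root_elt (b ^ 4) (c ^ 4) 1"
    unfolding root_elt_def x d by (simp add: sq)
  then show ?thesis by (rule that)
qed

lemma Union_root_groups: "\<Union> root_groups = {x. det x = 1 \<and> trace x = 0}"
proof (rule equalityI; rule subsetI)
  fix x assume "x \<in> {x :: 'a ^ 2 ^ 2. det x = 1 \<and> trace x = 0}"
  then obtain p q where x: "x = root_elt p q 1"
    using trace0_root_elt by blast
  show "x \<in> \<Union> root_groups"
  proof (cases "p = 0 \<and> q = 0")
    case True
    \<comment> \<open>The zero vector names no root group, but here the element is the identity,
      which lies in all of them.\<close>
    then have "x = root_elt 1 0 0"
      by (simp add: x root_elt_def mat2_one)
    then have "x \<in> root_group 1 0"
      unfolding root_group_def by (rule range_eqI)
    then show ?thesis
      using root_groupsI[of 1 0] by (intro UnionI) auto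
  next
    case False
    moreover have "x \<in> root_group p q"
      unfolding x root_group_def by simp
    ultimately show ?thesis
      by (intro UnionI root_groupsI) auto
  qed
qed (auto simp: root_groups_def root_group_def)

text \<open>Conjugation by \<open>h\<close> moves the vector v to the inverse of \<open>h\<close>
  applied to v, because a matrix of determinant 1 preserves the symplectic form J. The new
  coordinates are the adjugate applied to \<open>(p, q)\<close>, without signs.\<close>

lemma conj_root_elt:
  assumes "a * d + b * c = (1::'a)"
  shows "conj_map SL2 (mat2 a b c d) (root_elt p q k) = root_elt (d * p + b * q) (c * p + a * q) k"
proof (rule conj_map_eqI)
  define r s where "r = d * p + b * q" and "s = c * p + a * q"
  have "a * r + b * s = (a * d + b * c) * p" "c * r + d * s = (a * d + b * c) * q"
    by (simp_all add: r_def s_def algebra_simps)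
  then have p: "p = a * r + b * s" and q: "q = c * r + d * s"
    using assms by simp_all
  have s: "q * a + p * c = s" and r: "q * b + p * d = r"
    by (simp_all add: r_def s_def algebra_simps)
  have "root_elt p q k ** mat2 a b c d =
    mat2 (a + k * (p * (q * a + p * c))) (b + k * (p * (q * b + p * d)))
      (c + k * (q * (q * a + p * c))) (d + k * (q * (q * b + p * d)))"
    by (simp add: root_elt_def power2_eq_square algebra_simps)
  also have "\<dots> = mat2 a b c d ** root_elt r s k"
    unfolding s r by (simp add: p q root_elt_def power2_eq_square algebra_simps)
  finally show "root_elt p q k ** mat2 a b c d = mat2 a b c d ** root_elt (d * p + b * q) (c * p + a * q) k"
    unfolding r_def s_def .
qed (use assms in simp_all)

lemma conj_root_group:
  assumes "a * d + b * c = (1::'a)"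
  shows "conj_map SL2 (mat2 a b c d) ` root_group p q = root_group (d * p + b * q) (c * p + a * q)"
  unfolding root_group_def image_image conj_root_elt[OF assms] ..

end

section \<open>Conjugation in an arbitrary group\<close>

lemma (in group) conj_map_closed [simp]:
  "h \<in> carrier G \<Longrightarrow> x \<in> carrier G \<Longrightarrow> conj_map G h x \<in> carrier G"
  by (simp add: conj_map_def)

lemma (in group) conj_map_mult:
  "h \<in> carrier G \<Longrightarrow> k \<in> carrier G \<Longrightarrow> x \<in> carrier G \<Longrightarrow>
    conj_map G (h \<otimes> k) x = conj_map G k (conj_map G h x)"
  by (simp add: conj_map_def inv_mult_group m_assoc)

lemma (in group) conj_map_one: "x \<in> carrier G \<Longrightarrow> conj_map G \<one> x = x"
  by (simp add: conj_map_def)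

lemma (in group) image_conj_map_mult:
  "h \<in> carrier G \<Longrightarrow> k \<in> carrier G \<Longrightarrow> P \<subseteq> carrier G \<Longrightarrow>
    conj_map G (h \<otimes> k) ` P = conj_map G k ` conj_map G h ` P"
  unfolding image_image by (rule image_cong) (auto simp: conj_map_mult)

lemma (in group) image_conj_map_one: "P \<subseteq> carrier G \<Longrightarrow> conj_map G \<one> ` P = P"
  by (force simp: conj_map_one image_iff)

section \<open>Group order, traces, and the action on the Sylow 2-subgroups\<close>

context gf8 begin

text \<open>If the top left entry is nonzero, it and the two off-diagonal entries determine the
  matrix: 7 * 64 cases. If it is zero, the second column does: 7 * 8 cases.\<close>

lemma card_SL2: "card (carrier (SL2 :: ('a ^ 2 ^ 2) monoid)) = 504"
proof -
  define X where "X = (\<lambda>(a::'a, b, c). mat2 a b c ((1 + b * c) / a)) ` ((UNIV - {0}) \<times> UNIV \<times> UNIV)"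
  define Y where "Y = (\<lambda>(b::'a, d). mat2 0 b (1 / b) d) ` ((UNIV - {0}) \<times> UNIV)"
  have "carrier SL2 = X \<union> Y"
  proof (rule equalityI; rule subsetI)
    fix x :: "'a ^ 2 ^ 2" assume "x \<in> carrier SL2"
    moreover obtain a b c d where x: "x = mat2 a b c d" by (cases x)
    ultimately have det: "a * d + b * c = 1" by simp
    show "x \<in> X \<union> Y"
    proof (cases "a = 0")
      case True
      then have "b * c = 1" using det by simp
      then have "b \<noteq> 0" "c = 1 / b"
        by (auto simp: eq_divide_eq mult.commute)
      then show ?thesis
        unfolding Y_def x True by (intro UnI2 image_eqI[of _ _ "(b, d)"]) auto
    next
      case False
      have "d * a = 1 + b * c"
        using det by (metis add_self_left add.commute mult.commute)
      then have "d = (1 + b * c) / a"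
        using False by (simp add: eq_divide_eq)
      then show ?thesis
        unfolding X_def x using False by (intro UnI1 image_eqI[of _ _ "(a, b, c)"]) auto
    qed
  next
    fix x assume "x \<in> X \<union> Y"
    then show "x \<in> carrier SL2"
      by (auto simp: X_def Y_def add.assoc split: if_splits)
  qed
  moreover have "X \<inter> Y = {}"
    by (auto simp: X_def Y_def)
  moreover have "card X = 7 * (8 * 8)"
    unfolding X_def by (subst card_image) (auto simp: inj_on_def card_cartesian_product card_field card_Diff_singleton)
  moreover have "card Y = 7 * 8"
    unfolding Y_def by (subst card_image) (auto simp: inj_on_def card_cartesian_product card_field card_Diff_singleton)
  moreover have "finite X" "finite Y"
    unfolding X_def Y_def by (intro finite_imageI finite_cartesian_product finite_Diff finite_field)+
  ultimately show ?thesis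
    by (simp add: card_Un_disjoint)
qed

lemma finite_SL2 [simp]: "finite (carrier (SL2 :: ('a ^ 2 ^ 2) monoid))"
  using card_SL2 card.infinite by fastforce

text \<open>By Cayley-Hamilton the trace of the square differs from the square of the trace by twice
  the determinant, which is 0 here.\<close>

lemma trace_square: "det x = 1 \<Longrightarrow> trace (x ** x) = (trace (x :: 'a ^ 2 ^ 2))\<^sup>2"
  by (cases x) (simp add: power2_eq_square algebra_simps)

text \<open>Three squarings turn the trace into its eighth power, which is the trace 1 + 1 = 0 of
  the identity.\<close>

lemma trace_eq_0_of_pow8:
  assumes "det (x :: 'a ^ 2 ^ 2) = 1" "x \<up> 8 = \<one>\<^sub>S"
  shows "trace x = 0"
proof -
  define y where "y = x ** x"
  have y: "det y = 1" "det (y ** y) = 1"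
    by (simp_all add: y_def det_mul assms(1))
  have "x \<up> 8 = (y ** y) ** (y ** y)"
    using assms(1) by (simp add: numeral_nat SL2.nat_pow_Suc mult_SL2 one_SL2 y_def matrix_mul_assoc)
  then have "(y ** y) ** (y ** y) = mat 1"
    using assms(2) by (simp add: one_SL2)
  then have "trace ((y ** y) ** (y ** y)) = 0"
    by (simp add: mat2_one)
  then have "((trace x ^ 2) ^ 2) ^ 2 = 0"
    using trace_square[of x] trace_square[of y] trace_square[of "y ** y"] y assms(1)
    by (simp only: y_def)
  then show ?thesis
    by simp
qed

lemma trace_root_elt_mult:
  "trace (root_elt p q k ** root_elt r s l) = k * l * (p * s + q * r)\<^sup>2"
  by (simp add: root_elt_def power2_eq_square algebra_simps)

lemma sylow_subgroup_iff: "sylow_subgroup 2 SL2 (Q :: ('a ^ 2 ^ 2) set) \<longleftrightarrow> subgroup Q SL2 \<and> card Q = 8"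
proof -
  have "multiplicity 2 (504::nat) = 3"
    using multiplicity_prime_elem_times_other[of 2 63 3] by (intro multiplicity_eqI) auto
  then show ?thesis
    by (simp add: sylow_subgroup_def order_def card_SL2)
qed

text \<open>All elements have order dividing 8, hence trace 0, so each is a root element. Fix one of
  them other than the identity: its products with the others have trace 0 as well, and by
  \<open>trace_root_elt_mult\<close> this forces all of them into the same root group. Comparing
  cardinalities finishes.\<close>

lemma sylow_root_group:
  assumes "sylow_subgroup 2 SL2 (T :: ('a ^ 2 ^ 2) set)"
  shows "T \<in> root_groups"
proof -
  have T: "subgroup T SL2" and card: "card T = 8"
    using assms by (simp_all add: sylow_subgroup_iff)
  interpret T: group "SL2\<lparr>carrier := T\<rparr>"
    using T by (rule SL2.subgroup_imp_group)
  have det: "det x = 1" if "x \<in> T" for x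
    using subgroup.mem_carrier[OF T that] by simp
  have tr: "trace x = 0" if "x \<in> T" for x
  proof -
    have "x [^]\<^bsub>SL2\<lparr>carrier := T\<rparr>\<^esub> order (SL2\<lparr>carrier := T\<rparr>) = \<one>\<^bsub>SL2\<lparr>carrier := T\<rparr>\<^esub>"
      using that by (intro T.pow_order_eq_1) simp
    then show ?thesis
      using trace_eq_0_of_pow8[OF det[OF that]] SL2.nat_pow_consistent[of x 8 T]
      by (simp add: order_def card)
  qed
  have "T \<noteq> {mat 1}"
    using card by auto
  moreover have "mat 1 \<in> T"
    using subgroup.one_closed[OF T] by (simp add: one_SL2)
  ultimately obtain t where t: "t \<in> T" "t \<noteq> mat 1"
    by blast
  obtain p q where pq: "t = root_elt p q 1"
    using trace0_root_elt det tr t by metis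
  have nz: "p \<noteq> 0 \<or> q \<noteq> 0"
    using t(2) pq by (auto simp: root_elt_def mat2_one)
  have "T \<subseteq> root_group p q"
  proof
    fix x assume x: "x \<in> T"
    then obtain r s where rs: "x = root_elt r s 1"
      using trace0_root_elt det tr by metis
    have "t ** x \<in> T"
      using subgroup.m_closed[OF T t(1) x] by (simp add: mult_SL2)
    then have "trace (t ** x) = 0"
      by (rule tr)
    then have "p * s + q * r = 0"
      by (simp add: pq rs trace_root_elt_mult)
    then show "x \<in> root_group p q"
      \<comment> \<open>The case \<open>r = s = 0\<close> is the identity matrix, to which
        \<open>root_group_eq_iff\<close> does not apply.\<close>
      using nz root_group_eq_iff[of p q r s] rs
      by (cases "r \<noteq> 0 \<or> s \<noteq> 0") (auto simp: root_group_def root_elt_def mat2_one intro: rangeI[of _ 0])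
  qed
  then have "T = root_group p q"
    using card card_root_group[OF nz] by (metis card_subset_eq card.infinite zero_neq_numeral)
  then show ?thesis
    using nz by blast
qed

lemma root_groups_subset: "P \<in> root_groups \<Longrightarrow> P \<subseteq> carrier SL2"
  by (auto simp: root_groups_def root_group_def)

lemma root_groups_conj:
  assumes "P \<in> root_groups" "det h = 1"
  shows "conj_map SL2 h ` P \<in> root_groups"
proof -
  obtain p q where P: "P = root_group p q" "p \<noteq> 0 \<or> q \<noteq> 0"
    using assms(1) by blast
  obtain a b c d where h: "h = mat2 a b c d" by (cases h)
  have det: "a * d + b * c = 1"
    using assms(2) h by simp
  have "a * (d * p + b * q) + b * (c * p + a * q) = (a * d + b * c) * p"
    "c * (d * p + b * q) + d * (c * p + a * q) = (a * d + b * c) * q"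
    by (simp_all add: algebra_simps)
  then have "d * p + b * q \<noteq> 0 \<or> c * p + a * q \<noteq> 0"
    using P(2) det by force
  then show ?thesis
    unfolding P h conj_root_group[OF det] by blast
qed

lemma root_groups_conj_10:
  assumes "Q \<in> root_groups"
  obtains h where "det h = 1" "Q = conj_map SL2 h ` root_group 1 0"
proof -
  obtain r s where Q: "Q = root_group r s" "r \<noteq> 0 \<or> s \<noteq> 0"
    using assms by blast
  \<comment> \<open>Any vector paired to 1 with \<open>(r, s)\<close> completes it to a matrix of
    determinant 1 whose conjugation takes the point (1, 0) to \<open>(r, s)\<close>.\<close>
  obtain a b where det: "a * r + b * s = 1"
    using Q(2) by (metis add_0_right add.commute mult_zero_left left_inverse)
  show ?thesis
    using conj_root_group[OF det, of 1 0] det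
    by (intro that[of "mat2 a b s r"]) (simp_all add: Q)
qed

lemma root_groups_transitive:
  assumes "P \<in> root_groups" "Q \<in> root_groups"
  obtains h where "det h = 1" "conj_map SL2 h ` P = Q"
proof -
  obtain h where h: "det h = 1" "P = conj_map SL2 h ` root_group 1 0"
    using assms(1) by (rule root_groups_conj_10)
  obtain k where k: "det k = 1" "Q = conj_map SL2 k ` root_group 1 0"
    using assms(2) by (rule root_groups_conj_10)
  have sub: "root_group 1 0 \<subseteq> carrier SL2"
    by (auto simp: root_group_def)
  have ih: "inv\<^sub>S h \<in> carrier SL2"
    using h(1) by (intro SL2.inv_closed) simp
  have "root_group 1 0 = conj_map SL2 (inv\<^sub>S h) ` P"
    unfolding h(2) using sub h(1) ih
    by (subst SL2.image_conj_map_mult[symmetric]) (auto simp: SL2.image_conj_map_one)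
  then have "Q = conj_map SL2 (inv\<^sub>S h \<cdot> k) ` P"
    using k ih root_groups_subset[OF assms(1)] by (subst SL2.image_conj_map_mult) auto
  then show ?thesis
    using that ih k(1) SL2.m_closed by (metis carrier_SL2)
qed

lemma conjugates_eq_root_groups:
  assumes "T \<in> root_groups"
  shows "conjugates T = root_groups"
proof (rule equalityI; rule subsetI)
  fix P assume "P \<in> conjugates T"
  then show "P \<in> root_groups"
    using root_groups_conj[OF assms] by (auto simp: conjugates_def)
next
  fix P assume "P \<in> root_groups"
  then show "P \<in> conjugates T"
    using root_groups_transitive[OF assms] by (metis (mono_tags, lifting) carrier_SL2 conjugates_def mem_Collect_eq)
qed

text \<open>Fixing the three points (1, 0), (0, 1) and (1, 1) of the projective line makes
  \<open>h\<close> scalar, and in characteristic 2 the only scalar of determinant 1 is 1.\<close>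

lemma root_groups_faithful:
  assumes "det h = 1" "\<And>P. P \<in> root_groups \<Longrightarrow> conj_map SL2 h ` P = P"
  shows "h = mat 1"
proof -
  obtain a b c d where h: "h = mat2 a b c d" by (cases h)
  have det: "a * d + b * c = 1"
    using assms(1) h by simp
  have *: "(d * p + b * q) * q + (c * p + a * q) * p = 0" if "p \<noteq> 0 \<or> q \<noteq> 0" for p q
  proof -
    have eq: "root_group (d * p + b * q) (c * p + a * q) = root_group p q"
      using assms(2)[of "root_group p q"] that conj_root_group[OF det, of p q] h by auto
    show ?thesis
    proof (cases "d * p + b * q \<noteq> 0 \<or> c * p + a * q \<noteq> 0")
      case True
      then show ?thesis
        using eq root_group_eq_iff[OF True that] by simp
    qed auto
  qed
  have "c = 0" "b = 0"
    using *[of 1 0] *[of 0 1] by simp_all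
  moreover from this have "d = a"
    using *[of 1 1] by (simp add: add_eq_0_iff2)
  ultimately have "(a + 1)\<^sup>2 = 0"
    using det by (simp add: power2_eq_square distrib_left distrib_right)
  then have "a = 1"
    by (simp add: add_eq_0_iff2)
  with \<open>b = 0\<close> \<open>c = 0\<close> \<open>d = a\<close> show ?thesis
    by (simp add: h mat2_one)
qed

text \<open>For fixed \<open>k\<close> the equation is affine in \<open>l\<close> with slope
  \<open>\<beta> + k * \<epsilon>\<close>. The slope is never zero exactly under the stated
  condition, since for \<open>\<epsilon>\<close> nonzero it vanishes at
  \<open>k = \<beta> / \<epsilon>\<close>.\<close>

lemma unique_root_iff:
  "(\<forall>k. \<exists>!l. t + k * \<alpha> + l * \<beta> + k * l * \<epsilon> = 0) \<longleftrightarrow> \<epsilon> = 0 \<and> \<beta> \<noteq> (0::'a)"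
proof -
  have *: "(\<exists>!l. u + l * v = 0) \<longleftrightarrow> v \<noteq> 0" for u v :: 'a
  proof (cases "v = 0")
    case False
    then have "u + l * v = 0 \<longleftrightarrow> l = u / v" for l
      by (auto simp: add_eq_0_iff2 field_simps)
    then show ?thesis using False by auto
  next
    case True
    then show ?thesis
      using zero_neq_one by (metis add_0_right mult_zero_right)
  qed
  have "t + k * \<alpha> + l * \<beta> + k * l * \<epsilon> = (t + k * \<alpha>) + l * (\<beta> + k * \<epsilon>)" for k l
    by (simp add: algebra_simps)
  then have "(\<forall>k. \<exists>!l. t + k * \<alpha> + l * \<beta> + k * l * \<epsilon> = 0) \<longleftrightarrow> (\<forall>k. \<beta> + k * \<epsilon> \<noteq> 0)"
    by (simp only: *)
  also have "\<dots> \<longleftrightarrow> \<epsilon> = 0 \<and> \<beta> \<noteq> 0"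
  proof (cases "\<epsilon> = 0")
    case False
    then have "\<beta> + (\<beta> / \<epsilon>) * \<epsilon> = 0"
      by simp
    with False show ?thesis by blast
  qed simp
  finally show ?thesis .
qed

text \<open>Two cosets \<open>P x\<close> and \<open>Q y\<close> are affine lines on the quadric \<open>det = 1\<close>; with \<open>h = x y\<^sup>-\<^sup>1\<close>, the
  condition says that collinearity is a perfect matching between them. The trace is the
  bilinear equation \<open>t + k \<alpha> + l \<beta> + k l \<gamma> \<delta> = 0\<close> in the parameters of the two lines, where
  \<open>\<delta> = 0\<close> iff \<open>P = Q\<close> and \<open>\<gamma> = 0\<close> iff \<open>P\<^sup>h = Q\<close>.\<close>

lemma matching_iff:
  assumes "P \<in> root_groups" "Q \<in> root_groups" "det h = 1"
  shows "(\<forall>u\<in>P. \<exists>!v. v \<in> Q \<and> trace (u ** h ** v) = 0) \<longleftrightarrow> (P = Q) \<noteq> (conj_map SL2 h ` P = Q)"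
proof -
  obtain p q where P: "P = root_group p q" "p \<noteq> 0 \<or> q \<noteq> 0"
    using assms(1) by blast
  obtain r s where Q: "Q = root_group r s" "r \<noteq> 0 \<or> s \<noteq> 0"
    using assms(2) by blast
  obtain a b c d where h: "h = mat2 a b c d" by (cases h)
  have det: "a * d + b * c = 1"
    using assms(3) h by simp
  \<comment> \<open>The vector of the conjugate of \<open>P\<close> by \<open>h\<close>, as in
    \<open>conj_root_elt\<close>.\<close>
  define p' q' where "p' = d * p + b * q" and "q' = c * p + a * q"
  \<comment> \<open>With v = \<open>(p, q)\<close> and w = \<open>(r, s)\<close>, the term of degree
    one in \<open>l\<close> is the symplectic form of w and hw, and the mixed term is the form of v
    and hw times the form of v and w; moving \<open>h\<close> to the other side makes the first
    factor the form of \<open>(p', q')\<close> and w.\<close>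
  define \<alpha> \<beta> \<gamma> \<delta> where "\<alpha> = c * p\<^sup>2 + b * q\<^sup>2 + (a + d) * (p * q)"
    and "\<beta> = c * r\<^sup>2 + b * s\<^sup>2 + (a + d) * (r * s)"
    and "\<gamma> = p' * s + q' * r" and "\<delta> = p * s + q * r"
  have trace: "trace (root_elt p q k ** h ** root_elt r s l) = (a + d) + k * \<alpha> + l * \<beta> + k * l * (\<gamma> * \<delta>)" for k l
    by (simp add: h root_elt_def \<alpha>_def \<beta>_def \<gamma>_def \<delta>_def p'_def q'_def power2_eq_square algebra_simps)
  have "(\<exists>!v. v \<in> Q \<and> trace (u ** h ** v) = 0) \<longleftrightarrow> (\<exists>!l. trace (u ** h ** root_elt r s l) = 0)" for u
    using ex1_image_iff[OF inj_root_elt[OF Q(2)], of "\<lambda>v. trace (u ** h ** v) = 0"]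
    by (simp add: Q root_group_def)
  then have 1: "(\<forall>u\<in>P. \<exists>!v. v \<in> Q \<and> trace (u ** h ** v) = 0) \<longleftrightarrow> \<gamma> * \<delta> = 0 \<and> \<beta> \<noteq> 0"
    unfolding P root_group_def by (simp add: trace unique_root_iff)
  have p'q': "p = a * p' + b * q'" "q = c * p' + d * q'"
  proof -
    have "a * p' + b * q' = (a * d + b * c) * p" "c * p' + d * q' = (a * d + b * c) * q"
      by (simp_all add: p'_def q'_def algebra_simps)
    then show "p = a * p' + b * q'" "q = c * p' + d * q'"
      using det by simp_all
  qed
  then have nz': "p' \<noteq> 0 \<or> q' \<noteq> 0"
    using P(2) by auto
  have \<delta>: "P = Q \<longleftrightarrow> \<delta> = 0"
    unfolding P Q \<delta>_def using P(2) Q(2) by (rule root_group_eq_iff)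
  have \<gamma>: "conj_map SL2 h ` P = Q \<longleftrightarrow> \<gamma> = 0"
    unfolding P Q h conj_root_group[OF det] \<gamma>_def p'_def[symmetric] q'_def[symmetric]
    using nz' Q(2) by (rule root_group_eq_iff)
  \<comment> \<open>If one of \<gamma> and \<delta> vanishes, w is proportional to one of the two
    vectors, and \<beta> becomes a nonzero multiple of the other form. So under
    \<open>\<gamma> * \<delta> = 0\<close> the condition on \<beta> excludes that both
    vanish.\<close>
  have "\<exists>m. m \<noteq> 0 \<and> \<beta> = m * \<gamma>" if "\<delta> = 0"
  proof -
    have "p * s = q * r"
      using that by (simp add: \<delta>_def add_eq_0_iff2)
    then obtain m where m: "m \<noteq> 0" "r = m * p" "s = m * q"
      using proportional P(2) Q(2) by metis
    have "\<beta> = m * \<gamma>"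
      by (simp add: \<beta>_def \<gamma>_def p'_def q'_def m power2_eq_square algebra_simps)
    with m show ?thesis by blast
  qed
  moreover have "\<exists>m. m \<noteq> 0 \<and> \<beta> = m * \<delta>" if "\<gamma> = 0"
  proof -
    have "p' * s = q' * r"
      using that by (simp add: \<gamma>_def add_eq_0_iff2)
    then obtain m where m: "m \<noteq> 0" "r = m * p'" "s = m * q'"
      using proportional nz' Q(2) by metis
    have "\<beta> = m * \<delta>"
      by (simp add: \<beta>_def \<delta>_def p'q' m power2_eq_square algebra_simps)
    with m show ?thesis by blast
  qed
  ultimately have "\<gamma> * \<delta> = 0 \<and> \<beta> \<noteq> 0 \<longleftrightarrow> (\<delta> = 0) \<noteq> (\<gamma> = 0)"
    by (cases "\<gamma> = 0"; cases "\<delta> = 0") auto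
  with 1 \<delta> \<gamma> show ?thesis by simp
qed

end

section \<open>Automorphisms of the geometry of short blocks\<close>

text \<open>The properties of the Sylow 2-subgroups on which the geometric argument rests. In
  \<open>fam_avoid\<close> four members are excluded because a new direction has to differ from both
  directions of each of two lines.\<close>

locale conjugate_family = group G for G (structure) +
  fixes \<T> :: "'a set set"
  assumes fam_subgroup: "P \<in> \<T> \<Longrightarrow> subgroup P G"
    and fam_conj: "P \<in> \<T> \<Longrightarrow> h \<in> carrier G \<Longrightarrow> conj_map G h ` P \<in> \<T>"
    and fam_transitive: "P \<in> \<T> \<Longrightarrow> Q \<in> \<T> \<Longrightarrow> \<exists>h\<in>carrier G. conj_map G h ` P = Q"
    and fam_faithful: "h \<in> carrier G \<Longrightarrow> (\<And>P. P \<in> \<T> \<Longrightarrow> conj_map G h ` P = P) \<Longrightarrow> h = \<one>"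
    and fam_matching: "P \<in> \<T> \<Longrightarrow> Q \<in> \<T> \<Longrightarrow> h \<in> carrier G \<Longrightarrow>
      (\<forall>u\<in>P. \<exists>!v. v \<in> Q \<and> u \<otimes> h \<otimes> v \<in> \<Union> \<T>) \<longleftrightarrow> (P = Q) \<noteq> (conj_map G h ` P = Q)"
    and fam_avoid: "\<exists>P\<in>\<T>. P \<noteq> A \<and> P \<noteq> B \<and> P \<noteq> C \<and> P \<noteq> D"
begin

abbreviation cj :: "'a set \<Rightarrow> 'a \<Rightarrow> 'a set" where
  "cj P h \<equiv> conj_map G h ` P"

lemma fam_subset: "P \<in> \<T> \<Longrightarrow> P \<subseteq> carrier G"
  using fam_subgroup subgroup.subset by blast

lemma fam_one: "P \<in> \<T> \<Longrightarrow> \<one> \<in> P"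
  using fam_subgroup subgroup.one_closed by blast

lemma cj_mult: "P \<in> \<T> \<Longrightarrow> x \<in> carrier G \<Longrightarrow> y \<in> carrier G \<Longrightarrow> cj P (x \<otimes> y) = cj (cj P x) y"
  by (rule image_conj_map_mult) (use fam_subset in auto)

lemma cj_one: "P \<in> \<T> \<Longrightarrow> cj P \<one> = P"
  by (rule image_conj_map_one) (use fam_subset in auto)

lemma cj_inv_iff:
  assumes "P \<in> \<T>" "Q \<in> \<T>" "x \<in> carrier G" "y \<in> carrier G"
  shows "cj P (x \<otimes> inv y) = Q \<longleftrightarrow> cj P x = cj Q y"
proof
  assume "cj P (x \<otimes> inv y) = Q"
  then have "cj Q y = cj P (x \<otimes> inv y \<otimes> y)"
    using assms by (subst cj_mult) auto
  then show "cj P x = cj Q y"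
    using assms by (simp add: m_assoc)
next
  assume "cj P x = cj Q y"
  then have "cj P (x \<otimes> inv y) = cj (cj Q y) (inv y)"
    using assms by (simp add: cj_mult)
  also have "\<dots> = cj Q (y \<otimes> inv y)"
    using assms by (simp only: cj_mult inv_closed)
  finally show "cj P (x \<otimes> inv y) = Q"
    using assms by (simp add: cj_one)
qed

section \<open>Lines and their two directions\<close>

definition short :: "'a set set" where
  "short = {P #> x | P x. P \<in> \<T> \<and> x \<in> carrier G}"

definition collinear :: "'a \<Rightarrow> 'a \<Rightarrow> bool" where
  "collinear u v \<longleftrightarrow> (\<exists>B\<in>short. u \<in> B \<and> v \<in> B)"

definition matched :: "'a set \<Rightarrow> 'a set \<Rightarrow> bool" where
  "matched l m \<longleftrightarrow> (\<forall>u\<in>l. \<exists>!v. v \<in> m \<and> collinear u v)"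

text \<open>For a line P x the two sets of quotients are P and the conjugate of P by x. Defining
  them by quotients makes them depend on the point set alone, not on a representation as a
  coset.\<close>

definition rdir :: "'a set \<Rightarrow> 'a set" where
  "rdir l = {u \<otimes> inv v | u v. u \<in> l \<and> v \<in> l}"

definition ldir :: "'a set \<Rightarrow> 'a set" where
  "ldir l = {inv u \<otimes> v | u v. u \<in> l \<and> v \<in> l}"

lemma shortI: "P \<in> \<T> \<Longrightarrow> x \<in> carrier G \<Longrightarrow> P #> x \<in> short"
  by (auto simp: short_def)

lemma shortE:
  assumes "l \<in> short"
  obtains P x where "P \<in> \<T>" "x \<in> carrier G" "l = P #> x"
  using assms unfolding short_def by blast

lemma short_subset: "l \<in> short \<Longrightarrow> l \<subseteq> carrier G"
  by (erule shortE) (simp add: fam_subset r_coset_subset_G)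

lemma mem_rcoset_iff:
  assumes "P \<in> \<T>" "x \<in> carrier G" "u \<in> carrier G"
  shows "u \<in> P #> x \<longleftrightarrow> u \<otimes> inv x \<in> P"
  using assms by (intro subgroup.rcos_module fam_subgroup is_group)

lemma rcoset_eq:
  assumes "P \<in> \<T>" "x \<in> carrier G" "u \<in> P #> x"
  shows "P #> x = P #> u"
  using assms repr_independence fam_subgroup by blast

lemma self_mem_rcoset: "P \<in> \<T> \<Longrightarrow> x \<in> carrier G \<Longrightarrow> x \<in> P #> x"
  using rcos_self fam_subgroup by blast

lemma short_rcoset:
  assumes "l \<in> short" "x \<in> l"
  obtains P where "P \<in> \<T>" "x \<in> carrier G" "l = P #> x"
proof -
  obtain P y where P: "P \<in> \<T>" "y \<in> carrier G" "l = P #> y"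
    using assms(1) by (rule shortE)
  then have "l = P #> x"
    using rcoset_eq assms(2) by simp
  moreover have "x \<in> carrier G"
    using assms short_subset by blast
  ultimately show ?thesis
    using that P(1) by blast
qed

lemma collinear_iff:
  assumes "u \<in> carrier G" "v \<in> carrier G"
  shows "collinear u v \<longleftrightarrow> u \<otimes> inv v \<in> \<Union> \<T>"
proof
  assume "collinear u v"
  then obtain B where B: "B \<in> short" "u \<in> B" "v \<in> B"
    by (auto simp: collinear_def)
  obtain P where "P \<in> \<T>" "B = P #> v"
    using B(1,3) by (rule short_rcoset)
  then show "u \<otimes> inv v \<in> \<Union> \<T>"
    using B(2) mem_rcoset_iff assms by auto
next
  assume "u \<otimes> inv v \<in> \<Union> \<T>"
  then obtain P where P: "P \<in> \<T>" "u \<otimes> inv v \<in> P" by blast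
  then show "collinear u v"
    unfolding collinear_def
    using assms shortI[OF P(1) assms(2)] self_mem_rcoset[OF P(1) assms(2)] mem_rcoset_iff[OF P(1) assms(2,1)]
    by (intro bexI[of _ "P #> v"] conjI) simp_all
qed

lemma rdir_rcoset:
  assumes "P \<in> \<T>" "x \<in> carrier G"
  shows "rdir (P #> x) = P"
proof (rule equalityI; rule subsetI)
  fix w assume "w \<in> rdir (P #> x)"
  then obtain u v where w: "w = u \<otimes> inv v" "u \<in> P #> x" "v \<in> P #> x"
    by (auto simp: rdir_def)
  moreover have "v \<in> carrier G" "u \<in> carrier G"
    using w(2,3) short_subset[OF shortI[OF assms]] by auto
  ultimately show "w \<in> P"
    using rcoset_eq[OF assms w(3)] mem_rcoset_iff[OF assms(1)] by auto
next
  fix w assume w: "w \<in> P"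
  then have wc: "w \<in> carrier G"
    using fam_subset assms by blast
  have "w \<otimes> x \<in> P #> x"
    using w by (auto simp: r_coset_def)
  moreover have "w = (w \<otimes> x) \<otimes> inv x"
    using wc assms by (simp add: m_assoc)
  ultimately show "w \<in> rdir (P #> x)"
    unfolding rdir_def using self_mem_rcoset[OF assms] by blast
qed

text \<open>The inverse of p x is the conjugate by x of the inverse of p, times the inverse of x.
  Hence inversion permutes the lines, and it interchanges their two directions.\<close>

lemma inv_rcoset:
  assumes "P \<in> \<T>" "x \<in> carrier G"
  shows "m_inv G ` (P #> x) = cj P x #> inv x"
proof (rule equalityI; rule subsetI)
  fix w assume "w \<in> m_inv G ` (P #> x)"
  then obtain p where p: "p \<in> P" "w = inv (p \<otimes> x)"
    by (auto simp: r_coset_def)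
  then have pc: "p \<in> carrier G" "inv p \<in> P" "inv p \<in> carrier G"
    using fam_subset assms subgroup.m_inv_closed[OF fam_subgroup] by auto
  then have "w = conj_map G x (inv p) \<otimes> inv x"
    using p assms by (simp add: conj_map_def inv_mult_group m_assoc)
  then show "w \<in> cj P x #> inv x"
    using pc by (auto simp: r_coset_def)
next
  fix w assume "w \<in> cj P x #> inv x"
  then obtain p where p: "p \<in> P" "w = conj_map G x p \<otimes> inv x"
    by (auto simp: r_coset_def)
  then have pc: "p \<in> carrier G" "inv p \<in> P"
    using fam_subset assms subgroup.m_inv_closed[OF fam_subgroup] by auto
  then have "w = inv (inv p \<otimes> x)"
    using p assms by (simp add: conj_map_def inv_mult_group m_assoc)
  then show "w \<in> m_inv G ` (P #> x)"
    using pc by (auto simp: r_coset_def)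
qed

lemma short_inv: "l \<in> short \<Longrightarrow> m_inv G ` l \<in> short"
  unfolding short_def using inv_rcoset fam_conj by blast

lemma inv_image_inv_image: "l \<subseteq> carrier G \<Longrightarrow> m_inv G ` m_inv G ` l = l"
  by (force simp: image_image image_iff)

lemma ldir_eq_rdir_inv:
  assumes "l \<subseteq> carrier G"
  shows "ldir l = rdir (m_inv G ` l)"
proof -
  have "inv (inv v) = v" if "v \<in> l" for v
    using that assms by auto
  then show ?thesis
    unfolding ldir_def rdir_def by (force simp: image_iff)
qed

lemma rdir_inv: "l \<in> short \<Longrightarrow> rdir (m_inv G ` l) = ldir l"
  by (simp add: ldir_eq_rdir_inv short_subset)

lemma ldir_inv: "l \<in> short \<Longrightarrow> ldir (m_inv G ` l) = rdir l"
  by (metis inv_image_inv_image ldir_eq_rdir_inv short_inv short_subset)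

lemma ldir_rcoset:
  assumes "P \<in> \<T>" "x \<in> carrier G"
  shows "ldir (P #> x) = cj P x"
  using assms by (simp add: rdir_inv[symmetric] shortI inv_rcoset rdir_rcoset fam_conj)

lemma dir_mem:
  assumes "l \<in> short"
  shows "rdir l \<in> \<T>" "ldir l \<in> \<T>"
  using assms rdir_rcoset ldir_rcoset fam_conj unfolding short_def by auto

text \<open>Any point of a line can serve as its coset representative, so each of them conjugates
  the one direction into the other. This ties the action of points on the family to the lines
  through them.\<close>

lemma dir_point:
  assumes "l \<in> short" "x \<in> l"
  shows "cj (rdir l) x = ldir l"
  using short_rcoset[OF assms] rdir_rcoset ldir_rcoset by metis

lemma ex_short_dir:
  assumes "P \<in> \<T>" "Q \<in> \<T>"
  obtains l where "l \<in> short" "rdir l = P" "ldir l = Q"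
  using fam_transitive[OF assms] rdir_rcoset ldir_rcoset shortI assms by metis

lemma fam_short:
  assumes "P \<in> \<T>"
  shows "P \<in> short" "rdir P = P" "ldir P = P"
proof -
  have "P = P #> \<one>"
    using fam_subset[OF assms] by simp
  then show "P \<in> short" "rdir P = P" "ldir P = P"
    using shortI[OF assms one_closed] rdir_rcoset[OF assms one_closed] ldir_rcoset[OF assms one_closed]
      cj_one[OF assms] by simp_all
qed

lemma short_one:
  assumes "l \<in> short" "\<one> \<in> l"
  shows "l \<in> \<T>"
  using short_rcoset[OF assms] fam_subset by (metis coset_mult_one)

lemma matched_rcosets:
  assumes "P \<in> \<T>" "Q \<in> \<T>" "x \<in> carrier G" "y \<in> carrier G"
  shows "matched (P #> x) (Q #> y) \<longleftrightarrow> (P = Q) \<noteq> (cj P x = cj Q y)"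
proof -
  have *: "(\<exists>!v. v \<in> Q #> y \<and> collinear (p \<otimes> x) v) \<longleftrightarrow>
      (\<exists>!q. q \<in> Q \<and> p \<otimes> (x \<otimes> inv y) \<otimes> q \<in> \<Union> \<T>)" if p: "p \<in> P" for p
  proof -
    have pc: "p \<in> carrier G"
      using p fam_subset assms by blast
    \<comment> \<open>Running through the second line by inverses turns the quotient of two points
      into the product \<open>p \<otimes> (x \<otimes> inv y) \<otimes> q\<close> of
      \<open>fam_matching\<close>.\<close>
    define f where "f = (\<lambda>q. inv q \<otimes> y)"
    have f: "bij_betw f Q (Q #> y)"
    proof (rule bij_betwI')
      fix q q' assume q: "q \<in> Q" "q' \<in> Q"
      then have "q \<in> carrier G" "q' \<in> carrier G"
        using fam_subset assms by auto
      then show "(f q = f q') = (q = q')"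
        using assms inv_inj by (simp add: f_def inj_on_eq_iff)
    next
      fix q assume "q \<in> Q"
      then show "f q \<in> Q #> y"
        using subgroup.m_inv_closed[OF fam_subgroup[OF assms(2)]] by (auto simp: f_def r_coset_def)
    next
      fix v assume "v \<in> Q #> y"
      then obtain q where q: "q \<in> Q" "v = q \<otimes> y"
        by (auto simp: r_coset_def)
      then have "v = f (inv q)" "inv q \<in> Q"
        using subgroup.m_inv_closed[OF fam_subgroup[OF assms(2)]] fam_subset[OF assms(2)] by (auto simp: f_def)
      then show "\<exists>q\<in>Q. v = f q"
        by blast
    qed
    have "collinear (p \<otimes> x) (f q) \<longleftrightarrow> p \<otimes> (x \<otimes> inv y) \<otimes> q \<in> \<Union> \<T>" if "q \<in> Q" for q
    proof -
      have "q \<in> carrier G"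
        using that fam_subset assms by auto
      then have "(p \<otimes> x) \<otimes> inv (f q) = p \<otimes> (x \<otimes> inv y) \<otimes> q" "f q \<in> carrier G"
        using pc assms by (simp_all add: f_def inv_mult_group m_assoc)
      then show ?thesis
        using collinear_iff[of "p \<otimes> x" "f q"] pc assms by simp
    qed
    moreover have "Q #> y = f ` Q" "inj_on f Q"
      using f by (simp_all add: bij_betw_def)
    ultimately show ?thesis
      by (simp only: ex1_image_iff)
  qed
  have "matched (P #> x) (Q #> y) \<longleftrightarrow> (\<forall>p\<in>P. \<exists>!v. v \<in> Q #> y \<and> collinear (p \<otimes> x) v)"
    unfolding matched_def r_coset_def[of G P] by blast
  also have "\<dots> \<longleftrightarrow> (P = Q) \<noteq> (cj P (x \<otimes> inv y) = Q)"
    using * fam_matching[of P Q "x \<otimes> inv y"] assms by simp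
  finally show ?thesis
    using cj_inv_iff assms by simp
qed

lemma matched_iff:
  assumes "l \<in> short" "m \<in> short"
  shows "matched l m \<longleftrightarrow> (rdir l = rdir m) \<noteq> (ldir l = ldir m)"
proof -
  obtain P x where P: "P \<in> \<T>" "x \<in> carrier G" and l: "l = P #> x"
    using assms(1) by (rule shortE)
  obtain Q y where Q: "Q \<in> \<T>" "y \<in> carrier G" and m: "m = Q #> y"
    using assms(2) by (rule shortE)
  show ?thesis
    unfolding l m rdir_rcoset[OF P] rdir_rcoset[OF Q] ldir_rcoset[OF P] ldir_rcoset[OF Q]
    using P(1) Q(1) P(2) Q(2) by (rule matched_rcosets)
qed

section \<open>Permutations that fix 1 and preserve the set of lines\<close>

definition short_aut :: "('a \<Rightarrow> 'a) \<Rightarrow> bool" where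
  "short_aut \<alpha> \<longleftrightarrow> bij_betw \<alpha> (carrier G) (carrier G) \<and> (`) \<alpha> ` short = short \<and> \<alpha> \<one> = \<one>"

context
  fixes \<alpha> assumes \<alpha>: "short_aut \<alpha>"
begin

lemma bij_\<alpha>: "bij_betw \<alpha> (carrier G) (carrier G)"
  and image_\<alpha>: "l \<in> short \<Longrightarrow> \<alpha> ` l \<in> short"
  and \<alpha>_one: "\<alpha> \<one> = \<one>"
  using \<alpha> by (auto simp: short_aut_def)

lemma \<alpha>_surj_short:
  assumes "l \<in> short"
  obtains l' where "l' \<in> short" "l = \<alpha> ` l'"
  using assms \<alpha> unfolding short_aut_def by blast

lemma \<alpha>_closed [simp]: "x \<in> carrier G \<Longrightarrow> \<alpha> x \<in> carrier G"
  using bij_\<alpha> bij_betwE by blast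

lemma \<alpha>_mem_iff: "x \<in> carrier G \<Longrightarrow> l \<in> short \<Longrightarrow> \<alpha> x \<in> \<alpha> ` l \<longleftrightarrow> x \<in> l"
  using bij_\<alpha> short_subset by (metis bij_betw_imp_inj_on inj_on_image_mem_iff)

lemma \<alpha>_image_eq_iff: "l \<in> short \<Longrightarrow> m \<in> short \<Longrightarrow> \<alpha> ` l = \<alpha> ` m \<longleftrightarrow> l = m"
  using bij_\<alpha> short_subset by (metis bij_betw_imp_inj_on inj_on_image_eq_iff)

lemma collinear_\<alpha>:
  assumes "u \<in> carrier G" "v \<in> carrier G"
  shows "collinear (\<alpha> u) (\<alpha> v) \<longleftrightarrow> collinear u v"
proof
  assume "collinear (\<alpha> u) (\<alpha> v)"
  then obtain B where B: "B \<in> short" "\<alpha> u \<in> B" "\<alpha> v \<in> B"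
    unfolding collinear_def by blast
  obtain B' where "B' \<in> short" "B = \<alpha> ` B'"
    using B(1) by (rule \<alpha>_surj_short)
  then show "collinear u v"
    unfolding collinear_def using B \<alpha>_mem_iff assms by (intro bexI[of _ B']) auto
next
  assume "collinear u v"
  then show "collinear (\<alpha> u) (\<alpha> v)"
    unfolding collinear_def using image_\<alpha> by (meson imageI)
qed

lemma matched_\<alpha>:
  assumes "l \<in> short" "m \<in> short"
  shows "matched (\<alpha> ` l) (\<alpha> ` m) \<longleftrightarrow> matched l m"
proof -
  have "(\<exists>!v. v \<in> \<alpha> ` m \<and> collinear (\<alpha> u) v) \<longleftrightarrow> (\<exists>!v. v \<in> m \<and> collinear u v)" if "u \<in> l" for u
  proof -
    have u: "u \<in> carrier G"
      using that short_subset assms by blast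
    have m: "\<And>v. v \<in> m \<Longrightarrow> v \<in> carrier G"
      using short_subset assms by blast
    have inj: "\<And>v w. v \<in> m \<Longrightarrow> w \<in> m \<Longrightarrow> \<alpha> v = \<alpha> w \<Longrightarrow> v = w"
      using m bij_\<alpha> by (meson bij_betw_imp_inj_on inj_onD)
    have "inj_on \<alpha> m"
      using inj by (rule inj_onI)
    then show ?thesis
      using collinear_\<alpha>[OF u m] by (rule ex1_image_iff)
  qed
  then show ?thesis
    unfolding matched_def by simp
qed

text \<open>The members of the family are precisely the lines through 1, and 1 is fixed.\<close>

lemma image_fam: "P \<in> \<T> \<Longrightarrow> \<alpha> ` P \<in> \<T>"
  using short_one image_\<alpha> fam_short(1) fam_one \<alpha>_one by (metis imageI)

lemma image_fam_surj:
  assumes "Q \<in> \<T>"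
  obtains P where "P \<in> \<T>" "Q = \<alpha> ` P"
proof -
  obtain P where P: "P \<in> short" "Q = \<alpha> ` P"
    using \<alpha>_surj_short fam_short(1)[OF assms] by metis
  have "\<one> \<in> P"
    using \<alpha>_mem_iff[OF one_closed P(1)] \<alpha>_one fam_one[OF assms] P by simp
  then show ?thesis
    using that P short_one by blast
qed

lemma image_fam_eq_iff: "P \<in> \<T> \<Longrightarrow> Q \<in> \<T> \<Longrightarrow> \<alpha> ` P = \<alpha> ` Q \<longleftrightarrow> P = Q"
  using \<alpha>_image_eq_iff fam_short(1) by blast

text \<open>A member \<open>P\<close> of the family is itself a line, with both directions equal to
  \<open>P\<close>. So being matched with \<open>P\<close> tests whether \<open>P\<close> is exactly
  one of the two directions, and matching is invariant.\<close>

lemma dir_image_matched: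
  assumes "l \<in> short" "P \<in> \<T>"
  shows "((rdir (\<alpha> ` l) = \<alpha> ` P) \<noteq> (ldir (\<alpha> ` l) = \<alpha> ` P)) \<longleftrightarrow> ((rdir l = P) \<noteq> (ldir l = P))"
  using matched_\<alpha>[of l P] matched_iff[of l P] matched_iff[of "\<alpha> ` l" "\<alpha> ` P"]
    assms fam_short image_fam image_\<alpha> by simp

definition straight :: "'a set \<Rightarrow> bool" where
  "straight l \<longleftrightarrow> rdir (\<alpha> ` l) = \<alpha> ` rdir l \<and> ldir (\<alpha> ` l) = \<alpha> ` ldir l"

definition skew :: "'a set \<Rightarrow> bool" where
  "skew l \<longleftrightarrow> rdir (\<alpha> ` l) = \<alpha> ` ldir l \<and> ldir (\<alpha> ` l) = \<alpha> ` rdir l"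

text \<open>By \<open>dir_image_matched\<close>, the image of each of the two directions is exactly
  one direction of the image line. These images are distinct, so they fill both places, in one of
  the two orders.\<close>

lemma straight_or_skew:
  assumes "l \<in> short" "rdir l \<noteq> ldir l"
  shows "straight l \<noteq> skew l"
proof -
  have "\<alpha> ` rdir l \<noteq> \<alpha> ` ldir l"
    using image_fam_eq_iff dir_mem assms by blast
  then show ?thesis
    using dir_image_matched[OF assms(1) dir_mem(1)[OF assms(1)]]
      dir_image_matched[OF assms(1) dir_mem(2)[OF assms(1)]] assms(2)
    unfolding straight_def skew_def by argo
qed

text \<open>No member of the family occurs exactly once as a direction of \<open>l\<close>, so none
  does for the image. Which member the common direction becomes is left open here.\<close>

lemma diagonal_image:
  assumes "l \<in> short" "rdir l = ldir l"
  shows "rdir (\<alpha> ` l) = ldir (\<alpha> ` l)"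
proof -
  obtain P where "P \<in> \<T>" "rdir (\<alpha> ` l) = \<alpha> ` P"
    using image_fam_surj dir_mem(1) image_\<alpha> assms(1) by metis
  then show ?thesis
    using dir_image_matched[OF assms(1)] assms(2) by metis
qed

text \<open>Suppose \<open>m\<close> were skew. The matching of the images then makes exactly one
  crosswise pair of directions of \<open>l\<close> and \<open>m\<close> equal, while the matching of
  \<open>l\<close> and \<open>m\<close> makes exactly one parallel pair equal. Either combination
  forces the two directions of \<open>l\<close>, or those of \<open>m\<close>, to coincide.\<close>

lemma straight_matched:
  assumes "l \<in> short" "m \<in> short" "rdir l \<noteq> ldir l" "rdir m \<noteq> ldir m" "matched l m" "straight l"
  shows "straight m"
proof (rule ccontr)
  assume "\<not> straight m"
  then have "skew m"
    using straight_or_skew assms by blast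
  moreover have "matched (\<alpha> ` l) (\<alpha> ` m)"
    using matched_\<alpha> assms by blast
  ultimately have "(\<alpha> ` rdir l = \<alpha> ` ldir m) \<noteq> (\<alpha> ` ldir l = \<alpha> ` rdir m)"
    using assms(1,2,6) by (simp add: matched_iff image_\<alpha> straight_def skew_def)
  then have "(rdir l = ldir m) \<noteq> (ldir l = rdir m)"
    using image_fam_eq_iff dir_mem assms(1,2) by simp
  moreover have "(rdir l = rdir m) \<noteq> (ldir l = ldir m)"
    using matched_iff assms by blast
  ultimately show False
    using assms(3,4) by argo
qed

lemma straight_all:
  assumes "l \<in> short" "m \<in> short" "rdir l \<noteq> ldir l" "rdir m \<noteq> ldir m" "straight l"
  shows "straight m"
proof -
  obtain K where K: "K \<in> \<T>" "K \<noteq> rdir l" "K \<noteq> ldir l" "K \<noteq> rdir m" "K \<noteq> ldir m"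
    using fam_avoid[of "rdir l" "ldir l" "rdir m" "ldir m"] by blast
  \<comment> \<open>With \<open>K\<close> as new left direction, \<open>l\<close>,
    \<open>l1\<close>, \<open>m1\<close>, \<open>m\<close> form a chain in which neighbours share
    exactly one direction; if \<open>l\<close> and \<open>m\<close> have the same right direction,
    the chain is \<open>l\<close>, \<open>l1\<close>, \<open>m\<close>.\<close>
  obtain l1 where l1: "l1 \<in> short" "rdir l1 = rdir l" "ldir l1 = K"
    using dir_mem(1)[OF assms(1)] K(1) by (rule ex_short_dir)
  obtain m1 where m1: "m1 \<in> short" "rdir m1 = rdir m" "ldir m1 = K"
    using dir_mem(1)[OF assms(2)] K(1) by (rule ex_short_dir)
  have "straight l1"
    by (rule straight_matched[of l]) (use assms l1 K matched_iff in auto)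
  show ?thesis
  proof (cases "rdir l = rdir m")
    case True
    show ?thesis
      by (rule straight_matched[of l1]) (use assms l1 K True \<open>straight l1\<close> matched_iff in auto)
  next
    case False
    have "straight m1"
      by (rule straight_matched[of l1]) (use assms l1 m1 K False \<open>straight l1\<close> matched_iff in auto)
    show ?thesis
      by (rule straight_matched[of m1]) (use assms m1 K \<open>straight m1\<close> matched_iff in auto)
  qed
qed

text \<open>Straightness makes \<alpha> compatible with the conjugation action on the family. Then
  the image of a product and the product of the images act alike on all members, and the action is
  faithful.\<close>

lemma straight_imp_mult:
  assumes straight: "\<And>l. l \<in> short \<Longrightarrow> rdir l \<noteq> ldir l \<Longrightarrow> straight l"
    and "x \<in> carrier G" "y \<in> carrier G"
  shows "\<alpha> (x \<otimes> y) = \<alpha> x \<otimes> \<alpha> y"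
proof -
  have cj: "cj (\<alpha> ` P) (\<alpha> x) = \<alpha> ` cj P x" if P: "P \<in> \<T>" and x: "x \<in> carrier G" for P x
  proof (cases "cj P x = P")
    case False
    define l where "l = P #> x"
    have l: "l \<in> short" "rdir l = P" "ldir l = cj P x" "x \<in> l"
      using P x by (simp_all add: l_def shortI rdir_rcoset ldir_rcoset self_mem_rcoset)
    then have "straight l"
      using straight False by simp
    moreover have "cj (rdir (\<alpha> ` l)) (\<alpha> x) = ldir (\<alpha> ` l)"
      using l image_\<alpha> by (intro dir_point) auto
    ultimately show ?thesis
      using l by (simp add: straight_def)
  next
    case True
    define m where "m = \<alpha> ` P #> \<alpha> x"
    have m: "m \<in> short" "rdir m = \<alpha> ` P" "ldir m = cj (\<alpha> ` P) (\<alpha> x)" "\<alpha> x \<in> m"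
      using P x image_fam by (simp_all add: m_def shortI rdir_rcoset ldir_rcoset self_mem_rcoset)
    obtain l where l: "l \<in> short" "m = \<alpha> ` l"
      using \<alpha>_surj_short m(1) by metis
    have "x \<in> l"
      using \<alpha>_mem_iff x l m(4) by simp
    then have xl: "cj (rdir l) x = ldir l"
      using dir_point l(1) by blast
    have "rdir l = ldir l"
    proof (rule ccontr)
      assume ne: "rdir l \<noteq> ldir l"
      then have "\<alpha> ` rdir l = \<alpha> ` P"
        using straight l m(2) by (simp add: straight_def)
      then have "rdir l = P"
        using image_fam_eq_iff dir_mem(1) l(1) P by blast
      then show False
        using ne xl True by simp
    qed
    then have "rdir m = ldir m"
      using diagonal_image l by simp
    then show ?thesis
      using m True by simp
  qed
  have "\<alpha> (x \<otimes> y) \<otimes> inv (\<alpha> x \<otimes> \<alpha> y) = \<one>"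
  proof (rule fam_faithful)
    fix Q assume "Q \<in> \<T>"
    then obtain P where P: "P \<in> \<T>" "Q = \<alpha> ` P"
      by (rule image_fam_surj)
    have "cj Q (\<alpha> (x \<otimes> y)) = cj Q (\<alpha> x \<otimes> \<alpha> y)"
      using P assms(2,3) by (simp add: cj cj_mult image_fam fam_conj)
    then show "cj Q (\<alpha> (x \<otimes> y) \<otimes> inv (\<alpha> x \<otimes> \<alpha> y)) = Q"
      using \<open>Q \<in> \<T>\<close> assms(2,3) by (subst cj_inv_iff) auto
  qed (use assms in auto)
  then have "\<alpha> (x \<otimes> y) = inv (inv (\<alpha> x \<otimes> \<alpha> y))"
    using assms(2,3) by (intro inv_equality[symmetric]) auto
  then show ?thesis
    using assms(2,3) by simp
qed

end

lemma short_aut_inv: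
  assumes "short_aut \<alpha>"
  shows "short_aut (\<lambda>x. inv (\<alpha> x))"
proof -
  have "bij_betw (m_inv G \<circ> \<alpha>) (carrier G) (carrier G)"
    using bij_\<alpha>[OF assms] by (rule bij_betw_trans) (auto intro!: bij_betwI[of _ _ _ "m_inv G"])
  moreover have "(`) (m_inv G) ` short = short"
  proof (rule equalityI; rule subsetI)
    fix l assume "l \<in> short"
    then show "l \<in> (`) (m_inv G) ` short"
      using inv_image_inv_image short_subset short_inv by (metis imageI)
  qed (auto simp: short_inv)
  moreover have "(`) (\<lambda>x. inv (\<alpha> x)) ` short = (`) (m_inv G) ` (`) \<alpha> ` short"
    by (simp add: image_image)
  ultimately show ?thesis
    using assms unfolding short_aut_def by (simp add: comp_def)
qed

text \<open>Inversion fixes every member of the family as a set and interchanges the directions of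
  every line.\<close>

lemma skew_imp_straight_inv:
  assumes "short_aut \<alpha>" "l \<in> short" "skew \<alpha> l"
  shows "straight (\<lambda>x. inv (\<alpha> x)) l"
proof -
  have "m_inv G ` P = P" if "P \<in> \<T>" for P
    using inv_rcoset[OF that one_closed] fam_subset[OF that] cj_one[OF that] by simp
  moreover have "(\<lambda>x. inv (\<alpha> x)) ` l = m_inv G ` \<alpha> ` l" for l
    by (simp add: image_image)
  ultimately show ?thesis
    using assms dir_mem image_fam[OF assms(1)] image_\<alpha>[OF assms(1)]
    by (simp add: straight_def[OF short_aut_inv] straight_def skew_def rdir_inv ldir_inv)
qed

text \<open>A line whose two directions differ is mapped to one whose directions are the images of the
  two, in this or in the opposite order; the order is the same for all lines, and inversion
  interchanges the two orders.\<close>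

theorem short_aut_hom_or_antihom:
  assumes "short_aut \<alpha>"
  shows "(\<forall>x\<in>carrier G. \<forall>y\<in>carrier G. \<alpha> (x \<otimes> y) = \<alpha> x \<otimes> \<alpha> y) \<or>
    (\<forall>x\<in>carrier G. \<forall>y\<in>carrier G. \<alpha> (x \<otimes> y) = \<alpha> y \<otimes> \<alpha> x)"
proof (cases "\<exists>l\<in>short. rdir l \<noteq> ldir l \<and> straight \<alpha> l")
  case True
  then have "\<And>l. l \<in> short \<Longrightarrow> rdir l \<noteq> ldir l \<Longrightarrow> straight \<alpha> l"
    using straight_all[OF assms] by blast
  then show ?thesis
    using straight_imp_mult[OF assms] by blast
next
  case False
  then have "\<And>l. l \<in> short \<Longrightarrow> rdir l \<noteq> ldir l \<Longrightarrow> straight (\<lambda>x. inv (\<alpha> x)) l"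
    using straight_or_skew[OF assms] skew_imp_straight_inv[OF assms] by blast
  then have *: "inv (\<alpha> (x \<otimes> y)) = inv (\<alpha> x) \<otimes> inv (\<alpha> y)" if "x \<in> carrier G" "y \<in> carrier G" for x y
    using straight_imp_mult[OF short_aut_inv[OF assms]] that by blast
  have "\<alpha> (x \<otimes> y) = \<alpha> y \<otimes> \<alpha> x" if "x \<in> carrier G" "y \<in> carrier G" for x y
  proof -
    have "inv (\<alpha> (x \<otimes> y)) = inv (\<alpha> y \<otimes> \<alpha> x)"
      using *[OF that] that \<alpha>_closed[OF assms] by (simp add: inv_mult_group)
    then show ?thesis
      using that \<alpha>_closed[OF assms] by (metis inv_inv m_closed)
  qed
  then show ?thesis by blast
qed

end

section \<open>Computations in the field with eight elements\<close>

text \<open>A copy of the field with \<open>8\<close> elements for computations: \<open>(a, b, c)\<close> stands for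
  \<open>a + b z + c z\<^sup>2\<close>, with \<open>z\<^sup>3 = z + 1\<close>.\<close>

type_synonym f8 = "bool \<times> bool \<times> bool"
type_synonym mat8 = "f8 \<times> f8 \<times> f8 \<times> f8"

fun xor :: "bool \<Rightarrow> bool \<Rightarrow> bool" where
  "xor False b = b"
| "xor True b = (\<not> b)"

fun add8 :: "f8 \<Rightarrow> f8 \<Rightarrow> f8" where
  "add8 (a, b, c) (a', b', c') = (xor a a', xor b b', xor c c')"

text \<open>The coefficient \<open>c\<close> turns into that of the cube of z, which is z +
  1.\<close>

fun times_z :: "f8 \<Rightarrow> f8" where
  "times_z (a, b, c) = (c, xor a c, b)"

text \<open>Horner's scheme in the first factor.\<close>

fun mult8 :: "f8 \<Rightarrow> f8 \<Rightarrow> f8" where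
  "mult8 (a, b, c) y = add8 (if a then y else (False, False, False))
     (times_z (add8 (if b then y else (False, False, False)) (times_z (if c then y else (False, False, False)))))"

definition zero8 :: f8 where "zero8 = (False, False, False)"
definition one8 :: f8 where "one8 = (True, False, False)"

fun pow8 :: "nat \<Rightarrow> f8" where
  "pow8 0 = one8"
| "pow8 (Suc n) = times_z (pow8 n)"

fun mm8 :: "mat8 \<Rightarrow> mat8 \<Rightarrow> mat8" where
  "mm8 (a, b, c, d) (a', b', c', d') =
    (add8 (mult8 a a') (mult8 b c'), add8 (mult8 a b') (mult8 b d'),
     add8 (mult8 c a') (mult8 d c'), add8 (mult8 c b') (mult8 d d'))"

text \<open>The adjugate, whose signs disappear in characteristic 2; it is the inverse when the
  determinant is 1.\<close>

fun inv8 :: "mat8 \<Rightarrow> mat8" where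
  "inv8 (a, b, c, d) = (d, b, c, a)"

fun frob8 :: "mat8 \<Rightarrow> mat8" where
  "frob8 (a, b, c, d) = (mult8 a a, mult8 b b, mult8 c c, mult8 d d)"

fun det8 :: "mat8 \<Rightarrow> f8" where
  "det8 (a, b, c, d) = add8 (mult8 a d) (mult8 b c)"

fun trace8 :: "mat8 \<Rightarrow> f8" where
  "trace8 (a, b, c, d) = add8 a d"

definition one_mat8 :: mat8 where "one_mat8 = (one8, zero8, zero8, one8)"

definition mat_g8 :: mat8 where "mat_g8 = (pow8 2, pow8 4, pow8 4, pow8 1)"

definition mat_f8 :: mat8 where "mat_f8 = (zero8, one8, one8, zero8)"

fun mpow8 :: "mat8 \<Rightarrow> nat \<Rightarrow> mat8" where
  "mpow8 x 0 = one_mat8"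
| "mpow8 x (Suc n) = mm8 (mpow8 x n) x"

definition group_C8 :: "mat8 list" where
  "group_C8 = map (mpow8 mat_g8) [0..<9]"

definition conj8 :: "mat8 \<Rightarrow> mat8 \<Rightarrow> mat8" where
  "conj8 h x = mm8 (mm8 (inv8 h) x) h"

definition H1_8 :: "mat8 list" where
  "H1_8 = [one_mat8, (pow8 5, one8, pow8 5, pow8 6), (pow8 4, pow8 2, one8, pow8 2),
     (zero8, pow8 1, pow8 6, pow8 5), (pow8 3, pow8 6, pow8 4, pow8 5), (pow8 3, pow8 1, pow8 6, zero8),
     (one8, pow8 2, one8, pow8 6), (pow8 4, one8, pow8 5, one8), (pow8 5, zero8, zero8, pow8 2)]"

definition H4_8 :: "mat8 list" where
  "H4_8 = [one_mat8, (pow8 5, zero8, pow8 6, pow8 2), (pow8 1, pow8 6, pow8 4, one8),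
     (one8, pow8 5, pow8 6, pow8 5), (pow8 1, pow8 4, zero8, pow8 6), (pow8 5, pow8 2, pow8 4, pow8 4),
     (zero8, pow8 2, pow8 5, pow8 5), (zero8, pow8 4, pow8 3, pow8 4), (pow8 2, pow8 5, pow8 5, pow8 6)]"

definition D1_8 :: "mat8 list" where
  "D1_8 = [one_mat8, (pow8 5, one8, pow8 5, pow8 6), (pow8 4, pow8 2, one8, pow8 2),
     (zero8, pow8 1, pow8 6, pow8 2), (one8, pow8 4, pow8 2, pow8 2), (one8, pow8 1, pow8 6, zero8),
     (one8, pow8 2, one8, pow8 6), (pow8 4, one8, pow8 5, one8), (pow8 5, zero8, zero8, pow8 2)]"

definition D4_8 :: "mat8 list" where
  "D4_8 = [one_mat8, (pow8 5, zero8, pow8 6, pow8 2), (pow8 1, pow8 6, pow8 4, one8),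
     (zero8, pow8 1, pow8 6, pow8 5), (pow8 4, zero8, pow8 2, pow8 3), (pow8 5, pow8 2, pow8 3, pow8 6),
     (zero8, pow8 2, pow8 5, pow8 5), (zero8, pow8 4, pow8 3, pow8 4), (pow8 2, pow8 5, pow8 5, pow8 6)]"

definition frob_orbit8 :: "mat8 list \<Rightarrow> mat8 list list" where
  "frob_orbit8 L = [L, map frob8 L, map frob8 (map frob8 L)]"

definition system_H8 :: "mat8 list list" where
  "system_H8 = frob_orbit8 H1_8 @ frob_orbit8 H4_8"

definition system_D8 :: "mat8 list list" where
  "system_D8 = frob_orbit8 D1_8 @ frob_orbit8 D4_8"

text \<open>A list, so that repetitions remain visible: distinctness of this list is the injectivity
  required of a block.\<close>

definition quotients8 :: "mat8 list \<Rightarrow> mat8 list" where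
  "quotients8 L = map (\<lambda>(x, y). mm8 x (inv8 y)) (filter (\<lambda>(x, y). x \<noteq> y) (List.product L L))"

fun bits8 :: "f8 \<Rightarrow> bool list \<Rightarrow> bool list" where
  "bits8 (a, b, c) bs = a # b # c # bs"

fun bits :: "mat8 \<Rightarrow> bool list" where
  "bits (a, b, c, d) = bits8 a (bits8 b (bits8 c (bits8 d [])))"

text \<open>The empty list passes too, since a leaf of the trie may receive no word.\<close>

fun singleton_list :: "'b list \<Rightarrow> bool" where
  "singleton_list [] = True"
| "singleton_list [x] = True"
| "singleton_list (x # y # xs) = False"

text \<open>A test of distinctness that avoids the quadratic number of comparisons.\<close>

fun trie_distinct :: "nat \<Rightarrow> bool list list \<Rightarrow> bool" where
  "trie_distinct 0 xs \<longleftrightarrow> singleton_list xs"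
| "trie_distinct (Suc n) xs \<longleftrightarrow>
    trie_distinct n (map tl (filter hd xs)) \<and> trie_distinct n (map tl (filter (\<lambda>x. \<not> hd x) xs))"

text \<open>Words with the same first bit are distinct if their tails are. The implication holds for
  every depth; 12 is used below because a matrix is coded by four entries of three bits.\<close>

lemma distinct_of_trie_distinct: "trie_distinct n xs \<Longrightarrow> distinct xs"
proof (induction n arbitrary: xs)
  case 0
  then show ?case
    by (cases xs rule: singleton_list.cases) auto
next
  case (Suc n)
  have "distinct (filter hd xs) \<Longrightarrow> distinct (filter (\<lambda>x. \<not> hd x) xs) \<Longrightarrow> distinct xs"
    by (induction xs) (auto split: if_splits)
  then show ?case
    using Suc.IH[of "map tl (filter hd xs)"] Suc.IH[of "map tl (filter (\<lambda>x. \<not> hd x) xs)"] Suc.prems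
    by (simp add: distinct_map)
qed

text \<open>440 = 6 * 72 + 8 is the number of elements of nonzero trace. Since the conjugates of the
  Sylow subgroup make up the elements of trace 0, the trace test keeps the list disjoint from them,
  and counting gives that nothing is missed.\<close>

definition difference_system8 :: "mat8 list list \<Rightarrow> bool" where
  "difference_system8 Ls \<longleftrightarrow>
    (let Q = concat (map quotients8 Ls) @ tl group_C8 in
      length Q = 440 \<and> trie_distinct 12 (map bits Q) \<and> (\<forall>x\<in>set Q. trace8 x \<noteq> zero8)) \<and>
    (\<forall>L\<in>set Ls. length L = 9 \<and> trie_distinct 12 (map bits L) \<and> one_mat8 \<in> set L \<and>
      (\<forall>x\<in>set L. det8 x = one8))"

text \<open>Conjugation fixes the identity, which belongs to each block set considered. A translate
  that contains it is a translate by the inverse of an element of \<open>L\<close>, so only these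
  are tried.\<close>

definition conj_translate8 :: "mat8 \<Rightarrow> mat8 list \<Rightarrow> bool" where
  "conj_translate8 h L \<longleftrightarrow>
    (\<exists>y\<in>set L. \<forall>x\<in>set L. conj8 h x \<in> set (map (\<lambda>x. mm8 x (inv8 y)) L))"

lemma difference_system_D8: "difference_system8 system_D8"
  by code_simp

lemma difference_system_H8: "difference_system8 system_H8"
  by code_simp

text \<open>Each of the six sets is taken to a translate of itself, not merely of another member of
  the system. Here g enters only through its cube; for the classical system the same test succeeds
  with g.\<close>

lemma conj_translate_D8:
  "\<forall>L\<in>set system_D8. conj_translate8 (mpow8 mat_g8 3) L"
  "\<forall>L\<in>set system_D8. conj_translate8 mat_f8 L"
  by code_simp+

lemma conj_translate_H8:
  "\<forall>L\<in>set system_H8. conj_translate8 mat_g8 L"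
  "\<forall>L\<in>set system_H8. conj_translate8 mat_f8 L"
  by code_simp+

text \<open>Right translates of a set have the same quotients. So this excludes that conjugation by
  g takes \<open>D1\<close> to a translate of a member of the system.\<close>

lemma conj_g_D1_8:
  "\<forall>L\<in>set system_D8. \<exists>x\<in>set (quotients8 D1_8). conj8 mat_g8 x \<notin> set (quotients8 L)"
  by code_simp

text \<open>\<gamma>_f inverts g and \<phi> raises it to the seventh power, so their product squares
  g, as 8 * 7 = 56 is 2 modulo 9. A single unipotent matrix witnesses that C is not normal.\<close>

lemma mat_g8_power9: "mpow8 mat_g8 9 = one_mat8"
  and conj_f_mat_g8: "conj8 mat_f8 mat_g8 = mpow8 mat_g8 8"
  and frob_mat_g8: "frob8 mat_g8 = mpow8 mat_g8 7"
  and group_C8_not_normal: "conj8 (one8, pow8 1, zero8, one8) mat_g8 \<notin> set group_C8"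
  and group_C8_distinct: "trie_distinct 12 (map bits group_C8)"
  and group_C8_det: "\<forall>x\<in>set group_C8. det8 x = one8"
  by code_simp+

text \<open>The powers of \<open>g\<close> are transitive on the projective line.\<close>

lemma group_C8_transitive:
  "\<forall>p\<in>set (zero8 # map pow8 [0..<7]). \<forall>q\<in>set (zero8 # map pow8 [0..<7]).
    \<exists>x\<in>set group_C8. case x of (a, b, c, d) \<Rightarrow> add8 (mult8 c p) (mult8 a q) = zero8"
  by code_simp

text \<open>With the computations done, the field operations are to be rewritten through
  \<open>dec\<close> and no longer unfolded to bits.\<close>

declare add8.simps [simp del] mult8.simps [simp del] times_z.simps [simp del]

lemma mem_quotients8:
  "x \<in> set (quotients8 L) \<longleftrightarrow> (\<exists>a\<in>set L. \<exists>b\<in>set L. a \<noteq> b \<and> x = mm8 a (inv8 b))"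
proof
  assume "x \<in> set (quotients8 L)"
  then obtain p where p: "p \<in> set (filter (\<lambda>(x, y). x \<noteq> y) (List.product L L))" "x = (case p of (a, b) \<Rightarrow> mm8 a (inv8 b))"
    unfolding quotients8_def set_map by blast
  obtain a b where "p = (a, b)"
    by (rule prod.exhaust)
  with p show "\<exists>a\<in>set L. \<exists>b\<in>set L. a \<noteq> b \<and> x = mm8 a (inv8 b)"
    by (intro bexI[of _ a] bexI[of _ b]) simp_all
next
  assume "\<exists>a\<in>set L. \<exists>b\<in>set L. a \<noteq> b \<and> x = mm8 a (inv8 b)"
  then obtain a b where "a \<in> set L" "b \<in> set L" "a \<noteq> b" "x = mm8 a (inv8 b)"
    by blast
  then show "x \<in> set (quotients8 L)"
    unfolding quotients8_def set_map by (intro image_eqI[of _ _ "(a, b)"]) simp_all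
qed

lemma (in group) card_r_coset:
  assumes "H \<subseteq> carrier G" "y \<in> carrier G"
  shows "card (H #> y) = card H"
proof -
  have "H #> y = (\<lambda>x. x \<otimes> y) ` H"
    by (auto simp: r_coset_def)
  moreover have "inj_on (\<lambda>x. x \<otimes> y) H"
  proof (rule inj_onI)
    fix u v assume "u \<in> H" "v \<in> H" "u \<otimes> y = v \<otimes> y"
    moreover from this have "u \<in> carrier G" "v \<in> carrier G"
      using assms(1) by auto
    ultimately show "u = v"
      using assms(2) by simp
  qed
  ultimately show ?thesis
    by (simp add: card_image)
qed

section \<open>Transfer from bit triples to the field\<close>

context gf8 begin

definition dec :: "f8 \<Rightarrow> 'a" where
  "dec = (\<lambda>(a, b, c). of_bool a + of_bool b * z + of_bool c * z\<^sup>2)"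

definition dec_mat :: "mat8 \<Rightarrow> 'a ^ 2 ^ 2" where
  "dec_mat = (\<lambda>(a, b, c, d). mat2 (dec a) (dec b) (dec c) (dec d))"

lemma of_bool_xor [simp]: "(of_bool (xor a b) :: 'a) = of_bool a + of_bool b"
  by (cases a; cases b) simp_all

lemma dec_zero [simp]: "dec zero8 = 0" and dec_one [simp]: "dec one8 = 1"
  by (simp_all add: dec_def zero8_def one8_def)

lemma dec_add [simp]: "dec (add8 x y) = dec x + dec y"
  by (cases x; cases y) (simp add: add8.simps dec_def algebra_simps)

lemma dec_times_z [simp]: "dec (times_z x) = z * dec x"
proof -
  have "z * (z * z) = z + 1"
    using z_cubed by (simp only: power3_eq_cube mult.assoc)
  then have "z * (z * (z * y)) = z * y + y" for y
    by (metis distrib_right mult.assoc mult_1)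
  with \<open>z * (z * z) = z + 1\<close> show ?thesis
    by (cases x) (simp add: times_z.simps add8.simps dec_def power2_eq_square algebra_simps)
qed

lemma dec_mult [simp]: "dec (mult8 x y) = dec x * dec y"
proof (cases x)
  case (fields a b c)
  have if_dec: "dec (if p then y else (False, False, False)) = of_bool p * dec y" for p
    using dec_zero by (simp add: zero8_def)
  have "dec (a, b, c) = of_bool a + of_bool b * z + of_bool c * z\<^sup>2"
    by (simp add: dec_def)
  then show ?thesis
    unfolding fields mult8.simps dec_add dec_times_z if_dec
    by (simp only: power2_eq_square distrib_left distrib_right mult_ac add.assoc)
qed

lemma dec_pow [simp]: "dec (pow8 n) = z ^ n"
  by (induction n) simp_all

lemma surj_dec: "range dec = UNIV"
proof -
  have "{zero8, one8, pow8 1, pow8 2, pow8 3, pow8 4, pow8 5, pow8 6} \<subseteq> UNIV"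
    by simp
  then have "dec ` {zero8, one8, pow8 1, pow8 2, pow8 3, pow8 4, pow8 5, pow8 6} \<subseteq> range dec"
    by (rule image_mono)
  then have "{0, 1, z, z ^ 2, z ^ 3, z ^ 4, z ^ 5, z ^ 6} \<subseteq> range dec"
    by (simp only: image_insert image_empty dec_zero dec_one dec_pow power_one_right)
  then show ?thesis
    unfolding UNIV_eq[symmetric] by (rule top_le)
qed

text \<open>A surjection between two sets of 8 elements. Injectivity is what lets inequalities and
  distinctness found on codes hold in the group.\<close>

lemma inj_dec: "inj dec"
proof (rule eq_card_imp_inj_on)
  show "card (range dec) = card (UNIV :: f8 set)"
    unfolding surj_dec card_field card_prod card_UNIV_bool by simp
qed simp

lemma dec_eq_iff [simp]: "dec x = dec y \<longleftrightarrow> x = y"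
  using inj_dec by (simp add: inj_eq)

lemma inj_dec_mat: "inj dec_mat"
proof (rule injI)
  fix x y :: mat8
  assume eq: "dec_mat x = dec_mat y"
  obtain a b c d where x: "x = (a, b, c, d)"
    by (rule prod_cases4)
  obtain a' b' c' d' where y: "y = (a', b', c', d')"
    by (rule prod_cases4)
  show "x = y"
    using eq unfolding x y dec_mat_def prod.case mat2_inject dec_eq_iff by (simp only:)
qed

lemma dec_mat_eq_iff [simp]: "dec_mat x = dec_mat y \<longleftrightarrow> x = y"
  using inj_dec_mat by (simp add: inj_eq)

lemma dec_mat_one [simp]: "dec_mat one_mat8 = mat 1"
  by (simp add: dec_mat_def one_mat8_def mat2_one)

lemma dec_mat_mult [simp]: "dec_mat (mm8 x y) = dec_mat x ** dec_mat y"
  by (cases x; cases y) (simp add: dec_mat_def)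

lemma det_dec_mat: "det (dec_mat x) = dec (det8 x)"
  by (cases x) (simp add: dec_mat_def)

lemma trace_dec_mat: "trace (dec_mat x) = dec (trace8 x)"
  by (cases x) (simp add: dec_mat_def)

lemma det_dec_mat_eq_1_iff: "det (dec_mat x) = 1 \<longleftrightarrow> det8 x = one8"
  by (metis dec_eq_iff dec_one det_dec_mat)

lemma trace_dec_mat_eq_0_iff: "trace (dec_mat x) = 0 \<longleftrightarrow> trace8 x = zero8"
  by (metis dec_eq_iff dec_zero trace_dec_mat)

lemma frob_dec_mat: "frob_mat (dec_mat x) = dec_mat (frob8 x)"
  by (cases x) (auto simp: dec_mat_def frob_mat_def power2_eq_square intro!: mat2_eqI)

lemma inv_dec_mat: "det8 x = one8 \<Longrightarrow> inv\<^sub>S (dec_mat x) = dec_mat (inv8 x)"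
  using det_dec_mat_eq_1_iff[of x] by (cases x) (simp add: dec_mat_def inv_SL2_char2)

lemma conj_dec_mat:
  assumes "det8 h = one8" "det8 x = one8"
  shows "conj_map SL2 (dec_mat h) (dec_mat x) = dec_mat (conj8 h x)"
  using assms by (simp add: conj_map_SL2 det_dec_mat inv_dec_mat conj8_def)

lemma dec_mat_g: "dec_mat mat_g8 = mat_g z" and dec_mat_f: "dec_mat mat_f8 = mat_f"
  by (simp_all add: dec_mat_def mat_g8_def mat_f8_def mat_g_def mat_f_def del: pow8.simps)

lemma det_mat_g [simp]: "det (mat_g z) = 1" and det_mat_f [simp]: "det (mat_f :: 'a ^ 2 ^ 2) = 1"
  unfolding dec_mat_g[symmetric] dec_mat_f[symmetric] det_dec_mat_eq_1_iff by code_simp+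

lemma dec_mpow: "dec_mat (mpow8 mat_g8 n) = mat_g z \<up> n"
  by (induction n) (simp_all add: dec_mat_g mult_SL2 one_SL2)

lemma det_mat_g_pow [simp]: "det (mat_g z \<up> n) = 1"
  using SL2.nat_pow_closed[of "mat_g z" n] by simp

lemma distinct_map_bits: "trie_distinct n (map bits L) \<Longrightarrow> distinct L"
  using distinct_of_trie_distinct distinct_map by blast

lemma mat_g_power9: "mat_g z \<up> 9 = \<one>\<^sub>S"
  using dec_mpow[of 9] mat_g8_power9 by (simp add: one_SL2)

lemma group_C_eq: "group_C z = dec_mat ` set group_C8"
proof -
  have "mat_g z \<up> n = mat_g z \<up> (n mod 9)" for n :: nat
  proof -
    have "mat_g z \<up> n = mat_g z \<up> (9 * (n div 9) + n mod 9)"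
      by simp
    also have "\<dots> = (mat_g z \<up> 9) \<up> (n div 9) \<cdot> mat_g z \<up> (n mod 9)"
      by (simp only: SL2.nat_pow_mult[symmetric] SL2.nat_pow_pow carrier_SL2 det_mat_g)
    finally show ?thesis
      by (simp add: mat_g_power9)
  qed
  then have "range (\<lambda>n::nat. mat_g z \<up> n) = (\<lambda>n. mat_g z \<up> n) ` {0..<9::nat}"
    by (auto simp: image_iff) (metis atLeastLessThan_iff le0 mod_less_divisor zero_less_numeral)
  moreover have "group_C z = range (\<lambda>n::nat. mat_g z \<up> n)"
    unfolding group_C_def
    by (subst SL2.generate_pow_on_finite_carrier) auto
  ultimately show ?thesis
    by (simp add: group_C8_def image_image dec_mpow)
qed

lemma D1_eq: "D1 z = dec_mat ` set D1_8" and D4_eq: "D4 z = dec_mat ` set D4_8"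
  and H1_eq: "H1 z = dec_mat ` set H1_8" and H4_eq: "H4 z = dec_mat ` set H4_8"
  unfolding D1_def D4_def H1_def H4_def D1_8_def D4_8_def H1_8_def H4_8_def list.set image_insert image_empty
  by (simp_all only: dec_mat_one) (simp_all only: dec_mat_def prod.case dec_zero dec_one dec_pow power_one_right)

lemma frob_orbit_eq: "frob_orbit (dec_mat ` set L) = (\<lambda>L. dec_mat ` set L) ` set (frob_orbit8 L)"
  by (simp add: frob_orbit_def frob_orbit8_def image_image frob_dec_mat)

lemma system_D_eq: "system_D z = (\<lambda>L. dec_mat ` set L) ` set system_D8"
  and system_H_eq: "system_H z = (\<lambda>L. dec_mat ` set L) ` set system_H8"
  by (simp_all only: system_D_def system_H_def system_D8_def system_H8_def D1_eq D4_eq H1_eq H4_eq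
      frob_orbit_eq set_append image_Un)

lemma quotients_eq:
  assumes "\<And>x. x \<in> set L \<Longrightarrow> det8 x = one8"
  shows "quotients (dec_mat ` set L) = dec_mat ` set (quotients8 L)"
proof (rule equalityI; rule subsetI)
  fix w assume "w \<in> quotients (dec_mat ` set L)"
  then obtain x y where xy: "x \<in> set L" "y \<in> set L" "dec_mat x \<noteq> dec_mat y"
    "w = dec_mat x \<cdot> inv\<^sub>S dec_mat y"
    unfolding quotients_def by blast
  then have "w = dec_mat (mm8 x (inv8 y))" "x \<noteq> y"
    using assms by (auto simp: mult_SL2 inv_dec_mat)
  moreover have "mm8 x (inv8 y) \<in> set (quotients8 L)"
    unfolding mem_quotients8 using xy(1,2) \<open>x \<noteq> y\<close> by blast
  ultimately show "w \<in> dec_mat ` set (quotients8 L)"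
    by (simp only: imageI)
next
  fix w assume "w \<in> dec_mat ` set (quotients8 L)"
  then obtain q where q: "w = dec_mat q" "q \<in> set (quotients8 L)"
    by (rule imageE)
  then obtain x y where xy: "x \<in> set L" "y \<in> set L" "x \<noteq> y" "q = mm8 x (inv8 y)"
    unfolding mem_quotients8 by blast
  then have "w = dec_mat x \<cdot> inv\<^sub>S dec_mat y" "dec_mat x \<noteq> dec_mat y"
    using assms q(1) by (simp_all add: mult_SL2 inv_dec_mat)
  moreover have "dec_mat x \<in> dec_mat ` set L" "dec_mat y \<in> dec_mat ` set L"
    using xy(1,2) by simp_all
  ultimately show "w \<in> quotients (dec_mat ` set L)"
    unfolding quotients_def by blast
qed

text \<open>The test only gives an inclusion. Conjugation and right translation are injective, so
  both sides have the cardinality of the block and are equal.\<close>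

lemma conj_translate:
  assumes "conj_translate8 h L" "det8 h = one8" "\<And>x. x \<in> set L \<Longrightarrow> det8 x = one8"
  obtains y where "det y = 1"
    "conj_map SL2 (dec_mat h) ` dec_mat ` set L = dec_mat ` set L #>\<^sub>S y"
proof -
  let ?D = "dec_mat ` set L"
  obtain y where y: "y \<in> set L"
    "\<And>x. x \<in> set L \<Longrightarrow> \<exists>w\<in>set L. conj8 h x = mm8 w (inv8 y)"
    using assms(1) unfolding conj_translate8_def set_map by (auto simp: image_iff)
  let ?y = "inv\<^sub>S (dec_mat y)"
  have D: "?D \<subseteq> carrier SL2"
    using assms(3) by (auto simp: det_dec_mat)
  have yc: "dec_mat y \<in> carrier SL2"
    using D y(1) by blast
  then have det: "?y \<in> carrier SL2"
    by (rule SL2.inv_closed)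
  have "conj_map SL2 (dec_mat h) ` ?D \<subseteq> ?D #>\<^sub>S ?y"
  proof
    fix w assume "w \<in> conj_map SL2 (dec_mat h) ` ?D"
    then obtain x where x: "x \<in> set L" "w = dec_mat (conj8 h x)"
      using assms(2,3) by (auto simp: conj_dec_mat)
    then obtain v where "v \<in> set L" "w = dec_mat v \<cdot> ?y"
      using y assms(3) by (metis dec_mat_mult inv_dec_mat mult_SL2)
    then show "w \<in> ?D #>\<^sub>S ?y"
      by (auto simp: r_coset_def)
  qed
  moreover have "finite (?D #>\<^sub>S ?y)"
    by (simp add: r_coset_def)
  moreover have "card (conj_map SL2 (dec_mat h) ` ?D) = card ?D"
  proof (rule card_image, rule inj_onI)
    fix u v assume uv: "u \<in> ?D" "v \<in> ?D" "conj_map SL2 (dec_mat h) u = conj_map SL2 (dec_mat h) v"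
    then have "u \<in> carrier SL2" "v \<in> carrier SL2" "dec_mat h \<in> carrier SL2" "inv\<^sub>S (dec_mat h) \<in> carrier SL2"
      using D assms(2) SL2.inv_closed[of "dec_mat h"] by (auto simp: det_dec_mat)
    then show "u = v"
      using uv(3) by (simp add: conj_map_def del: carrier_SL2)
  qed
  moreover have "card (?D #>\<^sub>S ?y) = card ?D"
    using D det by (rule SL2.card_r_coset)
  ultimately show ?thesis
    using that det card_subset_eq by (metis carrier_SL2)
qed

end

section \<open>Internal semidirect products\<close>

context group begin

lemma internal_semidirectI:
  assumes A: "subgroup A G" and N: "subgroup N G" "N \<subseteq> A" and H: "subgroup H G" "H \<subseteq> A"
    and normal: "\<And>a n. a \<in> A \<Longrightarrow> n \<in> N \<Longrightarrow> a \<otimes> n \<otimes> inv a \<in> N"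
    and triv: "\<And>x. x \<in> N \<Longrightarrow> x \<in> H \<Longrightarrow> x = \<one>"
    and gen: "\<And>a. a \<in> A \<Longrightarrow> \<exists>n\<in>N. \<exists>h\<in>H. a = n \<otimes> h"
  shows "internal_semidirect G A N H"
proof -
  interpret GA: group "G\<lparr>carrier := A\<rparr>"
    using A by (rule subgroup_imp_group)
  have "N \<lhd> G\<lparr>carrier := A\<rparr>"
    unfolding GA.normal_inv_iff
    using normal m_inv_consistent[OF A] by (simp add: subgroup_incl[OF N(1) A N(2)])
  moreover have "N \<inter> H = {\<one>}"
    using triv subgroup.one_closed[OF N(1)] subgroup.one_closed[OF H(1)] by blast
  moreover have "N <#> H = A"
  proof (rule equalityI; rule subsetI)
    fix x assume "x \<in> N <#> H"
    then show "x \<in> A"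
      using N(2) H(2) subgroup.m_closed[OF A] by (auto simp: set_mult_def)
  next
    fix x assume "x \<in> A"
    then show "x \<in> N <#> H"
      using gen unfolding set_mult_def by blast
  qed
  ultimately show ?thesis
    unfolding internal_semidirect_def using A subgroup_incl[OF H(1) A H(2)] by simp
qed

lemma internal_semidirectD:
  assumes "internal_semidirect G A N H"
  shows "subgroup A G" "subgroup N G" "subgroup H G" "N \<subseteq> A" "H \<subseteq> A"
    "\<And>a n. a \<in> A \<Longrightarrow> n \<in> N \<Longrightarrow> a \<otimes> n \<otimes> inv a \<in> N"
    "\<And>x. x \<in> N \<Longrightarrow> x \<in> H \<Longrightarrow> x = \<one>"
    "\<And>a. a \<in> A \<Longrightarrow> \<exists>n\<in>N. \<exists>h\<in>H. a = n \<otimes> h"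
proof -
  show A: "subgroup A G"
    using assms by (simp add: internal_semidirect_def)
  have N: "N \<lhd> G\<lparr>carrier := A\<rparr>" and H: "subgroup H (G\<lparr>carrier := A\<rparr>)"
    using assms by (simp_all add: internal_semidirect_def)
  show "N \<subseteq> A" "H \<subseteq> A"
    using subgroup.subset[OF normal_imp_subgroup[OF N]] subgroup.subset[OF H] by simp_all
  show "subgroup N G" "subgroup H G"
    using normal_imp_subgroup[OF N] H incl_subgroup[OF A] by simp_all
  show "a \<otimes> n \<otimes> inv a \<in> N" if "a \<in> A" "n \<in> N" for a n
    using normal.inv_op_closed2[OF N, of a n] that m_inv_consistent[OF A] by simp
  show "x = \<one>" if "x \<in> N" "x \<in> H" for x
    using assms that by (auto simp: internal_semidirect_def)
  show "\<exists>n\<in>N. \<exists>h\<in>H. a = n \<otimes> h" if "a \<in> A" for a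
    using assms that unfolding internal_semidirect_def set_mult_def by blast
qed

lemma internal_semidirect_unique:
  assumes "internal_semidirect G A N H"
    and "n \<in> N" "n' \<in> N" "h \<in> H" "h' \<in> H" "n \<otimes> h = n' \<otimes> h'"
  shows "n = n' \<and> h = h'"
proof -
  note D = internal_semidirectD[OF assms(1)]
  have c: "n \<in> carrier G" "n' \<in> carrier G" "h \<in> carrier G" "h' \<in> carrier G"
    using assms subgroup.mem_carrier D(2,3) by metis+
  have "inv n' \<otimes> n = inv n' \<otimes> (n \<otimes> h) \<otimes> inv h"
    using c by (simp add: m_assoc)
  also have "\<dots> = h' \<otimes> inv h"
    unfolding assms(6) using c by (simp add: m_assoc[symmetric])
  finally have eq: "inv n' \<otimes> n = h' \<otimes> inv h" .
  have "inv n' \<otimes> n \<in> N" "h' \<otimes> inv h \<in> H"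
    using assms D(2,3) by (simp_all add: subgroup.m_closed subgroup.m_inv_closed)
  then have "inv n' \<otimes> n = \<one>"
    using eq D(7) by simp
  then have "n = n'"
    using c by (metis inv_equality inv_inv inv_closed)
  then show ?thesis
    using assms(6) c by simp
qed

lemma card_internal_semidirect:
  assumes "internal_semidirect G A N H"
  shows "card A = card N * card H"
proof -
  have "bij_betw (\<lambda>(n, h). n \<otimes> h) (N \<times> H) A"
  proof (rule bij_betw_imageI)
    show "inj_on (\<lambda>(n, h). n \<otimes> h) (N \<times> H)"
      using internal_semidirect_unique[OF assms] by (auto simp: inj_on_def)
    have "(\<lambda>(n, h). n \<otimes> h) ` (N \<times> H) = N <#> H"
      by (auto simp: set_mult_def)
    then show "(\<lambda>(n, h). n \<otimes> h) ` (N \<times> H) = A"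
      using assms by (simp add: internal_semidirect_def)
  qed
  then show ?thesis
    using bij_betw_same_card card_cartesian_product by metis
qed

lemma subgroup_nat_pow_closed:
  assumes "subgroup H G" "x \<in> H"
  shows "x [^] (n::nat) \<in> H"
  using assms by (induction n) (simp_all add: subgroup.one_closed subgroup.m_closed)

lemma integer_mod_group_iso_generate:
  assumes "x \<in> carrier G" "ord x = n" "n \<noteq> 0"
  shows "(\<lambda>k::int. x [^] k) \<in> iso (integer_mod_group n) (G\<lparr>carrier := generate G {x}\<rparr>)"
proof (rule isoI)
  have eq: "x [^] (k mod int n) = x [^] k" for k :: int
    using assms by (subst int_pow_eq) (simp_all add: mod_eq_dvd_iff[symmetric])
  have gen: "generate G {x} = range (\<lambda>k::int. x [^] k)"
    using generate_pow[OF assms(1)] by auto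
  show "(\<lambda>k::int. x [^] k) \<in> hom (integer_mod_group n) (G\<lparr>carrier := generate G {x}\<rparr>)"
    by (rule homI) (simp_all add: gen eq int_pow_mult assms(1))
  show "bij_betw (\<lambda>k::int. x [^] k) (carrier (integer_mod_group n)) (carrier (G\<lparr>carrier := generate G {x}\<rparr>))"
  proof (rule bij_betw_imageI)
    show "inj_on (\<lambda>k::int. x [^] k) (carrier (integer_mod_group n))"
    proof (rule inj_onI)
      fix i j assume ij: "i \<in> carrier (integer_mod_group n)" "j \<in> carrier (integer_mod_group n)" "x [^] i = x [^] j"
      then have "int n dvd j - i"
        using int_pow_eq[OF assms(1)] assms(2) by simp
      then have "j mod int n = i mod int n"
        by (simp add: mod_eq_dvd_iff)
      then show "i = j"
        using ij(1,2) assms(3) by (simp add: carrier_integer_mod_group)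
    qed
    have "x [^] k \<in> (\<lambda>k::int. x [^] k) ` {0..<int n}" for k :: int
      using eq[of k, symmetric] assms(3) by (intro image_eqI[of _ _ "k mod int n"]) auto
    then show "(\<lambda>k::int. x [^] k) ` carrier (integer_mod_group n) = carrier (G\<lparr>carrier := generate G {x}\<rparr>)"
      using assms(3) by (auto simp: gen carrier_integer_mod_group)
  qed
qed

lemma generate_iso_integer_mod_group:
  assumes "x \<in> carrier G" "ord x = n" "n \<noteq> 0"
  shows "G\<lparr>carrier := generate G {x}\<rparr> \<cong> integer_mod_group n"
  using integer_mod_group_iso_generate[OF assms] group.iso_sym[OF group_integer_mod_group]
  unfolding is_iso_def by blast

text \<open>The action is conjugation by \<open>g h\<close>, pulled back along \<open>f\<close> to
  \<open>N'\<close>; for it, multiplying \<open>f n\<close> by \<open>g h\<close> is the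
  isomorphism.\<close>

lemma internal_semidirect_iso:
  fixes N' :: "('n, 'u) monoid_scheme" and H' :: "('h, 'v) monoid_scheme"
  assumes sd: "internal_semidirect G A N H"
    and N': "group N'" and H': "group H'"
    and f: "f \<in> iso N' (G\<lparr>carrier := N\<rparr>)" and g: "g \<in> iso H' (G\<lparr>carrier := H\<rparr>)"
  shows "\<exists>\<theta>\<in>hom H' (AutoGroup N'). G\<lparr>carrier := A\<rparr> \<cong> semidirect_product N' H' \<theta>"
proof -
  note D = internal_semidirectD[OF sd]
  interpret N': group N' by fact
  interpret H': group H' by fact
  have f_mult: "f (x \<otimes>\<^bsub>N'\<^esub> y) = f x \<otimes> f y" if "x \<in> carrier N'" "y \<in> carrier N'" for x y
    using f that by (simp add: iso_def hom_def)
  have g_mult: "g (x \<otimes>\<^bsub>H'\<^esub> y) = g x \<otimes> g y" if "x \<in> carrier H'" "y \<in> carrier H'" for x y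
    using g that by (simp add: iso_def hom_def)
  have f_bij: "bij_betw f (carrier N') N" and g_bij: "bij_betw g (carrier H') H"
    using f g by (simp_all add: iso_def)
  have f_N: "f x \<in> N" "f x \<in> carrier G" if "x \<in> carrier N'" for x
    using f_bij that D(2) bij_betwE subgroup.mem_carrier by metis+
  have g_H: "g x \<in> H" "g x \<in> A" "g x \<in> carrier G" if "x \<in> carrier H'" for x
    using g_bij that D(3,5) bij_betwE subgroup.mem_carrier by (metis subsetD)+
  define act where "act = (\<lambda>h n. g h \<otimes> f n \<otimes> inv (g h))"
  have act_N: "act h n \<in> N" if "h \<in> carrier H'" "n \<in> carrier N'" for h n
    unfolding act_def using D(6) g_H(2) f_N(1) that by blast
  \<comment> \<open>The restriction to the carrier makes the map extensional, as elements of
    \<open>AutoGroup\<close> have to be.\<close>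
  define \<theta> where "\<theta> = (\<lambda>h. \<lambda>n\<in>carrier N'. inv_into (carrier N') f (act h n))"
  have f_\<theta>: "f (\<theta> h n) = act h n" and \<theta>_closed: "\<theta> h n \<in> carrier N'"
    if "h \<in> carrier H'" "n \<in> carrier N'" for h n
    using act_N[OF that] f_bij that unfolding \<theta>_def
    by (simp_all add: bij_betw_inv_into_right bij_betw_def inv_into_into)
  have f_eqD: "x = y" if "f x = f y" "x \<in> carrier N'" "y \<in> carrier N'" for x y
    using inj_onD[OF bij_betw_imp_inj_on[OF f_bij]] that by blast
  have g_one: "g \<one>\<^bsub>H'\<^esub> = \<one>"
    using g_mult[of "\<one>\<^bsub>H'\<^esub>" "\<one>\<^bsub>H'\<^esub>"] g_H(3)[of "\<one>\<^bsub>H'\<^esub>"] by (metis H'.one_closed H'.r_one r_cancel_one)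
  have \<theta>_mult_H: "\<theta> (h \<otimes>\<^bsub>H'\<^esub> k) n = \<theta> h (\<theta> k n)"
    if "h \<in> carrier H'" "k \<in> carrier H'" "n \<in> carrier N'" for h k n
  proof (rule f_eqD)
    show "f (\<theta> (h \<otimes>\<^bsub>H'\<^esub> k) n) = f (\<theta> h (\<theta> k n))"
      using that by (simp add: f_\<theta> \<theta>_closed) (simp add: act_def f_\<theta> g_mult g_H(3) f_N(2) \<theta>_closed inv_mult_group m_assoc)
  qed (use that \<theta>_closed in auto)
  have \<theta>_one: "\<theta> \<one>\<^bsub>H'\<^esub> n = n" if "n \<in> carrier N'" for n
  proof (rule f_eqD)
    show "f (\<theta> \<one>\<^bsub>H'\<^esub> n) = f n"
      using that by (simp add: f_\<theta>) (simp add: act_def g_one f_N(2))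
  qed (use that \<theta>_closed in auto)
  have \<theta>_mult_N: "\<theta> h (m \<otimes>\<^bsub>N'\<^esub> n) = \<theta> h m \<otimes>\<^bsub>N'\<^esub> \<theta> h n"
    if "h \<in> carrier H'" "m \<in> carrier N'" "n \<in> carrier N'" for h m n
  proof (rule f_eqD)
    have "act h (m \<otimes>\<^bsub>N'\<^esub> n) = act h m \<otimes> act h n"
      using that g_H(3) f_N(2) by (simp add: act_def f_mult m_assoc inv_solve_left' inv_solve_left)
    then show "f (\<theta> h (m \<otimes>\<^bsub>N'\<^esub> n)) = f (\<theta> h m \<otimes>\<^bsub>N'\<^esub> \<theta> h n)"
      using that by (simp add: f_\<theta> \<theta>_closed f_mult)
  qed (use that \<theta>_closed in auto)
  have \<theta>_auto: "\<theta> h \<in> auto N'" if "h \<in> carrier H'" for h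
  proof -
    have "bij_betw (\<theta> h) (carrier N') (carrier N')"
    proof (rule bij_betw_byWitness[where f' = "\<theta> (inv\<^bsub>H'\<^esub> h)"])
      show "\<forall>n\<in>carrier N'. \<theta> (inv\<^bsub>H'\<^esub> h) (\<theta> h n) = n" "\<forall>n\<in>carrier N'. \<theta> h (\<theta> (inv\<^bsub>H'\<^esub> h) n) = n"
        using that \<theta>_one by (simp_all flip: \<theta>_mult_H)
    qed (use that \<theta>_closed in auto)
    then show ?thesis
      using that \<theta>_mult_N \<theta>_closed
      by (auto simp: auto_def hom_def Bij_def \<theta>_def[of] restrict_def extensional_def)
  qed
  have "\<theta> \<in> hom H' (AutoGroup N')"
  proof (rule homI)
    fix h k assume hk: "h \<in> carrier H'" "k \<in> carrier H'"
    have "\<theta> (h \<otimes>\<^bsub>H'\<^esub> k) = compose (carrier N') (\<theta> h) (\<theta> k)"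
    proof (rule extensionalityI[of _ "carrier N'"])
      show "\<theta> (h \<otimes>\<^bsub>H'\<^esub> k) \<in> extensional (carrier N')"
        by (simp add: \<theta>_def)
    qed (simp_all add: compose_def \<theta>_mult_H hk)
    then show "\<theta> (h \<otimes>\<^bsub>H'\<^esub> k) = \<theta> h \<otimes>\<^bsub>AutoGroup N'\<^esub> \<theta> k"
      using hk \<theta>_auto by (simp add: AutoGroup_def BijGroup_def auto_def)
  qed (simp add: AutoGroup_def \<theta>_auto)
  moreover have "G\<lparr>carrier := A\<rparr> \<cong> semidirect_product N' H' \<theta>"
  proof -
    let ?S = "semidirect_product N' H' \<theta>"
    define \<Phi> where "\<Phi> = (\<lambda>(n, h). f n \<otimes> g h)"
    have \<Phi>_mult: "\<Phi> (x \<otimes>\<^bsub>?S\<^esub> y) = \<Phi> x \<otimes> \<Phi> y" if "x \<in> carrier ?S" "y \<in> carrier ?S" for x y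
    proof -
      obtain n h m k where xy: "x = (n, h)" "y = (m, k)"
        by (metis surj_pair)
      then have c: "n \<in> carrier N'" "h \<in> carrier H'" "m \<in> carrier N'" "k \<in> carrier H'"
        using that by (simp_all add: semidirect_product_def)
      have "\<Phi> (x \<otimes>\<^bsub>?S\<^esub> y) = f n \<otimes> act h m \<otimes> (g h \<otimes> g k)"
        using c by (simp add: \<Phi>_def xy semidirect_product_def f_mult g_mult f_\<theta> \<theta>_closed)
      also have "\<dots> = \<Phi> x \<otimes> \<Phi> y"
        using c f_N(2) g_H(3) by (simp add: \<Phi>_def xy act_def m_assoc inv_solve_left' inv_solve_left)
      finally show ?thesis .
    qed
    have \<Phi>_bij: "bij_betw \<Phi> (carrier ?S) A"
    proof (rule bij_betw_imageI)
      show "inj_on \<Phi> (carrier ?S)"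
      proof (rule inj_onI)
        fix x y assume xy: "x \<in> carrier ?S" "y \<in> carrier ?S" "\<Phi> x = \<Phi> y"
        obtain n h m k where "x = (n, h)" "y = (m, k)"
          by (metis surj_pair)
        moreover from this have "f n = f m \<and> g h = g k"
          using xy f_N(1) g_H(1) by (intro internal_semidirect_unique[OF sd]) (simp_all add: semidirect_product_def \<Phi>_def)
        ultimately show "x = y"
          using xy(1,2) inj_onD[OF bij_betw_imp_inj_on[OF f_bij]] inj_onD[OF bij_betw_imp_inj_on[OF g_bij]]
          by (simp add: semidirect_product_def)
      qed
      show "\<Phi> ` carrier ?S = A"
      proof (rule equalityI; rule subsetI)
        fix a assume "a \<in> \<Phi> ` carrier ?S"
        then show "a \<in> A"
          using subsetD[OF D(4) f_N(1)] g_H(2) subgroup.m_closed[OF D(1)]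
          by (auto simp: semidirect_product_def \<Phi>_def)
      next
        fix a assume "a \<in> A"
        then obtain n h where nh: "n \<in> N" "h \<in> H" "a = n \<otimes> h"
          using D(8) by blast
        then obtain m k where "m \<in> carrier N'" "n = f m" "k \<in> carrier H'" "h = g k"
          using f_bij g_bij unfolding bij_betw_def by blast
        then show "a \<in> \<Phi> ` carrier ?S"
          using nh(3) by (intro image_eqI[of _ _ "(m, k)"]) (simp_all add: semidirect_product_def \<Phi>_def)
      qed
    qed
    have S_closed: "x \<otimes>\<^bsub>?S\<^esub> y \<in> carrier ?S" if "x \<in> carrier ?S" "y \<in> carrier ?S" for x y
      using that \<theta>_closed by (auto simp: semidirect_product_def)
    have "inv_into (carrier ?S) \<Phi> \<in> iso (G\<lparr>carrier := A\<rparr>) ?S"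
    proof (rule isoI)
      have inv: "inv_into (carrier ?S) \<Phi> a \<in> carrier ?S" "\<Phi> (inv_into (carrier ?S) \<Phi> a) = a" if "a \<in> A" for a
        using that \<Phi>_bij by (simp_all add: bij_betw_def inv_into_into f_inv_into_f)
      show "inv_into (carrier ?S) \<Phi> \<in> hom (G\<lparr>carrier := A\<rparr>) ?S"
      proof (rule homI)
        fix a b assume ab: "a \<in> carrier (G\<lparr>carrier := A\<rparr>)" "b \<in> carrier (G\<lparr>carrier := A\<rparr>)"
        then have "\<Phi> (inv_into (carrier ?S) \<Phi> a \<otimes>\<^bsub>?S\<^esub> inv_into (carrier ?S) \<Phi> b) = a \<otimes> b"
          using inv \<Phi>_mult by simp
        moreover have "inv_into (carrier ?S) \<Phi> a \<otimes>\<^bsub>?S\<^esub> inv_into (carrier ?S) \<Phi> b \<in> carrier ?S"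
          using ab inv(1) by (intro S_closed) simp_all
        ultimately have "inv_into (carrier ?S) \<Phi> (a \<otimes> b) = inv_into (carrier ?S) \<Phi> a \<otimes>\<^bsub>?S\<^esub> inv_into (carrier ?S) \<Phi> b"
          using inv_into_f_f[OF bij_betw_imp_inj_on[OF \<Phi>_bij]] by metis
        then show "inv_into (carrier ?S) \<Phi> (a \<otimes>\<^bsub>G\<lparr>carrier := A\<rparr>\<^esub> b) =
            inv_into (carrier ?S) \<Phi> a \<otimes>\<^bsub>?S\<^esub> inv_into (carrier ?S) \<Phi> b"
          by simp
      qed (use inv in simp)
      show "bij_betw (inv_into (carrier ?S) \<Phi>) (carrier (G\<lparr>carrier := A\<rparr>)) (carrier ?S)"
        using bij_betw_inv_into[OF \<Phi>_bij] by simp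
    qed
    then show ?thesis
      unfolding is_iso_def by blast
  qed
  ultimately show ?thesis by blast
qed

lemma ord_eq_prime:
  assumes "x \<in> carrier G" "x [^] p = \<one>" "x \<noteq> \<one>" "prime p"
  shows "ord x = p"
proof -
  have "ord x dvd p"
    using assms pow_eq_id by simp
  moreover have "ord x \<noteq> 1"
    using assms ord_eq_1 by simp
  ultimately show ?thesis
    using assms(4) prime_nat_iff by blast
qed

text \<open>The third power of \<open>y \<otimes> x\<close> is \<open>x\<close> and its fourth power
  is \<open>y\<close>, so this single element recovers both factors and has order 6. Everything
  takes place in the abelian group it generates.\<close>

lemma commuting_ord_2_3:
  assumes x: "x \<in> carrier G" "ord x = 2" and y: "y \<in> carrier G" "ord y = 3" and comm: "x \<otimes> y = y \<otimes> x"
  shows "generate G {x} <#> generate G {y} = generate G {y \<otimes> x}" (is "?X <#> ?Y = ?A")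
    and "internal_direct G (generate G {x} <#> generate G {y}) (generate G {x}) (generate G {y})"
    and "ord (y \<otimes> x) = 6"
proof -
  define a where "a = y \<otimes> x"
  have a: "a \<in> carrier G"
    using x y by (simp add: a_def)
  have pow: "a [^] (k::nat) = x [^] k \<otimes> y [^] k" for k
    unfolding a_def comm[symmetric] using comm x(1) y(1) by (rule pow_mult_distrib)
  have pow_one: "x [^] (k::nat) = \<one> \<longleftrightarrow> 2 dvd k" "y [^] (k::nat) = \<one> \<longleftrightarrow> 3 dvd k" for k
    using x y by (simp_all add: pow_eq_id)
  have "x [^] Suc 2 = x" "y [^] Suc 3 = y"
    unfolding nat_pow_Suc using pow_one(1)[of 2] pow_one(2)[of 3] x y by simp_all
  then have a3: "a [^] (3::nat) = x" and a4: "a [^] (4::nat) = y"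
    unfolding pow using pow_one(1)[of 4] pow_one(2)[of 3] x y by simp_all
  have "a [^] n = \<one> \<longleftrightarrow> 6 dvd n" for n :: nat
  proof
    assume "a [^] n = \<one>"
    moreover have "x [^] n = (a [^] n) [^] (3::nat)" "y [^] n = (a [^] n) [^] (4::nat)"
      using a by (simp_all add: a3[symmetric] a4[symmetric] nat_pow_pow mult.commute)
    ultimately have "x [^] n = \<one>" "y [^] n = \<one>"
      by simp_all
    then show "6 dvd n"
      unfolding pow_one by presburger
  next
    assume "6 dvd n"
    then have "2 dvd n" "3 dvd n"
      by presburger+
    then have "x [^] n = \<one>" "y [^] n = \<one>"
      by (simp_all only: pow_one)
    then show "a [^] n = \<one>"
      by (simp add: pow)
  qed
  then have ord: "ord a = 6"
    using ord_unique[OF a] by blast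
  then show "ord (y \<otimes> x) = 6"
    by (simp add: a_def)
  have gen_x: "?X = range (\<lambda>k::nat. x [^] k)" and gen_y: "?Y = range (\<lambda>k::nat. y [^] k)"
    and gen_a: "?A = range (\<lambda>k::nat. a [^] k)"
    using generate_pow_nat[OF x(1)] generate_pow_nat[OF y(1)] generate_pow_nat[OF a] x y ord
    by (auto simp: a_def)
  have sub: "subgroup ?X G" "subgroup ?Y G" "subgroup ?A G"
    using x y generate_is_subgroup by simp_all
  have "x [^] k = a [^] (3 * k)" "y [^] k = a [^] (4 * k)" for k :: nat
    using a by (simp_all add: a3[symmetric] a4[symmetric] nat_pow_pow)
  then have X: "?X \<subseteq> ?A" and Y: "?Y \<subseteq> ?A"
    unfolding gen_x gen_y gen_a by auto
  show A: "?X <#> ?Y = ?A"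
  proof (rule equalityI; rule subsetI)
    fix u assume "u \<in> ?X <#> ?Y"
    then show "u \<in> ?A"
      using X Y subgroup.m_closed[OF sub(3)] by (auto simp: set_mult_def)
  next
    fix u assume "u \<in> ?A"
    then obtain k :: nat where "u = a [^] k"
      unfolding gen_a by blast
    then show "u \<in> ?X <#> ?Y"
      unfolding pow gen_x gen_y set_mult_def by blast
  qed
  have comm_A: "u \<otimes> v \<otimes> inv u = v" if uv: "u \<in> ?A" "v \<in> ?A" for u v
  proof -
    obtain k l :: nat where "u = a [^] k" "v = a [^] l"
      using uv unfolding gen_a by blast
    then have "u \<otimes> v = v \<otimes> u" "u \<in> carrier G" "v \<in> carrier G"
      using a by (simp_all add: nat_pow_mult add.commute)
    then show ?thesis
      by (simp add: m_assoc)
  qed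
  have triv: "u = \<one>" if u: "u \<in> ?X" "u \<in> ?Y" for u
  proof -
    obtain k l :: nat where k: "u = x [^] k" and l: "u = y [^] l"
      using u unfolding gen_x gen_y by blast
    have uc: "u \<in> carrier G"
      using k x by simp
    \<comment> \<open>A common element has order dividing both 2 and 3.\<close>
    have "u [^] (2::nat) = \<one>"
      unfolding k using x pow_one(1) by (simp add: nat_pow_pow)
    moreover have "u [^] (3::nat) = \<one>"
      unfolding l using y pow_one(2) by (simp add: nat_pow_pow)
    ultimately have "ord u dvd 2" "ord u dvd 3"
      using uc by (simp_all add: pow_eq_id)
    then have "ord u dvd 1"
      using dvd_diff_nat[of "ord u" 3 2] by simp
    then show ?thesis
      using uc ord_eq_1 by simp
  qed
  have "internal_semidirect G (?X <#> ?Y) ?X ?Y"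
  proof (rule internal_semidirectI)
    show "\<exists>n\<in>?X. \<exists>h\<in>?Y. u = n \<otimes> h" if "u \<in> ?X <#> ?Y" for u
      using that by (auto simp: set_mult_def)
    show "u \<otimes> n \<otimes> inv u \<in> ?X" if "u \<in> ?X <#> ?Y" "n \<in> ?X" for u n
      using comm_A[of u n] that X unfolding A by auto
  qed (use sub X Y triv in \<open>simp_all add: A\<close>)
  moreover have "?Y \<lhd> G\<lparr>carrier := ?X <#> ?Y\<rparr>"
  proof -
    interpret GA: group "G\<lparr>carrier := ?A\<rparr>"
      using sub(3) by (rule subgroup_imp_group)
    have "u \<otimes> v \<otimes> inv u \<in> ?Y" if "u \<in> ?A" "v \<in> ?Y" for u v
      using comm_A[of u v] that Y by auto
    then show ?thesis
      unfolding A GA.normal_inv_iff using m_inv_consistent[OF sub(3)] subgroup_incl[OF sub(2,3) Y] by simp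
  qed
  ultimately show "internal_direct G (?X <#> ?Y) ?X ?Y"
    by (simp add: internal_direct_def)
qed

end

section \<open>The difference partition\<close>

lemma distinct_concat_mapD:
  assumes "distinct (concat (map f Ls))" "L \<in> set Ls" "M \<in> set Ls" "x \<in> set (f L)" "x \<in> set (f M)"
  shows "L = M"
  using assms by (induction Ls) auto

context gf8 begin

lemma subgroup_root_groups: "P \<in> root_groups \<Longrightarrow> subgroup P SL2"
  by (elim root_groupsE) (simp add: subgroup_root_group)

lemma card_root_groups: "P \<in> root_groups \<Longrightarrow> card P = 8"
  by (elim root_groupsE) (simp add: card_root_group)

text \<open>The eight groups \<open>root_group 1 q\<close> are already more than four.\<close>

lemma root_groups_avoid: "\<exists>P\<in>root_groups. P \<noteq> A \<and> P \<noteq> B \<and> P \<noteq> C \<and> P \<noteq> D"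
proof (rule ccontr)
  assume "\<not> ?thesis"
  moreover have "root_group 1 q \<in> root_groups" for q
    by (rule root_groupsI) simp
  ultimately have "range (root_group 1) \<subseteq> {A, B, C, D}"
    by blast
  then have "card (range (root_group 1)) \<le> card {A, B, C, D}"
    by (intro card_mono) auto
  moreover have "inj (root_group 1)"
    by (rule injI) (simp add: root_group_eq_iff add_eq_0_iff2)
  then have "card (range (root_group 1)) = 8"
    using card_image card_field by metis
  moreover have "card {A, B, C, D} \<le> 4"
    using card_length[of "[A, B, C, D]"] by simp
  ultimately show False
    by simp
qed

end

text \<open>As the union of the family consists of the elements of trace 0,
  \<open>fam_matching\<close> is \<open>matching_iff\<close>.\<close>

sublocale gf8 \<subseteq> fam: conjugate_family "SL2 :: ('a ^ 2 ^ 2) monoid" root_groups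
proof (intro conjugate_family.intro conjugate_family_axioms.intro)
  fix P Q :: "('a ^ 2 ^ 2) set" and h :: "'a ^ 2 ^ 2"
  assume *: "P \<in> root_groups" "Q \<in> root_groups" "h \<in> carrier SL2"
  have "u \<cdot> h \<cdot> v \<in> \<Union> root_groups \<longleftrightarrow> trace (u ** h ** v) = 0" if "u \<in> P" "v \<in> Q" for u v
  proof -
    have "det u = 1" "det v = 1"
      using that subsetD[OF root_groups_subset[OF *(1)]] subsetD[OF root_groups_subset[OF *(2)]] by auto
    then show ?thesis
      using *(3) by (simp add: Union_root_groups mult_SL2 det_mul)
  qed
  then have "(\<forall>u\<in>P. \<exists>!v. v \<in> Q \<and> u \<cdot> h \<cdot> v \<in> \<Union> root_groups) \<longleftrightarrow>
      (\<forall>u\<in>P. \<exists>!v. v \<in> Q \<and> trace (u ** h ** v) = 0)"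
    by (intro ball_cong refl arg_cong[where f = Ex1] ext conj_cong)
  then show "(\<forall>u\<in>P. \<exists>!v. v \<in> Q \<and> u \<cdot> h \<cdot> v \<in> \<Union> root_groups) \<longleftrightarrow>
      (P = Q) \<noteq> (conj_map SL2 h ` P = Q)"
    using matching_iff[of P Q h] * by simp
next
  fix P Q :: "('a ^ 2 ^ 2) set"
  assume "P \<in> root_groups" "Q \<in> root_groups"
  then show "\<exists>h\<in>carrier SL2. conj_map SL2 h ` P = Q"
    using root_groups_transitive by (metis carrier_SL2)
qed (auto simp: root_groups_conj one_SL2 group_SL2
    intro: subgroup_root_groups root_groups_faithful root_groups_avoid)

context gf8 begin

text \<open>The field being perfect, vectors correspond bijectively to elements of trace 0 through
  the parameter 1; the zero vector accounts for the identity.\<close>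

lemma card_trace0: "card {x :: 'a ^ 2 ^ 2. det x = 1 \<and> trace x = 0} = 64"
proof -
  have "bij_betw (\<lambda>(p, q). root_elt p q 1) UNIV {x :: 'a ^ 2 ^ 2. det x = 1 \<and> trace x = 0}"
  proof (rule bij_betw_imageI)
    have sq: "p = r" if "p\<^sup>2 = r\<^sup>2" for p r :: 'a
    proof -
      have "(p + r)\<^sup>2 = p\<^sup>2 + r\<^sup>2"
        by (simp add: power2_eq_square algebra_simps)
      then have "p + r = 0"
        using that by simp
      then show ?thesis
        by (simp add: add_eq_0_iff2)
    qed
    show "inj (\<lambda>(p :: 'a, q). root_elt p q 1)"
    proof (rule injI)
      fix u v :: "'a \<times> 'a"
      assume eq: "(\<lambda>(p, q). root_elt p q 1) u = (\<lambda>(p, q). root_elt p q 1) v"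
      obtain p q where u: "u = (p, q)"
        by (rule prod.exhaust)
      obtain r s where v: "v = (r, s)"
        by (rule prod.exhaust)
      have "p\<^sup>2 = r\<^sup>2" "q\<^sup>2 = s\<^sup>2"
        using eq by (simp_all add: u v root_elt_def)
      then show "u = v"
        unfolding u v by (simp only: sq[of p r] sq[of q s])
    qed
    show "range (\<lambda>(p, q). root_elt p q 1) = {x :: 'a ^ 2 ^ 2. det x = 1 \<and> trace x = 0}"
    proof (rule equalityI; rule subsetI)
      fix x assume "x \<in> {x :: 'a ^ 2 ^ 2. det x = 1 \<and> trace x = 0}"
      then have "det x = 1" "trace x = 0"
        by simp_all
      then obtain p q where "x = root_elt p q 1"
        by (rule trace0_root_elt)
      then show "x \<in> range (\<lambda>(p, q). root_elt p q 1)"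
        by (intro image_eqI[of _ _ "(p, q)"]) simp_all
    qed auto
  qed
  then have "card {x :: 'a ^ 2 ^ 2. det x = 1 \<and> trace x = 0} = CARD('a \<times> 'a)"
    by (rule bij_betw_same_card[symmetric])
  also have "\<dots> = 8 * 8"
    unfolding card_prod card_field by (rule refl)
  finally show ?thesis
    by simp
qed

lemma det_group_C8: "x \<in> set group_C8 \<Longrightarrow> det8 x = one8"
  using group_C8_det by blast

lemma group_C8_Cons: "group_C8 = one_mat8 # tl group_C8"
  by (simp add: group_C8_def upt_rec)

lemma group_C_minus_one: "group_C z - {\<one>\<^sub>S} = dec_mat ` set (tl group_C8)"
proof -
  have "distinct group_C8"
    using group_C8_distinct by (rule distinct_map_bits)
  then have "set group_C8 = insert one_mat8 (set (tl group_C8))" "one_mat8 \<notin> set (tl group_C8)"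
    using group_C8_Cons by (metis list.simps(15), metis distinct.simps(2))
  then have "group_C z = insert (mat 1) (dec_mat ` set (tl group_C8))" "mat 1 \<notin> dec_mat ` set (tl group_C8)"
    unfolding group_C_eq by (simp_all add: image_iff flip: dec_mat_one)
  then show ?thesis
    by (simp add: one_SL2)
qed

lemma subgroup_group_C: "subgroup (group_C z) SL2"
  unfolding group_C_def by (rule SL2.generate_is_subgroup) simp

lemma group_C_subset: "group_C z \<subseteq> carrier SL2"
  using subgroup.subset[OF subgroup_group_C] .

lemma card_group_C: "card (group_C z) = 9"
proof -
  have "card (group_C z) = card (set group_C8)"
    unfolding group_C_eq by (intro card_image inj_on_subset[OF inj_dec_mat]) simp
  also have "\<dots> = length group_C8"
    using group_C8_distinct by (intro distinct_card distinct_map_bits)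
  finally show ?thesis
    by (simp add: group_C8_def)
qed

text \<open>The trace separates the conjugates of \<open>T\<close> from the other parts. Among the
  former, disjointness is \<open>root_group_Int\<close>; among the latter, it is the distinctness of
  the one list \<open>Q\<close>.\<close>

lemma affine_unital_data_of_system8:
  assumes T: "sylow_subgroup 2 SL2 T" and Ls: "difference_system8 Ls"
  shows "affine_unital_data (group_C z) T ((\<lambda>L. dec_mat ` set L) ` set Ls)"
proof -
  define Q where "Q = concat (map quotients8 Ls) @ tl group_C8"
  have Q: "length Q = 440" "distinct Q" "\<And>x. x \<in> set Q \<Longrightarrow> trace8 x \<noteq> zero8"
    using Ls distinct_map_bits unfolding difference_system8_def Let_def Q_def by blast+
  have L: "length L = 9" "distinct L" "one_mat8 \<in> set L" "\<And>x. x \<in> set L \<Longrightarrow> det8 x = one8" if "L \<in> set Ls" for L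
    using Ls that distinct_map_bits unfolding difference_system8_def by blast+
  have quot: "quotients (dec_mat ` set L) = dec_mat ` set (quotients8 L)" if "L \<in> set Ls" for L
    using L(4)[OF that] by (rule quotients_eq)
  have dist_concat: "distinct (concat (map quotients8 Ls))"
    using Q(2) by (simp add: Q_def)
  have eqD: "L = M" if LM: "L \<in> set Ls" "M \<in> set Ls"
    and L: "x \<in> dec_mat ` set (quotients8 L)" and M: "x \<in> dec_mat ` set (quotients8 M)" for L M x
  proof -
    from L obtain a where a: "x = dec_mat a" "a \<in> set (quotients8 L)"
      by (rule imageE)
    from M obtain b where b: "x = dec_mat b" "b \<in> set (quotients8 M)"
      by (rule imageE)
    have "a = b"
      using a(1) b(1) by simp
    then show ?thesis
      using distinct_concat_mapD[OF dist_concat LM, of a] a(2) b(2) by simp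
  qed
  have C_disj: "x \<notin> dec_mat ` set (quotients8 L)"
    if L: "L \<in> set Ls" and C: "x \<in> dec_mat ` set (tl group_C8)" for L x
  proof
    assume "x \<in> dec_mat ` set (quotients8 L)"
    then obtain a where a: "x = dec_mat a" "a \<in> set (quotients8 L)"
      by (rule imageE)
    from C obtain b where b: "x = dec_mat b" "b \<in> set (tl group_C8)"
      by (rule imageE)
    have "a = b"
      using a(1) b(1) by simp
    then have "a \<in> set (concat (map quotients8 Ls))" "a \<in> set (tl group_C8)"
      using L a(2) b(2) by auto
    then show False
      using Q(2) unfolding Q_def distinct_append by blast
  qed
  have nonempty: "quotients8 L \<noteq> []" if "L \<in> set Ls" for L
  proof -
    have "\<not> (\<forall>x\<in>set L. \<forall>y\<in>set L. x = y)"
    proof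
      assume "\<forall>x\<in>set L. \<forall>y\<in>set L. x = y"
      then have "set L \<subseteq> {one_mat8}"
        using L(3)[OF that] by blast
      then have "card (set L) \<le> 1"
        using card_mono[of "{one_mat8}" "set L"] by simp
      then show False
        using L(1,2)[OF that] by (simp add: distinct_card)
    qed
    then obtain x y where "x \<in> set L" "y \<in> set L" "x \<noteq> y"
      by blast
    then have "mm8 x (inv8 y) \<in> set (quotients8 L)"
      unfolding mem_quotients8 by blast
    then show ?thesis
      by force
  qed
  have det_Q: "det (dec_mat x) = 1" if x: "x \<in> set Q" for x
  proof -
    consider L where "L \<in> set Ls" "x \<in> set (quotients8 L)" | "x \<in> set (tl group_C8)"
      using x by (auto simp: Q_def)
    then show ?thesis
    proof cases
      case 1
      then obtain a b where ab: "a \<in> set L" "b \<in> set L" "x = mm8 a (inv8 b)"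
        unfolding mem_quotients8 by blast
      then have "dec_mat a \<in> carrier SL2" "inv\<^sub>S (dec_mat b) \<in> carrier SL2" "dec_mat (inv8 b) = inv\<^sub>S (dec_mat b)"
        using L(4)[OF 1(1)] SL2.inv_closed[of "dec_mat b"] by (simp_all add: det_dec_mat inv_dec_mat)
      then show ?thesis
        unfolding ab(3) by (simp add: det_mul)
    next
      case 2
      then show ?thesis
        using det_group_C8 group_C8_Cons by (metis det_dec_mat dec_one list.set_intros(2))
    qed
  qed
  \<comment> \<open>Inclusion and equal size: \<open>Q\<close> has 440 entries, and 504 - 64
    elements have nonzero trace.\<close>
  have Q_eq: "dec_mat ` set Q = {x. det x = 1 \<and> trace x \<noteq> 0}"
  proof (rule card_subset_eq)
    have fin: "finite {x :: 'a ^ 2 ^ 2. det x = 1 \<and> P x}" for P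
      by (rule finite_subset[OF _ finite_SL2]) auto
    show "finite {x :: 'a ^ 2 ^ 2. det x = 1 \<and> trace x \<noteq> 0}"
      by (rule fin)
    show "dec_mat ` set Q \<subseteq> {x. det x = 1 \<and> trace x \<noteq> 0}"
      using det_Q Q(3) trace_dec_mat_eq_0_iff by auto
    have "card (dec_mat ` set Q) = card (set Q)"
      by (intro card_image inj_on_subset[OF inj_dec_mat]) simp
    then have "card (dec_mat ` set Q) = 440"
      using Q(1,2) by (simp add: distinct_card)
    moreover have "carrier SL2 = {x :: 'a ^ 2 ^ 2. det x = 1 \<and> trace x = 0} \<union> {x. det x = 1 \<and> trace x \<noteq> 0}"
      by auto
    then have "504 = card {x :: 'a ^ 2 ^ 2. det x = 1 \<and> trace x = 0} + card {x :: 'a ^ 2 ^ 2. det x = 1 \<and> trace x \<noteq> 0}"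
      unfolding card_SL2[symmetric] by (simp add: card_Un_disjoint fin disjoint_iff)
    ultimately show "card (dec_mat ` set Q) = card {x :: 'a ^ 2 ^ 2. det x = 1 \<and> trace x \<noteq> 0}"
      by (simp add: card_trace0)
  qed
  have conj: "conjugates T = root_groups"
    using T by (intro conjugates_eq_root_groups sylow_root_group)
  let ?\<D> = "(\<lambda>L. dec_mat ` set L) ` set Ls"
  let ?P = "{group_C z - {\<one>\<^sub>S}} \<union> {T' - {\<one>\<^sub>S} | T'. T' \<in> conjugates T} \<union> quotients ` ?\<D>"
  let ?F = "{dec_mat ` set (tl group_C8)} \<union> (\<lambda>T'. T' - {mat 1}) ` root_groups \<union>
      (\<lambda>L. dec_mat ` set (quotients8 L)) ` set Ls"
  have P: "?P = ?F"
    unfolding group_C_minus_one conj image_image using quot by (auto simp: one_SL2)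
  have trace_P: "trace x \<noteq> 0" if "x \<in> dec_mat ` set (tl group_C8) \<or> L \<in> set Ls \<and> x \<in> dec_mat ` set (quotients8 L)" for x L
  proof -
    have "x \<in> dec_mat ` set Q"
      using that by (auto simp: Q_def)
    then show ?thesis
      unfolding Q_eq by simp
  qed
  have trace_root: "trace x = 0" if "x \<in> R" "R \<in> root_groups" for x R
    using that Union_root_groups by blast
  have partition: "partition_on (carrier SL2 - {\<one>\<^sub>S}) ?P"
    unfolding P
  proof (rule partition_onI)
    have "\<Union> ?F = dec_mat ` set Q \<union> (\<Union> root_groups - {mat 1})"
      by (auto simp: Q_def)
    also have "\<dots> = carrier SL2 - {\<one>\<^sub>S}"
      unfolding Q_eq Union_root_groups by (auto simp: one_SL2 mat2_one)
    finally show "\<Union> ?F = carrier SL2 - {\<one>\<^sub>S}" .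
  next
    fix X Y
    assume X: "X \<in> ?F"
      and Y: "Y \<in> ?F"
      and ne: "X \<noteq> Y"
    have root: "x \<notin> R'" if "R \<in> root_groups" "R' \<in> root_groups" "x \<in> R" "x \<noteq> mat 1" "R \<noteq> R'" for R R' x
    proof -
      obtain p q where R: "R = root_group p q" "p \<noteq> 0 \<or> q \<noteq> 0"
        using \<open>R \<in> root_groups\<close> by (rule root_groupsE)
      obtain r s where R': "R' = root_group r s" "r \<noteq> 0 \<or> s \<noteq> 0"
        using \<open>R' \<in> root_groups\<close> by (rule root_groupsE)
      have "R \<inter> R' = {mat 1}"
        using root_group_Int[OF R(2) R'(2)] \<open>R \<noteq> R'\<close> unfolding R(1) R'(1) .
      then show ?thesis
        using \<open>x \<in> R\<close> \<open>x \<noteq> mat 1\<close> by blast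
    qed
    have "x \<notin> Y" if x: "x \<in> X" for x
    proof
      assume y: "x \<in> Y"
      show False
      \<comment> \<open>The trace of a common element decides of which kind both parts are.\<close>
      proof (cases "trace x = 0")
        case True
        then obtain R R' where "R \<in> root_groups" "X = R - {mat 1}" "R' \<in> root_groups" "Y = R' - {mat 1}"
          using X Y x y trace_P by blast
        then show False
          using root[of R R' x] x y ne by blast
      next
        case False
        then have "X \<in> {dec_mat ` set (tl group_C8)} \<union> (\<lambda>L. dec_mat ` set (quotients8 L)) ` set Ls"
          "Y \<in> {dec_mat ` set (tl group_C8)} \<union> (\<lambda>L. dec_mat ` set (quotients8 L)) ` set Ls"
          using X Y x y trace_root by blast+
        then show False
          using eqD C_disj x y ne by (elim UnE singletonE imageE) (simp, metis+)
      qed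
    qed
    then show "disjnt X Y"
      by (auto simp: disjnt_def)
  next
    have "tl group_C8 \<noteq> []"
      by (simp add: group_C8_def upt_rec)
    moreover have "R - {mat 1} \<noteq> {}" if "R \<in> root_groups" for R
    proof -
      obtain p q where R: "R = root_group p q" "p \<noteq> 0 \<or> q \<noteq> 0"
        using \<open>R \<in> root_groups\<close> by (rule root_groupsE)
      show ?thesis
      proof
        assume "R - {mat 1} = {}"
        then have "card R \<le> card {mat 1 :: 'a ^ 2 ^ 2}"
          by (intro card_mono) auto
        then show False
          using card_root_group[OF R(2)] R(1) by simp
      qed
    qed
    ultimately show "{} \<notin> ?F"
      using nonempty by auto
  qed
  have inj_quot: "inj_on quotients ?\<D>"
  proof (rule inj_onI)
    fix X Y assume "X \<in> ?\<D>" "Y \<in> ?\<D>" and eq: "quotients X = quotients Y"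
    then obtain L M where LM: "L \<in> set Ls" "X = dec_mat ` set L" "M \<in> set Ls" "Y = dec_mat ` set M"
      by blast
    obtain x where "x \<in> dec_mat ` set (quotients8 L)"
      using nonempty[OF LM(1)] by fastforce
    then have "L = M"
      using eqD[OF LM(1,3)] eq quot LM by simp
    then show "X = Y"
      using LM by simp
  qed
  have D: "X \<subseteq> carrier SL2 \<and> \<one>\<^sub>S \<in> X \<and> card X = 9 \<and>
      inj_on (\<lambda>(x, y). x \<cdot> inv\<^sub>S y) {(x, y). x \<in> X \<and> y \<in> X \<and> x \<noteq> y}" if "X \<in> ?\<D>" for X
  proof -
    obtain L where X: "L \<in> set Ls" "X = dec_mat ` set L"
      using \<open>X \<in> ?\<D>\<close> by blast
    have "card X = card (set L)"
      unfolding X(2) by (intro card_image inj_on_subset[OF inj_dec_mat]) simp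
    moreover have "inj_on (\<lambda>(x, y). x \<cdot> inv\<^sub>S y) {(x, y). x \<in> X \<and> y \<in> X \<and> x \<noteq> y}"
    proof (rule inj_onI)
      fix s t assume s: "s \<in> {(x, y). x \<in> X \<and> y \<in> X \<and> x \<noteq> y}" and t: "t \<in> {(x, y). x \<in> X \<and> y \<in> X \<and> x \<noteq> y}"
        and eq: "(case s of (x, y) \<Rightarrow> x \<cdot> inv\<^sub>S y) = (case t of (x, y) \<Rightarrow> x \<cdot> inv\<^sub>S y)"
      obtain a b where ab: "a \<in> set L" "b \<in> set L" "a \<noteq> b" "s = (dec_mat a, dec_mat b)"
        using s unfolding X(2) by blast
      obtain c d where cd: "c \<in> set L" "d \<in> set L" "c \<noteq> d" "t = (dec_mat c, dec_mat d)"
        using t unfolding X(2) by blast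
      have "dec_mat (mm8 a (inv8 b)) = dec_mat (mm8 c (inv8 d))"
        using eq ab cd L(4)[OF X(1)] by (simp add: mult_SL2 inv_dec_mat)
      then have eq': "mm8 a (inv8 b) = mm8 c (inv8 d)"
        by (simp only: dec_mat_eq_iff)
      have "distinct (quotients8 L)"
        using dist_concat X(1) by (auto simp: distinct_concat_iff)
      then have "inj_on (\<lambda>(x, y). mm8 x (inv8 y)) (set (filter (\<lambda>(x, y). x \<noteq> y) (List.product L L)))"
        unfolding quotients8_def distinct_map by blast
      from inj_onD[OF this, of "(a, b)" "(c, d)"] have "(a, b) = (c, d)"
        using ab cd eq' by simp
      then show "s = t"
        using ab cd by simp
    qed
    moreover have "\<one>\<^sub>S \<in> X"
      unfolding X(2) one_SL2 dec_mat_one[symmetric] using L(3)[OF X(1)] by (rule imageI)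
    ultimately show ?thesis
      using L[OF X(1)] X(2) by (auto simp: distinct_card det_dec_mat)
  qed
  show ?thesis
    unfolding affine_unital_data_def
    using subgroup_group_C card_group_C T D inj_quot partition by blast
qed

end

section \<open>Automorphisms of affine unitals\<close>

lemma mult_BijGroup: "\<alpha> \<in> Bij S \<Longrightarrow> \<beta> \<in> Bij S \<Longrightarrow> \<alpha> \<otimes>\<^bsub>BijGroup S\<^esub> \<beta> = compose S \<alpha> \<beta>"
  by (simp add: BijGroup_def)

lemma mult_BijGroup_apply:
  "\<alpha> \<in> Bij S \<Longrightarrow> \<beta> \<in> Bij S \<Longrightarrow> x \<in> S \<Longrightarrow> (\<alpha> \<otimes>\<^bsub>BijGroup S\<^esub> \<beta>) x = \<alpha> (\<beta> x)"
  by (simp add: mult_BijGroup compose_def)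

lemma one_BijGroup_apply: "x \<in> S \<Longrightarrow> \<one>\<^bsub>BijGroup S\<^esub> x = x"
  by (simp add: BijGroup_def)

lemma carrier_BijGroup: "carrier (BijGroup S) = Bij S"
  by (simp add: BijGroup_def)

lemma Bij_ext: "\<alpha> \<in> Bij S \<Longrightarrow> \<beta> \<in> Bij S \<Longrightarrow> (\<And>x. x \<in> S \<Longrightarrow> \<alpha> x = \<beta> x) \<Longrightarrow> \<alpha> = \<beta>"
  using Bij_imp_extensional extensionalityI by metis

lemma Bij_closed: "\<alpha> \<in> Bij S \<Longrightarrow> x \<in> S \<Longrightarrow> \<alpha> x \<in> S"
  using Bij_imp_funcset by blast

lemma Bij_inj: "\<alpha> \<in> Bij S \<Longrightarrow> inj_on \<alpha> S" and Bij_image: "\<alpha> \<in> Bij S \<Longrightarrow> \<alpha> ` S = S"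
  by (simp_all add: Bij_def bij_betw_def)

lemma Bij_restrictI: "bij_betw f S S \<Longrightarrow> restrict f S \<in> Bij S"
  unfolding Bij_def by (auto simp: bij_betw_def inj_on_def)

lemma inv_BijGroup_closed: "\<alpha> \<in> Bij S \<Longrightarrow> inv\<^bsub>BijGroup S\<^esub> \<alpha> \<in> Bij S"
  by (metis carrier_BijGroup group.inv_closed group_BijGroup)

lemma inv_BijGroup_apply:
  assumes "\<alpha> \<in> Bij S" "x \<in> S"
  shows "(inv\<^bsub>BijGroup S\<^esub> \<alpha>) (\<alpha> x) = x" "\<alpha> ((inv\<^bsub>BijGroup S\<^esub> \<alpha>) x) = x"
  using assms Bij_closed[OF assms] Bij_inj[OF assms(1)] Bij_image[OF assms(1)]
  by (simp_all add: inv_BijGroup f_inv_into_f)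

lemma image_mult_BijGroup:
  assumes "\<alpha> \<in> Bij S" "\<beta> \<in> Bij S" "B \<subseteq> S"
  shows "(\<alpha> \<otimes>\<^bsub>BijGroup S\<^esub> \<beta>) ` B = \<alpha> ` \<beta> ` B"
  unfolding image_image using assms by (intro image_cong) (auto simp: mult_BijGroup_apply)

lemma subgroup_aut_incidence:
  assumes "snd J \<subseteq> Pow (fst J)"
  shows "subgroup (aut_incidence J) (BijGroup (fst J))"
proof -
  interpret group "BijGroup (fst J)"
    by (rule group_BijGroup)
  have image_image_set: "(`) (\<alpha> \<otimes>\<^bsub>BijGroup (fst J)\<^esub> \<beta>) ` X = (`) \<alpha> ` (`) \<beta> ` X"
    if "\<alpha> \<in> Bij (fst J)" "\<beta> \<in> Bij (fst J)" "X \<subseteq> Pow (fst J)" for \<alpha> \<beta> X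
  proof -
    have "(`) (\<alpha> \<otimes>\<^bsub>BijGroup (fst J)\<^esub> \<beta>) ` X = (\<lambda>B. \<alpha> ` \<beta> ` B) ` X"
      using that by (intro image_cong refl image_mult_BijGroup) auto
    then show ?thesis
      by (simp only: image_image)
  qed
  have one: "(`) \<one>\<^bsub>BijGroup (fst J)\<^esub> ` snd J = snd J"
  proof -
    have "(`) \<one>\<^bsub>BijGroup (fst J)\<^esub> ` snd J = (\<lambda>B. B) ` snd J"
      using assms by (intro image_cong refl) (force simp: one_BijGroup_apply image_iff)
    then show ?thesis
      by simp
  qed
  show ?thesis
  proof (rule subgroupI)
    show "aut_incidence J \<subseteq> carrier (BijGroup (fst J))"
      by (auto simp: aut_incidence_def carrier_BijGroup)
    have "\<one>\<^bsub>BijGroup (fst J)\<^esub> \<in> aut_incidence J"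
      using one one_closed by (simp add: aut_incidence_def carrier_BijGroup)
    then show "aut_incidence J \<noteq> {}"
      by blast
  next
    fix \<alpha> assume "\<alpha> \<in> aut_incidence J"
    then have \<alpha>: "\<alpha> \<in> Bij (fst J)" "(`) \<alpha> ` snd J = snd J"
      by (simp_all add: aut_incidence_def)
    have "(`) (inv\<^bsub>BijGroup (fst J)\<^esub> \<alpha>) ` snd J = (`) (inv\<^bsub>BijGroup (fst J)\<^esub> \<alpha>) ` (`) \<alpha> ` snd J"
      by (simp only: \<alpha>(2))
    also have "\<dots> = (`) (inv\<^bsub>BijGroup (fst J)\<^esub> \<alpha> \<otimes>\<^bsub>BijGroup (fst J)\<^esub> \<alpha>) ` snd J"
      by (rule image_image_set[OF inv_BijGroup_closed[OF \<alpha>(1)] \<alpha>(1) assms, symmetric])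
    also have "\<dots> = snd J"
      using l_inv[of \<alpha>] \<alpha>(1) one by (simp add: carrier_BijGroup)
    finally show "inv\<^bsub>BijGroup (fst J)\<^esub> \<alpha> \<in> aut_incidence J"
      using \<alpha>(1) inv_BijGroup_closed by (simp add: aut_incidence_def)
  next
    fix \<alpha> \<beta> assume "\<alpha> \<in> aut_incidence J" "\<beta> \<in> aut_incidence J"
    then have *: "\<alpha> \<in> Bij (fst J)" "(`) \<alpha> ` snd J = snd J" "\<beta> \<in> Bij (fst J)" "(`) \<beta> ` snd J = snd J"
      by (simp_all add: aut_incidence_def)
    then show "\<alpha> \<otimes>\<^bsub>BijGroup (fst J)\<^esub> \<beta> \<in> aut_incidence J"
      using image_image_set[OF *(1,3) assms] m_closed[of \<alpha> \<beta>] by (simp add: aut_incidence_def carrier_BijGroup)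
  qed
qed

text \<open>There are finitely many blocks and the induced map on them is injective, so mapping
  blocks to blocks already makes it surjective.\<close>

lemma aut_incidenceI:
  assumes "\<alpha> \<in> Bij (fst J)" "finite (fst J)" "snd J \<subseteq> Pow (fst J)" "\<And>B. B \<in> snd J \<Longrightarrow> \<alpha> ` B \<in> snd J"
  shows "\<alpha> \<in> aut_incidence J"
proof -
  have "finite (snd J)"
    using assms(2,3) finite_subset by blast
  moreover have "inj_on ((`) \<alpha>) (snd J)"
    using assms(3) inj_on_image_Pow[OF Bij_inj[OF assms(1)]] by (rule inj_on_subset[rotated])
  ultimately have "(`) \<alpha> ` snd J = snd J"
    using assms(4) by (intro endo_inj_surj) auto
  with assms(1) show ?thesis
    by (simp add: aut_incidence_def)
qed

lemma (in group) image_r_coset_hom: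
  assumes "\<alpha> \<in> hom G G" "H \<subseteq> carrier G" "x \<in> carrier G"
  shows "\<alpha> ` (H #> x) = \<alpha> ` H #> \<alpha> x"
proof -
  have "\<alpha> (h \<otimes> x) = \<alpha> h \<otimes> \<alpha> x" if "h \<in> H" for h
    using assms that by (auto intro: hom_mult)
  moreover have "H #> x = (\<lambda>h. h \<otimes> x) ` H" "\<alpha> ` H #> \<alpha> x = (\<lambda>h. h \<otimes> \<alpha> x) ` \<alpha> ` H"
    by (auto simp: r_coset_def)
  ultimately show ?thesis
    by (simp add: image_image)
qed

context gf8 begin

lemma g_neq_one: "mat_g z \<noteq> \<one>\<^sub>S"
proof
  assume "mat_g z = \<one>\<^sub>S"
  then have "group_C z = {\<one>\<^sub>S}"
    by (simp add: group_C_def SL2.generate_one)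
  then show False
    using card_group_C by simp
qed

lemma g_mem_C: "mat_g z \<in> group_C z"
  by (simp add: group_C_def generate.incl)

lemma ex_conj_g_notin_C: "\<exists>y. det y = 1 \<and> conj_map SL2 y (mat_g z) \<notin> group_C z"
proof -
  define u where "u = (one8, pow8 1, zero8, one8)"
  have det: "det8 u = one8" "det8 mat_g8 = one8"
    unfolding u_def by code_simp+
  have "dec_mat (conj8 u mat_g8) \<notin> group_C z"
    unfolding group_C_eq u_def using group_C8_not_normal by (simp add: image_iff del: pow8.simps)
  then have "conj_map SL2 (dec_mat u) (mat_g z) \<notin> group_C z"
    using conj_dec_mat[OF det] by (simp add: dec_mat_g)
  then show ?thesis
    using det(1) det_dec_mat_eq_1_iff by blast
qed

text \<open>The image is a subgroup of order 8, and the root groups are all of these.\<close>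

lemma auto_root_group:
  assumes "\<alpha> \<in> auto SL2" "Q \<in> root_groups"
  shows "\<alpha> ` Q \<in> root_groups"
proof -
  have "inj_on \<alpha> Q"
    using assms(1) by (intro inj_on_subset[OF Bij_inj root_groups_subset[OF assms(2)]]) (simp add: auto_def)
  then have "card (\<alpha> ` Q) = 8"
    using card_image card_root_groups[OF assms(2)] by metis
  moreover have "group_hom SL2 SL2 \<alpha>"
    using assms(1) by unfold_locales (simp add: auto_def)
  then have "subgroup (\<alpha> ` Q) SL2"
    by (rule group_hom.subgroup_img_is_subgroup[OF _ subgroup_root_groups[OF assms(2)]])
  ultimately show ?thesis
    by (intro sylow_root_group) (simp add: sylow_subgroup_iff)
qed

end

text \<open>Both unitals are instances, so the reduction of their automorphisms to group
  automorphisms is carried out once.\<close>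

locale affine_unital = gf8 +
  fixes T :: "('a ^ 2 ^ 2) set" and \<D>
  assumes data: "affine_unital_data (group_C z) T \<D>"
begin

abbreviation blocks :: "('a ^ 2 ^ 2) set set" where
  "blocks \<equiv> snd (unital (group_C z) T \<D>)"

abbreviation stab_one :: "('a ^ 2 ^ 2 \<Rightarrow> 'a ^ 2 ^ 2) set" where
  "stab_one \<equiv> Aut_stabilizer (unital (group_C z) T \<D>) \<one>\<^sub>S"

abbreviation aut_unital :: "('a ^ 2 ^ 2 \<Rightarrow> 'a ^ 2 ^ 2) set" where
  "aut_unital \<equiv> aut_incidence (unital (group_C z) T \<D>)"

lemma conjugates_T: "conjugates T = root_groups"
  using data by (intro conjugates_eq_root_groups sylow_root_group) (simp add: affine_unital_data_def)

lemma D_facts: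
  assumes "D \<in> \<D>"
  shows "D \<subseteq> carrier SL2" "card D = 9"
    "inj_on (\<lambda>(x, y). x \<cdot> inv\<^sub>S y) {(x, y). x \<in> D \<and> y \<in> D \<and> x \<noteq> y}"
  using data assms unfolding affine_unital_data_def by blast+

lemma blockE:
  assumes "B \<in> blocks"
  obtains x where "x \<in> carrier SL2" "B = group_C z #>\<^sub>S x"
  | P x where "P \<in> root_groups" "x \<in> carrier SL2" "B = P #>\<^sub>S x"
  | D x where "D \<in> \<D>" "x \<in> carrier SL2" "B = D #>\<^sub>S x"
  using assms unfolding unital_def conjugates_T snd_conv by blast

lemma block_C: "x \<in> carrier SL2 \<Longrightarrow> group_C z #>\<^sub>S x \<in> blocks"
  and block_T: "P \<in> root_groups \<Longrightarrow> x \<in> carrier SL2 \<Longrightarrow> P #>\<^sub>S x \<in> blocks"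
  and block_D: "D \<in> \<D> \<Longrightarrow> x \<in> carrier SL2 \<Longrightarrow> D #>\<^sub>S x \<in> blocks"
  unfolding unital_def conjugates_T snd_conv by blast+

lemma points_unital: "fst (unital (group_C z) T \<D>) = carrier SL2"
  by (simp add: unital_def)

lemma blocks_subset: "blocks \<subseteq> Pow (carrier SL2)"
proof
  fix B assume "B \<in> blocks"
  then show "B \<in> Pow (carrier SL2)"
    by (cases rule: blockE)
      (use SL2.r_coset_subset_G[OF group_C_subset] SL2.r_coset_subset_G[OF root_groups_subset]
        SL2.r_coset_subset_G[OF D_facts(1)] in \<open>simp_all del: carrier_SL2\<close>)
qed

text \<open>Translates keep the size, which is 9 for \<open>C\<close> and for the members of the
  system. Hence an automorphism, which preserves block sizes, preserves the lines.\<close>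

lemma short_eq: "fam.short = {B \<in> blocks. card B = 8}"
proof (rule equalityI; rule subsetI)
  fix B assume "B \<in> fam.short"
  then obtain P x where "P \<in> root_groups" "x \<in> carrier SL2" "B = P #>\<^sub>S x"
    by (rule fam.shortE)
  then show "B \<in> {B \<in> blocks. card B = 8}"
    using block_T SL2.card_r_coset[OF root_groups_subset] card_root_groups by simp
next
  fix B assume "B \<in> {B \<in> blocks. card B = 8}"
  then have "B \<in> blocks" "card B = 8"
    by simp_all
  then show "B \<in> fam.short"
  proof (cases rule: blockE)
    case (1 x)
    then show ?thesis
      using SL2.card_r_coset[OF group_C_subset] card_group_C \<open>card B = 8\<close> by simp
  next
    case (2 P x)
    then show ?thesis
      using fam.shortI by simp
  next
    case (3 D x)
    then show ?thesis
      using SL2.card_r_coset[OF D_facts(1)] D_facts(2) \<open>card B = 8\<close> by simp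
  qed
qed

lemma block_r_coset:
  assumes "B \<in> blocks" "y \<in> carrier SL2"
  shows "B #>\<^sub>S y \<in> blocks"
  using assms(1)
proof (cases rule: blockE)
  case (1 x)
  then show ?thesis
    using assms(2) SL2.coset_mult_assoc[OF group_C_subset] block_C by (metis SL2.m_closed)
next
  case (2 P x)
  then show ?thesis
    using assms(2) SL2.coset_mult_assoc[OF root_groups_subset] block_T by (metis SL2.m_closed)
next
  case (3 D x)
  then show ?thesis
    using assms(2) SL2.coset_mult_assoc[OF D_facts(1)] block_D by (metis SL2.m_closed)
qed

text \<open>In a translate of \<open>D \<in> \<D>\<close> containing \<open>1\<close>, \<open>a\<close> and \<open>a\<^sup>2\<close>, the quotient \<open>a\<close> would arise twice.\<close>

lemma block_eq_C:
  assumes B: "B \<in> blocks" "card B = 9" "\<one>\<^sub>S \<in> B"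
    and a: "a \<in> B" "a \<cdot> a \<in> B" "a \<noteq> \<one>\<^sub>S"
  shows "B = group_C z"
  using B(1)
proof (cases rule: blockE)
  case (1 x)
  then have "group_C z #>\<^sub>S x = group_C z #>\<^sub>S \<one>\<^sub>S"
    using B(3) subgroup_group_C by (intro SL2.repr_independence) auto
  then show ?thesis
    using 1 SL2.coset_mult_one[OF group_C_subset] by simp
next
  case (2 P x)
  then show ?thesis
    using B(2) SL2.card_r_coset[OF root_groups_subset] card_root_groups by simp
next
  case (3 D x)
  have ac: "a \<in> carrier SL2"
    using blocks_subset B(1) a(1) by blast
  have mem: "u \<cdot> inv\<^sub>S x \<in> D" if "u \<in> B" for u
  proof -
    obtain d where d: "d \<in> D" "u = d \<cdot> x"
      using \<open>u \<in> B\<close> unfolding 3(3) r_coset_def by blast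
    then have "u \<cdot> inv\<^sub>S x = d"
      using subsetD[OF D_facts(1)[OF 3(1)] d(1)] 3(2) SL2.inv_closed[OF 3(2)]
      by (simp add: SL2.m_assoc del: carrier_SL2)
    with d show ?thesis
      by simp
  qed
  define d0 d1 d2 where "d0 = inv\<^sub>S x" and "d1 = a \<cdot> inv\<^sub>S x"
    and "d2 = a \<cdot> a \<cdot> inv\<^sub>S x"
  have xc: "inv\<^sub>S x \<in> carrier SL2"
    using 3(2) by (rule SL2.inv_closed)
  have "d0 \<in> D" "d1 \<in> D" "d2 \<in> D"
    using mem[OF B(3)] mem[OF a(1)] mem[OF a(2)] xc unfolding d0_def d1_def d2_def by (simp_all only: SL2.l_one)
  moreover have "d0 \<noteq> d1"
    using a(3) ac xc by (auto simp: d0_def d1_def simp del: carrier_SL2)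
  moreover have "d1 \<noteq> d2"
    using a(3) ac xc by (auto simp: d1_def d2_def SL2.m_assoc simp del: carrier_SL2)
  moreover have "d1 \<cdot> inv\<^sub>S d0 = a" "d2 \<cdot> inv\<^sub>S d1 = a"
  proof -
    have "d1 = a \<cdot> d0" "d2 = a \<cdot> d1" "d0 \<in> carrier SL2" "d1 \<in> carrier SL2"
      using ac xc by (simp_all add: d0_def d1_def d2_def SL2.m_assoc del: carrier_SL2)
    moreover have "(a \<cdot> y) \<cdot> inv\<^sub>S y = a" if "y \<in> carrier SL2" for y
      using ac that by (simp add: SL2.m_assoc del: carrier_SL2)
    ultimately show "d1 \<cdot> inv\<^sub>S d0 = a" "d2 \<cdot> inv\<^sub>S d1 = a"
      by metis+
  qed
  ultimately show ?thesis
    using inj_onD[OF D_facts(3)[OF 3(1)], of "(d1, d0)" "(d2, d1)"] by simp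
qed

section \<open>Automorphisms of the unital that fix 1\<close>

context
  fixes \<alpha> assumes \<alpha>: "\<alpha> \<in> aut_unital" and \<alpha>_one: "\<alpha> \<one>\<^sub>S = \<one>\<^sub>S"
begin

lemma aut_Bij: "\<alpha> \<in> Bij (carrier SL2)" and aut_image_blocks: "(`) \<alpha> ` blocks = blocks"
  using \<alpha> by (simp_all add: aut_incidence_def points_unital)

lemma aut_block: "B \<in> blocks \<Longrightarrow> \<alpha> ` B \<in> blocks"
  using aut_image_blocks by blast

lemma aut_card: "B \<subseteq> carrier SL2 \<Longrightarrow> card (\<alpha> ` B) = card B"
  using Bij_inj[OF aut_Bij] by (intro card_image) (rule inj_on_subset)

lemma aut_short_aut: "fam.short_aut \<alpha>"
  unfolding fam.short_aut_def
proof (intro conjI)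
  show "bij_betw \<alpha> (carrier SL2) (carrier SL2)"
    using aut_Bij by (simp add: Bij_def)
  show "(`) \<alpha> ` fam.short = fam.short"
  proof (rule equalityI; rule subsetI)
    fix B assume "B \<in> (`) \<alpha> ` fam.short"
    then obtain B' where B': "B' \<in> blocks" "card B' = 8" "B = \<alpha> ` B'"
      unfolding short_eq by blast
    then have "card B = 8"
      using aut_card[of B'] blocks_subset by auto
    then show "B \<in> fam.short"
      using aut_block B' unfolding short_eq by simp
  next
    fix B assume B: "B \<in> fam.short"
    then obtain B' where B': "B' \<in> blocks" "B = \<alpha> ` B'"
      using aut_image_blocks unfolding short_eq by blast
    then have "card B' = 8"
      using aut_card[of B'] blocks_subset B unfolding short_eq by auto
    then show "B \<in> (`) \<alpha> ` fam.short"
      using B' unfolding short_eq by blast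
  qed
qed (rule \<alpha>_one)

lemma aut_image_C: "\<alpha> ` group_C z = group_C z"
proof (rule block_eq_C)
  note one = subgroup.one_closed[OF subgroup_group_C]
  have "group_C z = group_C z #>\<^sub>S \<one>\<^sub>S"
    using SL2.coset_mult_one[OF group_C_subset] by simp
  then show "\<alpha> ` group_C z \<in> blocks"
    using aut_block[OF block_C[OF SL2.one_closed]] by simp
  show "card (\<alpha> ` group_C z) = 9"
    using aut_card[OF group_C_subset] card_group_C by simp
  show "\<one>\<^sub>S \<in> \<alpha> ` group_C z"
    using one \<alpha>_one by (metis imageI)
  show "\<alpha> (mat_g z) \<in> \<alpha> ` group_C z"
    using g_mem_C by (rule imageI)
  \<comment> \<open>For a square the order of the factors is immaterial, so homomorphisms and
    anti-homomorphisms need not be told apart yet.\<close>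
  have "\<alpha> (mat_g z \<cdot> mat_g z) = \<alpha> (mat_g z) \<cdot> \<alpha> (mat_g z)"
    using fam.short_aut_hom_or_antihom[OF aut_short_aut] by auto
  then show "\<alpha> (mat_g z) \<cdot> \<alpha> (mat_g z) \<in> \<alpha> ` group_C z"
    using subgroup.m_closed[OF subgroup_group_C g_mem_C g_mem_C] by (metis imageI)
  show "\<alpha> (mat_g z) \<noteq> \<one>\<^sub>S"
    using inj_onD[OF Bij_inj[OF aut_Bij], of "mat_g z" "\<one>\<^sub>S"] \<alpha>_one g_neq_one
      subsetD[OF group_C_subset g_mem_C] SL2.one_closed by (auto simp del: carrier_SL2)
qed

text \<open>An anti-automorphism would take right cosets of C to left cosets. For \<open>y\<close>
  with C^y different from C, the left coset by the inverse of \<open>y\<close> would thus be a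
  block, and so would its right translate by \<open>y\<close>, which is C^y. But that is a subgroup
  of order 9, and by \<open>block_eq_C\<close> it would equal C.\<close>

lemma aut_hom:
  assumes xy: "x \<in> carrier SL2" "y \<in> carrier SL2"
  shows "\<alpha> (x \<cdot> y) = \<alpha> x \<cdot> \<alpha> y"
proof (rule ccontr)
  assume "\<alpha> (x \<cdot> y) \<noteq> \<alpha> x \<cdot> \<alpha> y"
  then have anti: "\<alpha> (x \<cdot> y) = \<alpha> y \<cdot> \<alpha> x" if "x \<in> carrier SL2" "y \<in> carrier SL2" for x y
    using fam.short_aut_hom_or_antihom[OF aut_short_aut] xy that by blast
  obtain y where y: "y \<in> carrier SL2" "conj_map SL2 y (mat_g z) \<notin> group_C z"
    using ex_conj_g_notin_C by auto
  have iy: "inv\<^sub>S y \<in> carrier SL2"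
    using y(1) by (rule SL2.inv_closed)
  then obtain v where v: "v \<in> carrier SL2" "\<alpha> v = inv\<^sub>S y"
    using Bij_image[OF aut_Bij] by (metis imageE)
  let ?B = "\<alpha> ` (group_C z #>\<^sub>S v) #>\<^sub>S y"
  have B: "?B = conj_map SL2 y ` group_C z"
  proof -
    have "\<alpha> ` (group_C z #>\<^sub>S v) = (\<lambda>c. inv\<^sub>S y \<cdot> \<alpha> c) ` group_C z"
      unfolding r_coset_def using anti[OF _ v(1)] group_C_subset v(2) by force
    also have "\<dots> = (\<lambda>c. inv\<^sub>S y \<cdot> c) ` \<alpha> ` group_C z"
      by (simp only: image_image)
    also have "\<alpha> ` group_C z = group_C z"
      by (rule aut_image_C)
    finally have "?B = (\<lambda>c. inv\<^sub>S y \<cdot> c \<cdot> y) ` group_C z"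
      unfolding r_coset_def by auto
    also have "\<dots> = conj_map SL2 y ` group_C z"
      using group_C_subset by (intro image_cong) (auto simp: conj_map_def)
    finally show ?thesis .
  qed
  have conj_mult: "conj_map SL2 y (a \<cdot> b) = conj_map SL2 y a \<cdot> conj_map SL2 y b"
    if "a \<in> carrier SL2" "b \<in> carrier SL2" for a b
    using that y(1) iy by (simp add: conj_map_def SL2.m_assoc SL2.inv_solve_left del: carrier_SL2)
      (simp add: SL2.m_assoc[symmetric] del: carrier_SL2)
  have inj: "inj_on (conj_map SL2 y) (carrier SL2)"
    using y(1) iy by (intro inj_onI) (simp add: conj_map_def del: carrier_SL2)
  have conj_one: "conj_map SL2 y \<one>\<^sub>S = \<one>\<^sub>S"
    using y(1) iy by (simp add: conj_map_def del: carrier_SL2)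
  note gc = subsetD[OF group_C_subset g_mem_C]
  have "?B = group_C z"
  proof (rule block_eq_C[of _ "conj_map SL2 y (mat_g z)"])
    show "?B \<in> blocks"
      by (rule block_r_coset[OF aut_block[OF block_C[OF v(1)]] y(1)])
    show "card ?B = 9"
      unfolding B using card_image[OF inj_on_subset[OF inj group_C_subset]] card_group_C by simp
    show "\<one>\<^sub>S \<in> ?B"
      unfolding B using conj_one subgroup.one_closed[OF subgroup_group_C] by (metis imageI)
    show "conj_map SL2 y (mat_g z) \<in> ?B"
      unfolding B using g_mem_C by (rule imageI)
    show "conj_map SL2 y (mat_g z) \<cdot> conj_map SL2 y (mat_g z) \<in> ?B"
      unfolding B conj_mult[OF gc gc, symmetric]
      using subgroup.m_closed[OF subgroup_group_C g_mem_C g_mem_C] by (rule imageI)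
    show "conj_map SL2 y (mat_g z) \<noteq> \<one>\<^sub>S"
      using inj_onD[OF inj, of "mat_g z" "\<one>\<^sub>S"] gc conj_one g_neq_one SL2.one_closed
      by (auto simp del: carrier_SL2)
  qed
  then show False
    using y(2) g_mem_C unfolding B by blast
qed

lemma aut_auto_stab: "\<alpha> \<in> auto_stab (group_C z)"
  using aut_Bij aut_image_C aut_hom Bij_closed[OF aut_Bij]
  unfolding auto_stab_def auto_def by (auto intro!: homI)

end

text \<open>Automorphisms of the group permute the cosets of the Sylow 2-subgroups, and those of C
  when C is fixed. What remains to be checked is the system itself.\<close>

lemma auto_stab_aut:
  assumes \<alpha>: "\<alpha> \<in> auto_stab (group_C z)"
    and D: "\<And>D. D \<in> \<D> \<Longrightarrow> \<exists>D'\<in>\<D>. \<exists>y\<in>carrier SL2. \<alpha> ` D = D' #>\<^sub>S y"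
  shows "\<alpha> \<in> aut_unital"
proof (rule aut_incidenceI)
  have auto: "\<alpha> \<in> auto SL2" "\<alpha> ` group_C z = group_C z"
    using \<alpha> by (simp_all add: auto_stab_def)
  then have hom: "\<alpha> \<in> hom SL2 SL2" and Bij: "\<alpha> \<in> Bij (carrier SL2)"
    by (simp_all add: auto_def)
  show "\<alpha> \<in> Bij (fst (unital (group_C z) T \<D>))"
    using Bij by (simp add: points_unital)
  fix B assume "B \<in> blocks"
  then show "\<alpha> ` B \<in> blocks"
  proof (cases rule: blockE)
    case (1 x)
    then show ?thesis
      using SL2.image_r_coset_hom[OF hom group_C_subset] auto(2) block_C Bij_closed[OF Bij] by simp
  next
    case (2 P x)
    then show ?thesis
      using SL2.image_r_coset_hom[OF hom root_groups_subset] auto_root_group[OF auto(1)] block_T Bij_closed[OF Bij] by simp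
  next
    case (3 D x)
    obtain D' y where D': "D' \<in> \<D>" "y \<in> carrier SL2" "\<alpha> ` D = D' #>\<^sub>S y"
      using D[OF 3(1)] by blast
    have "\<alpha> ` B = D' #>\<^sub>S y #>\<^sub>S \<alpha> x"
      using 3 D'(3) SL2.image_r_coset_hom[OF hom D_facts(1)] by simp
    then show ?thesis
      using block_r_coset[OF block_D[OF D'(1,2)]] Bij_closed[OF Bij 3(2)] by simp
  qed
qed (simp_all add: points_unital blocks_subset)

end

section \<open>Automorphisms of \<open>SL(2, 8)\<close> preserving \<open>C\<close>\<close>

lemma (in group) conj_map_hom:
  assumes "h \<in> carrier G" "x \<in> carrier G" "y \<in> carrier G"
  shows "conj_map G h (x \<otimes> y) = conj_map G h x \<otimes> conj_map G h y"
proof -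
  have "h \<otimes> (inv h \<otimes> w) = w" if "w \<in> carrier G" for w
    using assms(1) that by (simp flip: m_assoc)
  then show ?thesis
    using assms by (simp add: conj_map_def m_assoc)
qed

lemma (in group) conj_map_auto:
  assumes "h \<in> carrier G"
  shows "conj_map G h \<in> auto G"
proof -
  have "bij_betw (conj_map G h) (carrier G) (carrier G)"
    using assms by (intro bij_betw_byWitness[where f' = "conj_map G (inv h)"])
      (auto simp: conj_map_mult[symmetric] conj_map_one)
  moreover have "conj_map G h \<in> extensional (carrier G)"
    by (simp add: conj_map_def)
  moreover have "conj_map G h \<in> hom G G"
    using assms by (intro homI conj_map_hom) auto
  ultimately show ?thesis
    by (simp add: auto_def Bij_def)
qed

lemma auto_Bij: "\<alpha> \<in> auto G \<Longrightarrow> \<alpha> \<in> Bij (carrier G)"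
  and auto_mult: "\<alpha> \<in> auto G \<Longrightarrow> x \<in> carrier G \<Longrightarrow> y \<in> carrier G \<Longrightarrow> \<alpha> (x \<otimes>\<^bsub>G\<^esub> y) = \<alpha> x \<otimes>\<^bsub>G\<^esub> \<alpha> y"
  by (simp_all add: auto_def hom_def)

lemma (in group) auto_group_hom: "\<alpha> \<in> auto G \<Longrightarrow> group_hom G G \<alpha>"
  by unfold_locales (simp add: auto_def)

lemma (in group) auto_one: "\<alpha> \<in> auto G \<Longrightarrow> \<alpha> \<one> = \<one>"
  and auto_inv: "\<alpha> \<in> auto G \<Longrightarrow> x \<in> carrier G \<Longrightarrow> \<alpha> (inv x) = inv (\<alpha> x)"
  and auto_pow: "\<alpha> \<in> auto G \<Longrightarrow> x \<in> carrier G \<Longrightarrow> \<alpha> (x [^] (n::nat)) = \<alpha> x [^] n"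
  using group_hom.hom_one[OF auto_group_hom] group_hom.hom_inv[OF auto_group_hom]
    group_hom.hom_nat_pow[OF auto_group_hom] by blast+

lemma (in group) auto_conj_map:
  assumes "\<alpha> \<in> auto G" "h \<in> carrier G" "x \<in> carrier G"
  shows "\<alpha> (conj_map G h x) = conj_map G (\<alpha> h) (\<alpha> x)"
  using assms Bij_closed[OF auto_Bij[OF assms(1)]]
  by (simp add: conj_map_def auto_mult auto_inv)

lemma (in group) auto_mult_conj_map:
  assumes "\<alpha> \<in> auto G" "h \<in> carrier G"
  shows "\<alpha> \<otimes>\<^bsub>BijGroup (carrier G)\<^esub> conj_map G h = conj_map G (\<alpha> h) \<otimes>\<^bsub>BijGroup (carrier G)\<^esub> \<alpha>"
proof -
  note B = auto_Bij[OF assms(1)] auto_Bij[OF conj_map_auto[OF assms(2)]]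
    auto_Bij[OF conj_map_auto[OF Bij_closed[OF auto_Bij[OF assms(1)] assms(2)]]]
  show ?thesis
  proof (rule Bij_ext[of _ "carrier G"])
    fix x assume "x \<in> carrier G"
    then show "(\<alpha> \<otimes>\<^bsub>BijGroup (carrier G)\<^esub> conj_map G h) x = (conj_map G (\<alpha> h) \<otimes>\<^bsub>BijGroup (carrier G)\<^esub> \<alpha>) x"
      using B assms by (simp add: mult_BijGroup_apply auto_conj_map)
  qed (use B compose_Bij in \<open>simp_all add: mult_BijGroup\<close>)
qed

text \<open>The factors change places because conjugation acts from the right whereas
  \<open>BijGroup\<close> composes from right to left.\<close>

lemma (in group) conj_map_mult_conj_map:
  assumes "h \<in> carrier G" "k \<in> carrier G"
  shows "conj_map G h \<otimes>\<^bsub>BijGroup (carrier G)\<^esub> conj_map G k = conj_map G (k \<otimes> h)"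
proof -
  note B = auto_Bij[OF conj_map_auto[OF assms(1)]] auto_Bij[OF conj_map_auto[OF assms(2)]]
    auto_Bij[OF conj_map_auto[OF m_closed[OF assms(2,1)]]]
  show ?thesis
    by (rule Bij_ext[of _ "carrier G"])
      (use B compose_Bij assms in \<open>simp_all add: mult_BijGroup_apply conj_map_mult, simp_all add: mult_BijGroup\<close>)
qed

lemma (in group) conj_map_one_eq: "conj_map G \<one> = \<one>\<^bsub>BijGroup (carrier G)\<^esub>"
  by (rule Bij_ext[of _ "carrier G"])
    (simp_all add: auto_Bij conj_map_auto conj_map_one one_BijGroup_apply, simp add: BijGroup_def id_Bij)

lemma (in group) conj_map_pow:
  assumes "h \<in> carrier G"
  shows "conj_map G h [^]\<^bsub>BijGroup (carrier G)\<^esub> (n::nat) = conj_map G (h [^] n)"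
proof (induction n)
  case (Suc n)
  have "conj_map G h [^]\<^bsub>BijGroup (carrier G)\<^esub> Suc n = conj_map G (h [^] n) \<otimes>\<^bsub>BijGroup (carrier G)\<^esub> conj_map G h"
    using Suc by simp
  also have "\<dots> = conj_map G (h \<otimes> h [^] n)"
    using assms by (intro conj_map_mult_conj_map) auto
  finally show ?case
    by (simp only: nat_pow_Suc2[OF assms])
qed (simp add: conj_map_one_eq)

context gf8 begin

abbreviation P :: "('a ^ 2 ^ 2 \<Rightarrow> 'a ^ 2 ^ 2) monoid" where "P \<equiv> Perm_SL2"

end

sublocale gf8 \<subseteq> P: group P
  by (rule group_BijGroup)

section \<open>The automorphisms given by g, f and the Frobenius map\<close>

context gf8 begin

abbreviation conj_g :: "nat \<Rightarrow> 'a ^ 2 ^ 2 \<Rightarrow> 'a ^ 2 ^ 2" where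
  "conj_g n \<equiv> conj_map SL2 (mat_g z \<up> n)"

abbreviation frob_f :: "'a ^ 2 ^ 2 \<Rightarrow> 'a ^ 2 ^ 2" where
  "frob_f \<equiv> frob \<otimes>\<^bsub>P\<^esub> conj_map SL2 mat_f"

lemma g_carrier: "mat_g z \<in> carrier SL2" and f_carrier: "mat_f \<in> carrier (SL2 :: ('a ^ 2 ^ 2) monoid)"
  by simp_all

lemma g_pow_carrier: "mat_g z \<up> n \<in> carrier SL2"
  by simp

lemma ord_g: "SL2.ord (mat_g z) = 9"
  using SL2.generate_pow_card[OF g_carrier] card_group_C by (simp add: group_C_def)

lemma g_pow_eq_iff: "mat_g z \<up> m = mat_g z \<up> n \<longleftrightarrow> m mod 9 = n mod 9"
proof -
  have "mat_g z \<up> m = mat_g z \<up> n \<longleftrightarrow> int 9 dvd int n - int m"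
    using SL2.int_pow_eq[OF g_carrier, of "int m" "int n"] by (simp add: ord_g int_pow_int)
  also have "\<dots> \<longleftrightarrow> int n mod int 9 = int m mod int 9"
    by (rule mod_eq_dvd_iff[symmetric])
  also have "\<dots> \<longleftrightarrow> n mod 9 = m mod 9"
    by (simp only: of_nat_mod[symmetric] of_nat_eq_iff)
  finally show ?thesis
    by (simp only: eq_commute)
qed

lemma group_C_pow: "group_C z = range (\<lambda>n::nat. mat_g z \<up> n)"
  unfolding group_C_def by (subst SL2.generate_pow_on_finite_carrier) auto

text \<open>The centre is trivial, by faithfulness on the root groups; therefore \<gamma>_h has the
  same order as h.\<close>

lemma conj_map_eq_oneD:
  assumes "h \<in> carrier SL2" "conj_map SL2 h = \<one>\<^bsub>P\<^esub>"
  shows "h = \<one>\<^sub>S"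
proof (rule fam.fam_faithful[OF assms(1)])
  fix Q :: "('a ^ 2 ^ 2) set" assume Q: "Q \<in> root_groups"
  have "conj_map SL2 h x = x" if "x \<in> Q" for x
    unfolding assms(2) using subsetD[OF root_groups_subset[OF Q] that] by (rule one_BijGroup_apply)
  then show "conj_map SL2 h ` Q = Q"
    by (simp cong: image_cong)
qed

lemma ord_conj_map:
  assumes "h \<in> carrier SL2"
  shows "P.ord (conj_map SL2 h) = SL2.ord h"
proof -
  have c: "conj_map SL2 h \<in> carrier P"
    using auto_Bij[OF SL2.conj_map_auto[OF assms]] by (simp add: carrier_BijGroup)
  have "conj_map SL2 h [^]\<^bsub>P\<^esub> n = \<one>\<^bsub>P\<^esub> \<longleftrightarrow> SL2.ord h dvd n" for n :: nat
    unfolding SL2.conj_map_pow[OF assms] SL2.pow_eq_id[OF assms, symmetric]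
    using conj_map_eq_oneD[OF SL2.nat_pow_closed[OF assms]] SL2.conj_map_one_eq by metis
  then show ?thesis
    using P.ord_unique[OF c] by blast
qed

lemma frob_mat_mult: "frob_mat (A ** B) = frob_mat A ** frob_mat (B :: 'a ^ 2 ^ 2)"
proof -
  obtain a b c d where A: "A = mat2 a b c d" by (cases A)
  obtain a' b' c' d' where B: "B = mat2 a' b' c' d'" by (cases B)
  have frob: "frob_mat (mat2 p q r s) = mat2 (p\<^sup>2) (q\<^sup>2) (r\<^sup>2) (s\<^sup>2)" for p q r s :: 'a
    by (rule mat2_eqI) (simp_all add: frob_mat_def)
  show ?thesis
    by (simp add: A B frob power2_eq_square algebra_simps)
qed

lemma det_frob_mat: "det (frob_mat A) = (det (A :: 'a ^ 2 ^ 2))\<^sup>2"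
  by (cases A) (simp add: frob_mat_def det_2 power2_eq_square algebra_simps)

lemma frob_mat_cubed: "frob_mat (frob_mat (frob_mat A)) = (A :: 'a ^ 2 ^ 2)"
proof -
  have "((x\<^sup>2)\<^sup>2)\<^sup>2 = x" for x :: 'a
    by (simp flip: power_mult)
  then show ?thesis
    by (intro mat2_eqI) (simp_all add: frob_mat_def)
qed

lemma frob_apply: "x \<in> carrier SL2 \<Longrightarrow> frob x = frob_mat x"
  by (simp add: frob_def)

lemma frob_auto: "(frob :: 'a ^ 2 ^ 2 \<Rightarrow> 'a ^ 2 ^ 2) \<in> auto SL2"
proof -
  have "bij_betw frob_mat (carrier SL2) (carrier (SL2 :: ('a ^ 2 ^ 2) monoid))"
    by (rule bij_betw_byWitness[where f' = "\<lambda>A. frob_mat (frob_mat A)"])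
      (auto simp: frob_mat_cubed det_frob_mat)
  then have "frob \<in> Bij (carrier (SL2 :: ('a ^ 2 ^ 2) monoid))"
    unfolding frob_def by (rule Bij_restrictI)
  moreover have "frob \<in> hom SL2 (SL2 :: ('a ^ 2 ^ 2) monoid)"
    by (rule homI) (simp_all add: frob_def det_frob_mat mult_SL2 frob_mat_mult det_mul)
  ultimately show ?thesis
    by (simp add: auto_def)
qed

lemma frob_f_fixed: "frob mat_f = (mat_f :: 'a ^ 2 ^ 2)"
proof -
  have "frob_mat mat_f = (mat_f :: 'a ^ 2 ^ 2)"
    by (rule mat2_eqI) (simp_all add: frob_mat_def mat_f_def)
  then show ?thesis
    using frob_apply[OF f_carrier] by simp
qed

lemma frob_g: "frob (mat_g z) = mat_g z \<up> 7"
  using frob_apply[OF g_carrier] frob_dec_mat[of mat_g8] by (simp add: frob_mat_g8 dec_mat_g dec_mpow)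

lemma conj_f_g: "conj_map SL2 mat_f (mat_g z) = mat_g z \<up> 8"
proof -
  have "det8 mat_f8 = one8" "det8 mat_g8 = one8"
    by code_simp+
  from conj_dec_mat[OF this] show ?thesis
    by (simp add: conj_f_mat_g8 dec_mat_g dec_mat_f dec_mpow)
qed

lemma ord_conj_f: "P.ord (conj_map SL2 mat_f) = 2"
proof -
  have "mat_f \<up> 2 = \<one>\<^bsub>(SL2 :: ('a ^ 2 ^ 2) monoid)\<^esub>"
    by (simp add: numeral_2_eq_2 SL2.nat_pow_Suc) (simp add: mult_SL2 one_SL2 mat_f_def mat2_one)
  moreover have "mat_f \<noteq> \<one>\<^bsub>(SL2 :: ('a ^ 2 ^ 2) monoid)\<^esub>"
    by (simp add: one_SL2 mat_f_def mat2_one)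
  ultimately show ?thesis
    unfolding ord_conj_map[OF f_carrier] by (intro SL2.ord_eq_prime f_carrier) simp_all
qed

lemma frob_carrier: "frob \<in> carrier P" and conj_f_carrier: "conj_map SL2 mat_f \<in> carrier P"
  and conj_g_carrier: "conj_g n \<in> carrier P"
  using frob_auto SL2.conj_map_auto[OF f_carrier] SL2.conj_map_auto[OF g_pow_carrier]
  by (simp_all add: carrier_BijGroup auto_Bij)

lemma ord_frob: "P.ord frob = 3"
proof (rule P.ord_eq_prime)
  have B: "frob \<in> Bij (carrier (SL2 :: ('a ^ 2 ^ 2) monoid))"
    using frob_carrier by (simp add: carrier_BijGroup)
  have "frob [^]\<^bsub>P\<^esub> (3::nat) = frob \<otimes>\<^bsub>P\<^esub> frob \<otimes>\<^bsub>P\<^esub> frob"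
    using frob_carrier by (simp add: numeral_3_eq_3)
  also have "\<dots> = \<one>\<^bsub>P\<^esub>"
  proof (rule Bij_ext)
    show "frob \<otimes>\<^bsub>P\<^esub> frob \<otimes>\<^bsub>P\<^esub> frob \<in> Bij (carrier (SL2 :: ('a ^ 2 ^ 2) monoid))" "\<one>\<^bsub>P\<^esub> \<in> Bij (carrier (SL2 :: ('a ^ 2 ^ 2) monoid))"
      using frob_carrier by (simp_all flip: carrier_BijGroup)
    fix x :: "'a ^ 2 ^ 2" assume x: "x \<in> carrier SL2"
    have "frob \<otimes>\<^bsub>P\<^esub> frob \<in> Bij (carrier (SL2 :: ('a ^ 2 ^ 2) monoid))"
      using frob_carrier by (simp flip: carrier_BijGroup)
    then have "(frob \<otimes>\<^bsub>P\<^esub> frob \<otimes>\<^bsub>P\<^esub> frob) x = frob (frob (frob x))"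
      using B x Bij_closed[OF B] by (simp only: mult_BijGroup_apply)
    also have "\<dots> = x"
      using x by (simp add: frob_apply det_frob_mat frob_mat_cubed)
    finally show "(frob \<otimes>\<^bsub>P\<^esub> frob \<otimes>\<^bsub>P\<^esub> frob) x = \<one>\<^bsub>P\<^esub> x"
      using x by (simp only: one_BijGroup_apply)
  qed
  finally show "frob [^]\<^bsub>P\<^esub> (3::nat) = \<one>\<^bsub>P\<^esub>" .
  show "frob \<noteq> \<one>\<^bsub>P\<^esub>"
  proof
    assume "frob = \<one>\<^bsub>P\<^esub>"
    then have "mat_g z \<up> 7 = mat_g z \<up> 1"
      using frob_g one_BijGroup_apply[OF g_carrier] g_carrier by simp
    then show False
      unfolding g_pow_eq_iff by simp
  qed
qed (use frob_carrier in simp_all)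

lemma conj_f_frob_commute: "conj_map SL2 mat_f \<otimes>\<^bsub>P\<^esub> frob = frob \<otimes>\<^bsub>P\<^esub> conj_map SL2 mat_f"
  using SL2.auto_mult_conj_map[OF frob_auto f_carrier] by (simp add: frob_f_fixed)

lemma frob_f_carrier: "frob_f \<in> carrier P"
  using frob_carrier conj_f_carrier by simp

lemma group_FL_eq: "group_FL = generate P {frob_f}"
  unfolding group_FL_def using frob_carrier conj_f_carrier
  by (simp add: mult_BijGroup carrier_BijGroup)

lemmas FL_facts = P.commuting_ord_2_3[OF conj_f_carrier ord_conj_f frob_carrier ord_frob conj_f_frob_commute]

lemma frob_f_auto: "frob_f \<in> auto SL2"
  using subgroup.m_closed[OF SL2.subgroup_auto frob_auto SL2.conj_map_auto[OF f_carrier]] .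

lemma frob_f_g: "frob_f (mat_g z) = mat_g z \<up> 2"
proof -
  have "frob_f (mat_g z) = frob (mat_g z \<up> 8)"
    using frob_carrier conj_f_carrier g_carrier conj_f_g by (simp add: mult_BijGroup_apply carrier_BijGroup)
  also have "\<dots> = mat_g z \<up> 56"
    using SL2.auto_pow[OF frob_auto g_carrier, of 8] frob_g g_carrier by (simp add: SL2.nat_pow_pow)
  also have "\<dots> = mat_g z \<up> 2"
    unfolding g_pow_eq_iff by simp
  finally show ?thesis .
qed

lemma auto_pow_closed: "\<alpha> \<in> auto SL2 \<Longrightarrow> \<alpha> [^]\<^bsub>P\<^esub> (k::nat) \<in> auto SL2"
  by (rule P.subgroup_nat_pow_closed[OF SL2.subgroup_auto])

lemma frob_f_pow_g: "(frob_f [^]\<^bsub>P\<^esub> (k::nat)) (mat_g z) = mat_g z \<up> (2 ^ k)"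
proof (induction k)
  case 0
  then show ?case
    using one_BijGroup_apply[OF g_carrier] by simp
next
  case (Suc k)
  have a: "frob_f [^]\<^bsub>P\<^esub> k \<in> auto SL2"
    using frob_f_auto by (rule auto_pow_closed)
  have "(frob_f [^]\<^bsub>P\<^esub> Suc k) (mat_g z) = (frob_f [^]\<^bsub>P\<^esub> k) (frob_f (mat_g z))"
    using mult_BijGroup_apply[OF auto_Bij[OF a] auto_Bij[OF frob_f_auto] g_carrier] by simp
  also have "\<dots> = (mat_g z \<up> (2 ^ k)) \<up> 2"
    unfolding frob_f_g using SL2.auto_pow[OF a g_carrier] Suc by simp
  also have "\<dots> = mat_g z \<up> (2 ^ Suc k)"
    using g_carrier by (simp add: SL2.nat_pow_pow mult.commute)
  finally show ?case .
qed

lemma auto_stab_subset: "auto_stab (group_C z) \<subseteq> auto SL2"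
  by (auto simp: auto_stab_def)

lemma auto_stab_g:
  assumes "\<alpha> \<in> auto_stab (group_C z)"
  obtains m :: nat where "\<alpha> (mat_g z) = mat_g z \<up> m"
proof -
  have "\<alpha> (mat_g z) \<in> group_C z"
    using assms g_mem_C unfolding auto_stab_def by blast
  then show ?thesis
    using that unfolding group_C_pow by blast
qed

text \<open>The image of the generator lies in C, so C is mapped into itself, injectively and, being
  finite, onto itself.\<close>

lemma auto_stabI:
  assumes "\<alpha> \<in> auto SL2" "\<alpha> (mat_g z) = mat_g z \<up> m"
  shows "\<alpha> \<in> auto_stab (group_C z)"
proof -
  have "\<alpha> (mat_g z \<up> n) = mat_g z \<up> (m * n)" for n
    using SL2.auto_pow[OF assms(1) g_carrier] assms(2) g_carrier by (simp add: SL2.nat_pow_pow)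
  then have "\<alpha> ` group_C z \<subseteq> group_C z"
    unfolding group_C_pow by auto
  moreover have "group_C z \<subseteq> carrier SL2"
    by (rule subgroup.subset[OF subgroup_group_C])
  then have "inj_on \<alpha> (group_C z)" "finite (group_C z)"
    using inj_on_subset[OF Bij_inj[OF auto_Bij[OF assms(1)]]] finite_subset[OF _ finite_SL2] by blast+
  ultimately have "\<alpha> ` group_C z = group_C z"
    by (intro endo_inj_surj)
  then show ?thesis
    using assms(1) by (simp add: auto_stab_def)
qed

lemma conj_g_g: "conj_g n (mat_g z) = mat_g z \<up> 1"
proof -
  have "mat_g z \<cdot> mat_g z \<up> n = mat_g z \<up> n \<cdot> mat_g z"
    using SL2.nat_pow_Suc2[OF g_carrier, of n] SL2.nat_pow_Suc[of "mat_g z" n] by simp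
  then have "conj_map SL2 (mat_g z \<up> n) (mat_g z) = mat_g z"
    by (intro conj_map_eqI) (simp_all add: mult_SL2)
  then show ?thesis
    using g_carrier by simp
qed

lemma conj_g_auto: "conj_g n \<in> auto SL2"
  by (rule SL2.conj_map_auto[OF g_pow_carrier])

lemma conj_g_auto_stab: "conj_g n \<in> auto_stab (group_C z)"
  by (rule auto_stabI[OF conj_g_auto conj_g_g])

lemma frob_f_auto_stab: "frob_f \<in> auto_stab (group_C z)"
  by (rule auto_stabI[OF frob_f_auto frob_f_g])

lemma conj_f_auto_stab: "conj_map SL2 mat_f \<in> auto_stab (group_C z)"
  by (rule auto_stabI[OF SL2.conj_map_auto[OF f_carrier] conj_f_g])

lemma frob_auto_stab: "frob \<in> auto_stab (group_C z)"
  by (rule auto_stabI[OF frob_auto frob_g])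

lemma subgroup_auto_stab: "subgroup (auto_stab (group_C z)) P"
proof -
  note C = group_C_subset
  have B: "\<alpha> \<in> Bij (carrier SL2)" if "\<alpha> \<in> auto_stab (group_C z)" for \<alpha>
    using that auto_Bij by (auto simp: auto_stab_def)
  show ?thesis
  proof (rule P.subgroupI)
    show "auto_stab (group_C z) \<subseteq> carrier P"
      using B by (auto simp: carrier_BijGroup)
    show "auto_stab (group_C z) \<noteq> {}"
      using frob_auto_stab by blast
  next
    fix \<alpha> assume \<alpha>: "\<alpha> \<in> auto_stab (group_C z)"
    have "(inv\<^bsub>P\<^esub> \<alpha>) ` group_C z = (inv\<^bsub>P\<^esub> \<alpha>) ` \<alpha> ` group_C z"
      using \<alpha> by (simp add: auto_stab_def)
    also have "\<dots> = group_C z"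
      unfolding image_image using inv_BijGroup_apply(1)[OF B[OF \<alpha>]] C by (simp add: subset_iff cong: image_cong)
    finally show "inv\<^bsub>P\<^esub> \<alpha> \<in> auto_stab (group_C z)"
      using \<alpha> subgroup.m_inv_closed[OF SL2.subgroup_auto, of \<alpha>] by (simp add: auto_stab_def)
  next
    fix \<alpha> \<beta> assume *: "\<alpha> \<in> auto_stab (group_C z)" "\<beta> \<in> auto_stab (group_C z)"
    then show "\<alpha> \<otimes>\<^bsub>P\<^esub> \<beta> \<in> auto_stab (group_C z)"
      using image_mult_BijGroup[OF B B C] subgroup.m_closed[OF SL2.subgroup_auto, of \<alpha> \<beta>] by (simp add: auto_stab_def)
  qed
qed

lemma auto_image_conj:
  assumes "\<alpha> \<in> auto SL2" "x \<in> carrier SL2" "Q \<subseteq> carrier SL2"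
  shows "\<alpha> ` conj_map SL2 x ` Q = conj_map SL2 (\<alpha> x) ` \<alpha> ` Q"
  unfolding image_image using assms by (intro image_cong refl SL2.auto_conj_map) auto

text \<open>If all root groups are fixed, then \<open>x\<close> and \<open>\<alpha> x\<close>
  conjugate each of them to the same group, and conjugation is faithful.\<close>

lemma auto_fixing_root_groups:
  assumes \<alpha>: "\<alpha> \<in> auto SL2" "\<And>Q. Q \<in> root_groups \<Longrightarrow> \<alpha> ` Q = Q"
  shows "\<alpha> = \<one>\<^bsub>P\<^esub>"
proof (rule Bij_ext[of _ "carrier SL2"])
  show "\<alpha> \<in> Bij (carrier SL2)" "\<one>\<^bsub>P\<^esub> \<in> Bij (carrier SL2)"
    using auto_Bij[OF \<alpha>(1)] P.one_closed by (simp_all add: carrier_BijGroup)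
  fix x :: "'a ^ 2 ^ 2" assume x: "x \<in> carrier SL2"
  then have \<alpha>x: "\<alpha> x \<in> carrier SL2"
    by (rule Bij_closed[OF auto_Bij[OF \<alpha>(1)]])
  have "\<alpha> x \<cdot> inv\<^sub>S x = \<one>\<^sub>S"
  proof (rule fam.fam_faithful)
    fix Q :: "('a ^ 2 ^ 2) set" assume Q: "Q \<in> root_groups"
    have "conj_map SL2 (\<alpha> x) ` Q = conj_map SL2 (\<alpha> x) ` \<alpha> ` Q"
      using \<alpha>(2)[OF Q] by simp
    also have "\<dots> = \<alpha> ` conj_map SL2 x ` Q"
      by (rule auto_image_conj[OF \<alpha>(1) x root_groups_subset[OF Q], symmetric])
    also have "\<dots> = conj_map SL2 x ` Q"
      by (rule \<alpha>(2)[OF fam.fam_conj[OF Q x]])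
    finally show "conj_map SL2 (\<alpha> x \<cdot> inv\<^sub>S x) ` Q = Q"
      using fam.cj_inv_iff[OF Q Q \<alpha>x x] by simp
  qed (use x \<alpha>x in \<open>intro SL2.m_closed SL2.inv_closed\<close>)
  then have "\<alpha> x = x"
    using x \<alpha>x by (metis SL2.inv_closed SL2.inv_equality SL2.inv_inv)
  then show "\<alpha> x = \<one>\<^bsub>P\<^esub> x"
    using x by (simp only: one_BijGroup_apply)
qed

text \<open>C is transitive on the projective line by \<open>group_C8_transitive\<close>, where the
  vanishing expression is the second coordinate of the conjugated vector. That statement runs over
  codes, so the coordinates are first replaced by codes.\<close>

lemma root_groups_conj_g:
  assumes "Q \<in> root_groups"
  obtains i where "conj_g i ` Q = root_group 1 0"
proof -
  obtain p q where Q: "Q = root_group p q" "p \<noteq> 0 \<or> q \<noteq> 0"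
    using assms by (rule root_groupsE)
  have codes: "\<exists>u\<in>set (zero8 # map pow8 [0..<7]). dec u = x" for x
  proof -
    have "x \<in> {0, 1, z, z ^ 2, z ^ 3, z ^ 4, z ^ 5, z ^ 6}"
      using UNIV_eq by blast
    then have "x \<in> {0} \<union> (\<lambda>n. z ^ n) ` {0, 1, 2, 3, 4, 5, 6}"
      by auto
    moreover have "{0, 1, 2, 3, 4, 5, 6} = {0..<7::nat}"
      by auto
    ultimately have "x = 0 \<or> (\<exists>n\<in>{0..<7::nat}. x = z ^ n)"
      by (simp only:) blast
    then show ?thesis
    proof
      assume "\<exists>n\<in>{0..<7::nat}. x = z ^ n"
      then obtain n where "n \<in> {0..<7::nat}" "x = z ^ n"
        by blast
      then have "pow8 n \<in> set (zero8 # map pow8 [0..<7])" "dec (pow8 n) = x"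
        by (simp_all del: pow8.simps)
      then show ?thesis
        by blast
    qed (auto intro: bexI[of _ zero8])
  qed
  obtain u where u: "u \<in> set (zero8 # map pow8 [0..<7])" "dec u = p"
    using codes by blast
  obtain v where v: "v \<in> set (zero8 # map pow8 [0..<7])" "dec v = q"
    using codes by blast
  obtain x where x: "x \<in> set group_C8" "case x of (a, b, c, d) \<Rightarrow> add8 (mult8 c u) (mult8 a v) = zero8"
    using group_C8_transitive u(1) v(1) by blast
  obtain a b c d where abcd: "x = (a, b, c, d)"
    by (rule prod_cases4)
  have 0: "dec c * p + dec a * q = 0"
    using x(2) unfolding abcd u(2)[symmetric] v(2)[symmetric] by (simp flip: dec_mult dec_add dec_zero)
  have det: "dec a * dec d + dec b * dec c = 1"
    using det_group_C8[OF x(1)] det_dec_mat_eq_1_iff[of x] by (simp add: abcd dec_mat_def)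
  have "dec_mat x \<in> group_C z"
    unfolding group_C_eq using x(1) by (rule imageI)
  then obtain i :: nat where i: "dec_mat x = mat_g z \<up> i"
    unfolding group_C_pow by blast
  have *: "conj_map SL2 (dec_mat x) ` Q = root_group (dec d * p + dec b * q) 0"
    using conj_root_group[OF det, of p q] by (simp add: Q(1) abcd dec_mat_def 0)
  \<comment> \<open>The vector is recovered from its image. As the second coordinate of the image is
    0, the first cannot vanish and may be scaled to 1.\<close>
  have "p = dec a * (dec d * p + dec b * q) + dec b * (dec c * p + dec a * q)"
    "q = dec c * (dec d * p + dec b * q) + dec d * (dec c * p + dec a * q)"
  proof -
    have "dec a * (dec d * p + dec b * q) + dec b * (dec c * p + dec a * q) = (dec a * dec d + dec b * dec c) * p"
      "dec c * (dec d * p + dec b * q) + dec d * (dec c * p + dec a * q) = (dec a * dec d + dec b * dec c) * q"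
      by (simp_all add: algebra_simps)
    then show "p = dec a * (dec d * p + dec b * q) + dec b * (dec c * p + dec a * q)"
      "q = dec c * (dec d * p + dec b * q) + dec d * (dec c * p + dec a * q)"
      using det by simp_all
  qed
  then have "dec d * p + dec b * q \<noteq> 0"
    using Q(2) unfolding 0 by auto
  then have "root_group (dec d * p + dec b * q) 0 = root_group 1 0"
    using root_group_scale[of "dec d * p + dec b * q" 1 0] by simp
  then show ?thesis
    using that[of i] * i by simp
qed

end

lemma (in group) auto_quotients:
  assumes "\<alpha> \<in> auto G" "x \<in> carrier G" "y \<in> carrier G"
  shows "\<alpha> (x \<otimes> inv y) = \<alpha> x \<otimes> inv (\<alpha> y)"
  using assms by (simp add: auto_mult auto_inv)

context gf8 begin

text \<open>A conjugation by a power of g corrects \<alpha> so that it also fixes one root group.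
  The corrected map commutes with conjugation by C, which is transitive, so it fixes all root groups
  and is the identity.\<close>

lemma auto_fixing_g:
  assumes \<alpha>: "\<alpha> \<in> auto SL2" "\<alpha> (mat_g z) = mat_g z"
  obtains i where "\<alpha> = conj_g i"
proof -
  let ?T = "root_group 1 0"
  have T: "?T \<in> root_groups"
    by (rule root_groupsI) simp
  have sub: "\<beta> ` Q \<subseteq> carrier SL2" if "Q \<in> root_groups" "\<beta> \<in> auto SL2" for \<beta> and Q :: "('a ^ 2 ^ 2) set"
    using Bij_closed[OF auto_Bij[OF that(2)]] subsetD[OF root_groups_subset[OF that(1)]]
    by (intro image_subsetI) simp
  have \<alpha>T: "\<alpha> ` ?T \<in> root_groups"
    by (rule auto_root_group[OF \<alpha>(1) T])
  obtain i where i: "conj_g i ` \<alpha> ` ?T = ?T"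
    using \<alpha>T by (rule root_groups_conj_g)
  define \<delta> where "\<delta> = conj_g i \<otimes>\<^bsub>P\<^esub> \<alpha>"
  have \<delta>: "\<delta> \<in> auto SL2"
    unfolding \<delta>_def by (rule subgroup.m_closed[OF SL2.subgroup_auto conj_g_auto \<alpha>(1)])
  have \<delta>T: "\<delta> ` ?T = ?T"
    unfolding \<delta>_def image_mult_BijGroup[OF auto_Bij[OF conj_g_auto] auto_Bij[OF \<alpha>(1)] root_groups_subset[OF T]]
    by (rule i)
  have "\<delta> (mat_g z) = mat_g z"
    unfolding \<delta>_def mult_BijGroup_apply[OF auto_Bij[OF conj_g_auto] auto_Bij[OF \<alpha>(1)] g_carrier] \<alpha>(2) conj_g_g
    using g_carrier by simp
  then have \<delta>_pow: "\<delta> (mat_g z \<up> n) = mat_g z \<up> n" for n :: nat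
    using SL2.auto_pow[OF \<delta> g_carrier] by simp
  have "\<delta> = \<one>\<^bsub>P\<^esub>"
  proof (rule auto_fixing_root_groups[OF \<delta>])
    fix Q :: "('a ^ 2 ^ 2) set" assume Q: "Q \<in> root_groups"
    obtain j where j: "conj_g j ` Q = ?T"
      using Q by (rule root_groups_conj_g)
    have "conj_g j ` \<delta> ` Q = \<delta> ` conj_g j ` Q"
      using auto_image_conj[OF \<delta> g_pow_carrier root_groups_subset[OF Q]] \<delta>_pow by simp
    also have "\<dots> = conj_g j ` Q"
      unfolding j by (rule \<delta>T)
    finally show "\<delta> ` Q = Q"
      using inj_on_image_eq_iff[OF Bij_inj[OF auto_Bij[OF conj_g_auto]] sub[OF Q \<delta>] root_groups_subset[OF Q]] by simp
  qed
  \<comment> \<open>The exponent 8 * i is the negative of i modulo 9, which keeps exponents natural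
    numbers.\<close>
  then have "conj_g (8 * i) \<otimes>\<^bsub>P\<^esub> (conj_g i \<otimes>\<^bsub>P\<^esub> \<alpha>) = conj_g (8 * i)"
    using P.r_one[OF conj_g_carrier] by (simp add: \<delta>_def)
  moreover have "conj_g (8 * i) \<otimes>\<^bsub>P\<^esub> conj_g i = \<one>\<^bsub>P\<^esub>"
  proof -
    have "mat_g z \<up> i \<cdot> mat_g z \<up> (8 * i) = mat_g z \<up> (9 * i)"
      using SL2.nat_pow_mult[OF g_carrier] by simp
    also have "\<dots> = mat_g z \<up> 0"
      unfolding g_pow_eq_iff by simp
    finally show ?thesis
      using SL2.conj_map_mult_conj_map[OF g_pow_carrier g_pow_carrier] SL2.conj_map_one_eq by simp
  qed
  moreover have "\<alpha> \<in> carrier P"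
    using auto_Bij[OF \<alpha>(1)] by (simp add: carrier_BijGroup)
  ultimately have "\<alpha> = conj_g (8 * i)"
    using P.m_assoc[OF conj_g_carrier conj_g_carrier, of \<alpha> "8 * i" i] P.l_one[of \<alpha>] by simp
  then show ?thesis
    by (rule that)
qed

section \<open>Powers of 2 modulo 9\<close>

lemma two_power_mod_9:
  "(2::nat) ^ k mod 9 = 2 ^ (k mod 6) mod 9"
proof -
  have "(2::nat) ^ k = (2 ^ 6) ^ (k div 6) * 2 ^ (k mod 6)"
    by (simp only: power_mult[symmetric] power_add[symmetric] mult_div_mod_eq)
  also have "\<dots> mod 9 = ((2 ^ 6) ^ (k div 6) mod 9) * 2 ^ (k mod 6) mod 9"
    by (simp only: mod_mult_left_eq)
  also have "((2::nat) ^ 6) ^ (k div 6) mod 9 = (2 ^ 6 mod 9) ^ (k div 6) mod 9"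
    by (simp only: power_mod)
  finally show ?thesis
    by simp
qed

lemma two_power_mod_9_eq_1:
  assumes "(2::nat) ^ k mod 9 = 1"
  shows "6 dvd k"
proof -
  have "k mod 6 < 6"
    by simp
  then consider "k mod 6 = 0" | "k mod 6 = 1" | "k mod 6 = 2" | "k mod 6 = 3" | "k mod 6 = 4" | "k mod 6 = 5"
    by linarith
  then show ?thesis
    using assms unfolding two_power_mod_9[of k] by cases auto
qed

text \<open>2 is a primitive root modulo 9: its powers are 1, 2, 4, 8, 7, 5.\<close>

lemma unit_mod_9:
  assumes "\<not> 3 dvd (m::nat)"
  obtains k :: nat where "2 ^ k mod 9 = m mod 9"
proof -
  have "m mod 9 = 1 \<or> m mod 9 = 2 \<or> m mod 9 = 4 \<or> m mod 9 = 5 \<or> m mod 9 = 7 \<or> m mod 9 = 8"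
    using assms by presburger
  then consider "m mod 9 = 1" | "m mod 9 = 2" | "m mod 9 = 4" | "m mod 9 = 5" | "m mod 9 = 7" | "m mod 9 = 8"
    by blast
  then show ?thesis
  proof cases
    case 1 then show ?thesis using that[of 0] by simp
  next
    case 2 then show ?thesis using that[of 1] by simp
  next
    case 3 then show ?thesis using that[of 2] by simp
  next
    case 4 then show ?thesis using that[of 5] by simp
  next
    case 5 then show ?thesis using that[of 4] by simp
  next
    case 6 then show ?thesis using that[of 3] by simp
  qed
qed

text \<open>On C the automorphism is a power map with exponent prime to 3. \<open>frob_f\<close>
  squares g, so a power of it agrees with \<alpha> at g. The remaining factor fixes g, hence is some
  \<gamma>_(g^i), and moving it to the left of that power replaces i by m * i.\<close>

lemma auto_stab_cases:
  assumes \<alpha>: "\<alpha> \<in> auto_stab (group_C z)"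
  obtains i k where "\<alpha> = conj_g i \<otimes>\<^bsub>P\<^esub> frob_f [^]\<^bsub>P\<^esub> (k::nat)"
proof -
  have auto: "\<alpha> \<in> auto SL2"
    using \<alpha> auto_stab_subset by blast
  obtain m where m: "\<alpha> (mat_g z) = mat_g z \<up> m"
    using \<alpha> by (rule auto_stab_g)
  have "\<not> 3 dvd m"
  proof
    assume "3 dvd m"
    have "\<alpha> (mat_g z \<up> 3) = mat_g z \<up> (m * 3)"
      using SL2.auto_pow[OF auto g_carrier] m g_carrier by (simp add: SL2.nat_pow_pow)
    also have "\<dots> = mat_g z \<up> 0"
      unfolding g_pow_eq_iff using \<open>3 dvd m\<close> by presburger
    also have "\<dots> = \<alpha> (mat_g z \<up> 0)"
      using SL2.auto_one[OF auto] by simp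
    finally have "mat_g z \<up> 3 = mat_g z \<up> 0"
      using inj_onD[OF Bij_inj[OF auto_Bij[OF auto]]] g_pow_carrier by blast
    then show False
      unfolding g_pow_eq_iff by simp
  qed
  then obtain k :: nat where k: "2 ^ k mod 9 = m mod 9"
    by (rule unit_mod_9)
  define a where "a = frob_f [^]\<^bsub>P\<^esub> k"
  have a: "a \<in> auto SL2" "a \<in> carrier P"
    using auto_pow_closed[OF frob_f_auto] P.nat_pow_closed[OF frob_f_carrier] by (simp_all add: a_def)
  have ag: "a (mat_g z) = \<alpha> (mat_g z)"
    unfolding a_def frob_f_pow_g m g_pow_eq_iff by (rule k)
  have ia: "inv\<^bsub>P\<^esub> a \<in> auto SL2"
    by (rule subgroup.m_inv_closed[OF SL2.subgroup_auto a(1)])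
  have \<beta>: "inv\<^bsub>P\<^esub> a \<otimes>\<^bsub>P\<^esub> \<alpha> \<in> auto SL2"
    by (rule subgroup.m_closed[OF SL2.subgroup_auto ia auto])
  have "(inv\<^bsub>P\<^esub> a \<otimes>\<^bsub>P\<^esub> \<alpha>) (mat_g z) = (inv\<^bsub>P\<^esub> a) (a (mat_g z))"
    unfolding ag by (rule mult_BijGroup_apply[OF auto_Bij[OF ia] auto_Bij[OF auto] g_carrier])
  also have "\<dots> = mat_g z"
    by (rule inv_BijGroup_apply(1)[OF auto_Bij[OF a(1)] g_carrier])
  finally obtain i where i: "inv\<^bsub>P\<^esub> a \<otimes>\<^bsub>P\<^esub> \<alpha> = conj_g i"
    using auto_fixing_g[OF \<beta>] by blast
  have \<alpha>c: "\<alpha> \<in> carrier P"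
    using auto_Bij[OF auto] by (simp add: carrier_BijGroup)
  have "\<alpha> = a \<otimes>\<^bsub>P\<^esub> (inv\<^bsub>P\<^esub> a \<otimes>\<^bsub>P\<^esub> \<alpha>)"
    using P.m_assoc[OF a(2) P.inv_closed[OF a(2)] \<alpha>c] P.r_inv[OF a(2)] P.l_one[OF \<alpha>c] by simp
  also have "\<dots> = conj_map SL2 (a (mat_g z \<up> i)) \<otimes>\<^bsub>P\<^esub> a"
    unfolding i by (rule SL2.auto_mult_conj_map[OF a(1) g_pow_carrier])
  also have "a (mat_g z \<up> i) = mat_g z \<up> (m * i)"
    using SL2.auto_pow[OF a(1) g_carrier] ag m g_carrier by (simp add: SL2.nat_pow_pow)
  finally show ?thesis
    using that[of "m * i" k] by (simp add: a_def)
qed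

lemma conj_g_pow: "conj_g m [^]\<^bsub>P\<^esub> (n::nat) = conj_g (m * n)"
  using SL2.conj_map_pow[OF g_pow_carrier] SL2.nat_pow_pow[OF g_carrier] by simp

lemma ord_conj_g:
  assumes "d dvd 9" "d \<noteq> 0"
  shows "P.ord (conj_g d) = 9 div d"
  using ord_conj_map[OF g_pow_carrier, of d] SL2.ord_pow[OF g_carrier, of d] assms ord_g by simp

text \<open>Used with d = 3 for the stabilizer in the new unital and with d = 1 for the full group
  of automorphisms preserving C.\<close>

lemma semidirect_conj_g_FL:
  assumes X: "subgroup X P" "X \<subseteq> auto_stab (group_C z)"
    and d: "d dvd 9" "d \<noteq> 0" "conj_g d \<in> X" "\<And>i. conj_g i \<in> X \<Longrightarrow> d dvd i"
    and FL: "frob_f \<in> X"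
  shows "internal_semidirect P X (generate P {conj_g d}) group_FL"
proof -
  have ord: "P.ord (conj_g d) \<noteq> 0"
    using ord_conj_g[OF d(1,2)] dvd_imp_le[OF d(1)] d(2) by (simp add: div_eq_0_iff)
  have N: "generate P {conj_g d} = range (\<lambda>n. conj_g (d * n))"
    unfolding P.generate_pow_nat[OF conj_g_carrier ord] conj_g_pow by auto
  have ordF: "P.ord frob_f = 6"
    by (rule FL_facts(3))
  then have H: "group_FL = range (\<lambda>k::nat. frob_f [^]\<^bsub>P\<^esub> k)"
    unfolding group_FL_eq using P.generate_pow_nat[OF frob_f_carrier] by auto
  have mem: "x [^]\<^bsub>P\<^esub> (n::nat) \<in> X" if "x \<in> X" for x n
    using that by (rule P.subgroup_nat_pow_closed[OF X(1)])
  show ?thesis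
  proof (rule P.internal_semidirectI[OF X(1)])
    show "subgroup (generate P {conj_g d}) P" "subgroup group_FL P"
      unfolding group_FL_eq using conj_g_carrier frob_f_carrier by (auto intro!: P.generate_is_subgroup)
    show "generate P {conj_g d} \<subseteq> X"
      unfolding N using mem[OF d(3)] conj_g_pow by auto
    show "group_FL \<subseteq> X"
      unfolding H using mem[OF FL] by auto
  next
    fix x n assume x: "x \<in> X" and n: "n \<in> generate P {conj_g d}"
    obtain j where j: "n = conj_g (d * j)"
      using n unfolding N by blast
    have xs: "x \<in> auto_stab (group_C z)"
      using x X(2) by blast
    then have xa: "x \<in> auto SL2"
      using auto_stab_subset by blast
    have xc: "x \<in> carrier P"
      using auto_Bij[OF xa] by (simp add: carrier_BijGroup)
    obtain m :: nat where m: "x (mat_g z) = mat_g z \<up> m"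
      using xs by (rule auto_stab_g)
    have "x (mat_g z \<up> (d * j)) = mat_g z \<up> (m * (d * j))"
      using SL2.auto_pow[OF xa g_carrier] m g_carrier by (simp add: SL2.nat_pow_pow)
    then have "x \<otimes>\<^bsub>P\<^esub> n = conj_g (m * (d * j)) \<otimes>\<^bsub>P\<^esub> x"
      unfolding j using SL2.auto_mult_conj_map[OF xa g_pow_carrier, of "d * j"] by simp
    then have "x \<otimes>\<^bsub>P\<^esub> n \<otimes>\<^bsub>P\<^esub> inv\<^bsub>P\<^esub> x = conj_g (d * (m * j))"
      using P.m_assoc[OF conj_g_carrier xc P.inv_closed[OF xc]] P.r_inv[OF xc] P.r_one[OF conj_g_carrier]
      by (simp add: mult.left_commute)
    then show "x \<otimes>\<^bsub>P\<^esub> n \<otimes>\<^bsub>P\<^esub> inv\<^bsub>P\<^esub> x \<in> generate P {conj_g d}"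
      unfolding N by auto
  next
    fix x assume x: "x \<in> generate P {conj_g d}" "x \<in> group_FL"
    obtain j where j: "x = conj_g (d * j)"
      using x(1) unfolding N by blast
    obtain k :: nat where k: "x = frob_f [^]\<^bsub>P\<^esub> k"
      using x(2) unfolding H by blast
    \<comment> \<open>A common element fixes g, being conjugation by a power of g, but as a power of
      \<open>frob_f\<close> it raises g to the power 2 ^ k.\<close>
    have "mat_g z \<up> (2 ^ k) = mat_g z \<up> 1"
      unfolding frob_f_pow_g[symmetric] k[symmetric] j by (rule conj_g_g)
    then have "6 dvd k"
      unfolding g_pow_eq_iff by (intro two_power_mod_9_eq_1) simp
    then show "x = \<one>\<^bsub>P\<^esub>"
      unfolding k P.pow_eq_id[OF frob_f_carrier] ordF .
  next
    fix x assume x: "x \<in> X"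
    then have "x \<in> auto_stab (group_C z)"
      using X(2) by blast
    then obtain i k where ik: "x = conj_g i \<otimes>\<^bsub>P\<^esub> frob_f [^]\<^bsub>P\<^esub> (k::nat)"
      by (rule auto_stab_cases)
    let ?a = "frob_f [^]\<^bsub>P\<^esub> k"
    have a: "?a \<in> carrier P" "?a \<in> X"
      using frob_f_carrier mem[OF FL] by simp_all
    \<comment> \<open>Since \<open>X\<close> contains \<open>frob_f\<close>, the conjugation factor
      of each element lies in \<open>X\<close> too, so its exponent is a multiple of
      \<open>d\<close>.\<close>
    have "x \<otimes>\<^bsub>P\<^esub> inv\<^bsub>P\<^esub> ?a = conj_g i"
      unfolding ik using P.m_assoc[OF conj_g_carrier a(1) P.inv_closed[OF a(1)]] P.r_inv[OF a(1)] P.r_one[OF conj_g_carrier]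
      by simp
    moreover have "x \<otimes>\<^bsub>P\<^esub> inv\<^bsub>P\<^esub> ?a \<in> X"
      using subgroup.m_closed[OF X(1) x subgroup.m_inv_closed[OF X(1) a(2)]] .
    ultimately have "d dvd i"
      using d(4) by simp
    then have "conj_g i \<in> generate P {conj_g d}"
      unfolding N by (auto elim: dvdE)
    moreover have "?a \<in> group_FL"
      unfolding H by blast
    ultimately show "\<exists>n\<in>generate P {conj_g d}. \<exists>h\<in>group_FL. x = n \<otimes>\<^bsub>P\<^esub> h"
      using ik by blast
  qed
qed

section \<open>Right translations\<close>

lemma right_mult_Bij: "h \<in> carrier SL2 \<Longrightarrow> right_mult_map SL2 h \<in> Bij (carrier (SL2 :: ('a ^ 2 ^ 2) monoid))"
proof -
  assume h: "h \<in> carrier (SL2 :: ('a ^ 2 ^ 2) monoid)"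
  have ih: "inv\<^sub>S h \<in> carrier SL2"
    by (rule SL2.inv_closed[OF h])
  have "bij_betw (\<lambda>x. x \<cdot> h) (carrier SL2) (carrier SL2)"
    using h ih by (intro bij_betw_byWitness[where f' = "\<lambda>x. x \<cdot> inv\<^sub>S h"])
      (auto simp: SL2.m_assoc simp del: carrier_SL2)
  then show ?thesis
    unfolding right_mult_map_def by (rule Bij_restrictI)
qed

lemma right_mult_apply: "x \<in> carrier SL2 \<Longrightarrow> right_mult_map SL2 h x = x \<cdot> h"
  by (simp add: right_mult_map_def)

lemma right_mult_mult:
  assumes "h \<in> carrier SL2" "k \<in> carrier SL2"
  shows "right_mult_map SL2 h \<otimes>\<^bsub>P\<^esub> right_mult_map SL2 k = right_mult_map SL2 (k \<cdot> h)"
proof (rule Bij_ext)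
  show "right_mult_map SL2 (k \<cdot> h) \<in> Bij (carrier SL2)"
    using assms by (intro right_mult_Bij SL2.m_closed)
  show "right_mult_map SL2 h \<otimes>\<^bsub>P\<^esub> right_mult_map SL2 k \<in> Bij (carrier SL2)"
    using P.m_closed[of "right_mult_map SL2 h" "right_mult_map SL2 k"] right_mult_Bij[OF assms(1)] right_mult_Bij[OF assms(2)]
    by (simp add: carrier_BijGroup)
  fix x :: "'a ^ 2 ^ 2" assume "x \<in> carrier SL2"
  then show "(right_mult_map SL2 h \<otimes>\<^bsub>P\<^esub> right_mult_map SL2 k) x = right_mult_map SL2 (k \<cdot> h) x"
    using assms mult_BijGroup_apply[OF right_mult_Bij[OF assms(1)] right_mult_Bij[OF assms(2)]]
      SL2.m_closed[of x k]
    by (simp add: right_mult_apply SL2.m_assoc del: carrier_SL2)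
qed

lemma right_mult_one: "right_mult_map SL2 \<one>\<^sub>S = \<one>\<^bsub>P\<^esub>"
proof (rule Bij_ext)
  show "right_mult_map SL2 \<one>\<^sub>S \<in> Bij (carrier (SL2 :: ('a ^ 2 ^ 2) monoid))"
    "\<one>\<^bsub>P\<^esub> \<in> Bij (carrier (SL2 :: ('a ^ 2 ^ 2) monoid))"
    using right_mult_Bij[OF SL2.one_closed] P.one_closed by (simp_all add: carrier_BijGroup)
qed (simp add: right_mult_apply one_BijGroup_apply del: carrier_SL2)

lemma subgroup_group_R: "subgroup group_R P"
proof (rule P.subgroupI)
  show "group_R \<subseteq> carrier P"
    using right_mult_Bij by (auto simp: group_R_def carrier_BijGroup)
  show "group_R \<noteq> {}"
    using SL2.one_closed unfolding group_R_def by blast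
next
  fix \<rho> :: "'a ^ 2 ^ 2 \<Rightarrow> 'a ^ 2 ^ 2" assume "\<rho> \<in> group_R"
  then obtain h where h: "h \<in> carrier SL2" "\<rho> = right_mult_map SL2 h"
    unfolding group_R_def by blast
  have ih: "inv\<^sub>S h \<in> carrier SL2"
    by (rule SL2.inv_closed[OF h(1)])
  have "inv\<^bsub>P\<^esub> \<rho> = right_mult_map SL2 (inv\<^sub>S h)"
    using right_mult_mult[OF ih h(1)] SL2.r_inv[OF h(1)] right_mult_one h(2) right_mult_Bij[OF h(1)] right_mult_Bij[OF ih]
    by (intro P.inv_equality) (simp_all add: carrier_BijGroup)
  then show "inv\<^bsub>P\<^esub> \<rho> \<in> group_R"
    using ih unfolding group_R_def by blast
next
  fix \<rho> \<sigma> :: "'a ^ 2 ^ 2 \<Rightarrow> 'a ^ 2 ^ 2" assume "\<rho> \<in> group_R" "\<sigma> \<in> group_R"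
  then obtain h k where hk: "h \<in> carrier SL2" "\<rho> = right_mult_map SL2 h" "k \<in> carrier SL2" "\<sigma> = right_mult_map SL2 k"
    unfolding group_R_def by blast
  have "\<rho> \<otimes>\<^bsub>P\<^esub> \<sigma> = right_mult_map SL2 (k \<cdot> h)"
    unfolding hk(2,4) by (rule right_mult_mult[OF hk(1,3)])
  then show "\<rho> \<otimes>\<^bsub>P\<^esub> \<sigma> \<in> group_R"
    using SL2.m_closed[OF hk(3,1)] unfolding group_R_def by blast
qed

end

context affine_unital begin

lemma right_mult_aut:
  assumes "h \<in> carrier SL2"
  shows "right_mult_map SL2 h \<in> aut_unital"
proof (rule aut_incidenceI)
  fix B assume B: "B \<in> blocks"
  then have "B \<subseteq> carrier SL2"
    using blocks_subset by blast
  then have "right_mult_map SL2 h ` B = (\<lambda>x. x \<cdot> h) ` B"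
    by (intro image_cong refl right_mult_apply) blast
  also have "\<dots> = B #>\<^sub>S h"
    by (auto simp: r_coset_def)
  finally show "right_mult_map SL2 h ` B \<in> blocks"
    using block_r_coset[OF B assms] by simp
qed (use right_mult_Bij[OF assms] blocks_subset in \<open>simp_all add: points_unital\<close>)

lemma subgroup_aut_unital: "subgroup aut_unital P"
  using subgroup_aut_incidence[of "unital (group_C z) T \<D>"] blocks_subset by (simp add: points_unital)

lemma Aut_stabilizer_eq:
  "stab_one = {\<alpha> \<in> aut_unital. \<alpha> \<one>\<^sub>S = \<one>\<^sub>S}"
  by (simp add: Aut_stabilizer_def stabilizer_def)

lemma Aut_stabilizer_subset: "stab_one \<subseteq> auto_stab (group_C z)"
  using aut_auto_stab unfolding Aut_stabilizer_eq by blast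

lemma Aut_stabilizerI:
  assumes "\<alpha> \<in> aut_unital" "\<alpha> \<in> auto_stab (group_C z)"
  shows "\<alpha> \<in> stab_one"
  using assms SL2.auto_one[of \<alpha>] auto_stab_subset unfolding Aut_stabilizer_eq by auto

lemma Aut_stabilizer_eq_Int:
  "stab_one = aut_unital \<inter> auto_stab (group_C z)"
  using Aut_stabilizerI Aut_stabilizer_subset unfolding Aut_stabilizer_eq by blast

lemma subgroup_Aut_stabilizer: "subgroup stab_one P"
  unfolding Aut_stabilizer_eq_Int by (rule P.subgroups_Inter_pair[OF subgroup_aut_unital subgroup_auto_stab])

text \<open>Right translations are automorphisms and act regularly on the points, so one of them
  carries the image of 1 back to 1.\<close>

lemma aut_unital_decomp:
  assumes \<alpha>: "\<alpha> \<in> aut_unital"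
  obtains \<beta> where "\<beta> \<in> stab_one" "\<alpha> \<one>\<^sub>S \<in> carrier SL2"
    "\<alpha> = right_mult_map SL2 (\<alpha> \<one>\<^sub>S) \<otimes>\<^bsub>P\<^esub> \<beta>"
proof -
  define k where "k = \<alpha> \<one>\<^sub>S"
  have \<alpha>c: "\<alpha> \<in> carrier P"
    using subgroup.mem_carrier[OF subgroup_aut_unital \<alpha>] .
  then have \<alpha>B: "\<alpha> \<in> Bij (carrier SL2)"
    by (simp add: carrier_BijGroup)
  have k: "k \<in> carrier SL2"
    unfolding k_def by (rule Bij_closed[OF \<alpha>B SL2.one_closed])
  let ?\<rho> = "right_mult_map SL2 k"
  have \<rho>: "?\<rho> \<in> aut_unital" "?\<rho> \<in> Bij (carrier SL2)" "?\<rho> \<in> carrier P"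
    using right_mult_aut[OF k] right_mult_Bij[OF k] by (simp_all add: carrier_BijGroup)
  define \<beta> where "\<beta> = inv\<^bsub>P\<^esub> ?\<rho> \<otimes>\<^bsub>P\<^esub> \<alpha>"
  have "\<beta> \<in> aut_unital"
    unfolding \<beta>_def by (intro subgroup.m_closed[OF subgroup_aut_unital] subgroup.m_inv_closed[OF subgroup_aut_unital] \<rho>(1) \<alpha>)
  moreover have "\<beta> \<one>\<^sub>S = \<one>\<^sub>S"
  proof -
    have "?\<rho> \<one>\<^sub>S = k"
      unfolding right_mult_apply[OF SL2.one_closed] by (rule SL2.l_one[OF k])
    then have "\<beta> \<one>\<^sub>S = (inv\<^bsub>P\<^esub> ?\<rho>) (?\<rho> \<one>\<^sub>S)"
      unfolding \<beta>_def mult_BijGroup_apply[OF inv_BijGroup_closed[OF \<rho>(2)] \<alpha>B SL2.one_closed] by (simp add: k_def)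
    also have "\<dots> = \<one>\<^sub>S"
      by (rule inv_BijGroup_apply(1)[OF \<rho>(2) SL2.one_closed])
    finally show ?thesis .
  qed
  ultimately have "\<beta> \<in> stab_one"
    unfolding Aut_stabilizer_eq by blast
  moreover have "\<alpha> = ?\<rho> \<otimes>\<^bsub>P\<^esub> \<beta>"
    unfolding \<beta>_def using P.m_assoc[OF \<rho>(3) P.inv_closed[OF \<rho>(3)] \<alpha>c] P.r_inv[OF \<rho>(3)] P.l_one[OF \<alpha>c] by simp
  ultimately show ?thesis
    using that k unfolding k_def by blast
qed

text \<open>Here the rigidity result enters: the stabilizer of 1 consists of group automorphisms
  \<beta>, and these conjugate the translation by h into the translation by \<beta> h. This gives
  normality of \<open>group_R\<close>.\<close>

lemma aut_unital_semidirect: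
  "internal_semidirect P aut_unital group_R stab_one"
proof (rule P.internal_semidirectI[OF subgroup_aut_unital subgroup_group_R _ subgroup_Aut_stabilizer])
  show "group_R \<subseteq> aut_unital"
    using right_mult_aut by (auto simp: group_R_def)
  show "stab_one \<subseteq> aut_unital"
    unfolding Aut_stabilizer_eq by blast
next
  fix \<alpha> \<rho> :: "'a ^ 2 ^ 2 \<Rightarrow> 'a ^ 2 ^ 2" assume \<alpha>: "\<alpha> \<in> aut_unital" and "\<rho> \<in> group_R"
  then obtain h where h: "h \<in> carrier SL2" "\<rho> = right_mult_map SL2 h"
    unfolding group_R_def by blast
  obtain \<beta> where \<beta>: "\<beta> \<in> stab_one" and k: "\<alpha> \<one>\<^sub>S \<in> carrier SL2"
    and \<alpha>_eq: "\<alpha> = right_mult_map SL2 (\<alpha> \<one>\<^sub>S) \<otimes>\<^bsub>P\<^esub> \<beta>"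
    using \<alpha> by (rule aut_unital_decomp)
  let ?k = "right_mult_map SL2 (\<alpha> \<one>\<^sub>S)"
  have \<beta>a: "\<beta> \<in> auto SL2"
    using \<beta> Aut_stabilizer_subset auto_stab_subset by blast
  have \<beta>B: "\<beta> \<in> Bij (carrier SL2)"
    by (rule auto_Bij[OF \<beta>a])
  have \<beta>h: "\<beta> h \<in> carrier SL2"
    by (rule Bij_closed[OF \<beta>B h(1)])
  have c: "?k \<in> carrier P" "\<beta> \<in> carrier P" "\<rho> \<in> carrier P" "right_mult_map SL2 (\<beta> h) \<in> carrier P"
    using right_mult_Bij[OF k] right_mult_Bij[OF h(1)] right_mult_Bij[OF \<beta>h] \<beta>B h(2) by (simp_all add: carrier_BijGroup)
  have "\<beta> \<otimes>\<^bsub>P\<^esub> \<rho> = right_mult_map SL2 (\<beta> h) \<otimes>\<^bsub>P\<^esub> \<beta>"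
  proof (rule Bij_ext)
    show "\<beta> \<otimes>\<^bsub>P\<^esub> \<rho> \<in> Bij (carrier SL2)" "right_mult_map SL2 (\<beta> h) \<otimes>\<^bsub>P\<^esub> \<beta> \<in> Bij (carrier SL2)"
      using P.m_closed[OF c(2,3)] P.m_closed[OF c(4,2)] by (simp_all add: carrier_BijGroup)
    fix x :: "'a ^ 2 ^ 2" assume x: "x \<in> carrier SL2"
    have "(\<beta> \<otimes>\<^bsub>P\<^esub> \<rho>) x = \<beta> (x \<cdot> h)"
      using mult_BijGroup_apply[OF \<beta>B right_mult_Bij[OF h(1)] x] right_mult_apply[OF x] h(2) by simp
    also have "\<dots> = right_mult_map SL2 (\<beta> h) (\<beta> x)"
      unfolding auto_mult[OF \<beta>a x h(1)] by (rule right_mult_apply[OF Bij_closed[OF \<beta>B x], symmetric])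
    also have "\<dots> = (right_mult_map SL2 (\<beta> h) \<otimes>\<^bsub>P\<^esub> \<beta>) x"
      by (rule mult_BijGroup_apply[OF right_mult_Bij[OF \<beta>h] \<beta>B x, symmetric])
    finally show "(\<beta> \<otimes>\<^bsub>P\<^esub> \<rho>) x = (right_mult_map SL2 (\<beta> h) \<otimes>\<^bsub>P\<^esub> \<beta>) x" .
  qed
  then have conj: "\<beta> \<otimes>\<^bsub>P\<^esub> \<rho> \<otimes>\<^bsub>P\<^esub> inv\<^bsub>P\<^esub> \<beta> = right_mult_map SL2 (\<beta> h)"
    using P.m_assoc[OF c(4,2) P.inv_closed[OF c(2)]] P.r_inv[OF c(2)] P.r_one[OF c(4)] by simp
  have "\<alpha> \<otimes>\<^bsub>P\<^esub> \<rho> \<otimes>\<^bsub>P\<^esub> inv\<^bsub>P\<^esub> \<alpha> = (?k \<otimes>\<^bsub>P\<^esub> \<beta>) \<otimes>\<^bsub>P\<^esub> \<rho> \<otimes>\<^bsub>P\<^esub> inv\<^bsub>P\<^esub> (?k \<otimes>\<^bsub>P\<^esub> \<beta>)"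
    using \<alpha>_eq by simp
  also have "\<dots> = ?k \<otimes>\<^bsub>P\<^esub> (\<beta> \<otimes>\<^bsub>P\<^esub> \<rho> \<otimes>\<^bsub>P\<^esub> inv\<^bsub>P\<^esub> \<beta>) \<otimes>\<^bsub>P\<^esub> inv\<^bsub>P\<^esub> ?k"
    using c(1-3) by (simp add: P.m_assoc P.inv_mult_group)
  finally have "\<alpha> \<otimes>\<^bsub>P\<^esub> \<rho> \<otimes>\<^bsub>P\<^esub> inv\<^bsub>P\<^esub> \<alpha> = ?k \<otimes>\<^bsub>P\<^esub> right_mult_map SL2 (\<beta> h) \<otimes>\<^bsub>P\<^esub> inv\<^bsub>P\<^esub> ?k"
    unfolding conj .
  moreover have "?k \<in> group_R" "right_mult_map SL2 (\<beta> h) \<in> group_R"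
    using k \<beta>h unfolding group_R_def by blast+
  ultimately show "\<alpha> \<otimes>\<^bsub>P\<^esub> \<rho> \<otimes>\<^bsub>P\<^esub> inv\<^bsub>P\<^esub> \<alpha> \<in> group_R"
    by (simp add: subgroup.m_closed[OF subgroup_group_R] subgroup.m_inv_closed[OF subgroup_group_R])
next
  fix \<rho> assume "\<rho> \<in> group_R" and \<rho>: "\<rho> \<in> stab_one"
  then obtain h where h: "h \<in> carrier SL2" "\<rho> = right_mult_map SL2 h"
    unfolding group_R_def by blast
  have "\<rho> \<one>\<^sub>S = h"
    unfolding h(2) right_mult_apply[OF SL2.one_closed] by (rule SL2.l_one[OF h(1)])
  then have "h = \<one>\<^sub>S"
    using \<rho> unfolding Aut_stabilizer_eq by simp
  then show "\<rho> = \<one>\<^bsub>P\<^esub>"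
    unfolding h(2) using right_mult_one by simp
next
  fix \<alpha> assume "\<alpha> \<in> aut_unital"
  then obtain \<beta> where "\<beta> \<in> stab_one" "\<alpha> \<one>\<^sub>S \<in> carrier SL2"
    "\<alpha> = right_mult_map SL2 (\<alpha> \<one>\<^sub>S) \<otimes>\<^bsub>P\<^esub> \<beta>"
    by (rule aut_unital_decomp)
  then show "\<exists>n\<in>group_R. \<exists>h\<in>stab_one. \<alpha> = n \<otimes>\<^bsub>P\<^esub> h"
    unfolding group_R_def by blast
qed

end

text \<open>Complements \<open>conj_g_D1_8\<close>: the image of \<open>D1\<close> under conjugation
  by g is not a translate of C either.\<close>

lemma conj_g_D1_group_C8: "\<exists>x\<in>set (quotients8 D1_8). conj8 mat_g8 x \<notin> set group_C8"
  and det_g3_8: "det8 (mpow8 mat_g8 3) = one8" and det_g8: "det8 mat_g8 = one8" and det_f8: "det8 mat_f8 = one8"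
  and det_D8: "\<forall>L\<in>set system_D8. \<forall>x\<in>set L. det8 x = one8"
  and det_H8: "\<forall>L\<in>set system_H8. \<forall>x\<in>set L. det8 x = one8"
  by code_simp+

lemma (in group) lagrange_index:
  assumes A: "subgroup A G" and H: "subgroup H G" "H \<subseteq> A" and card: "card A = n * card H" and pos: "card H \<noteq> 0"
  shows "card (rcosets\<^bsub>G\<lparr>carrier := A\<rparr>\<^esub> H) = n"
proof -
  interpret A: group "G\<lparr>carrier := A\<rparr>"
    using A by (rule subgroup_imp_group)
  have "card (rcosets\<^bsub>G\<lparr>carrier := A\<rparr>\<^esub> H) * card H = n * card H"
    using A.lagrange[OF subgroup_incl[OF H(1) A H(2)]] card by (simp add: order_def)
  then show ?thesis
    using pos by simp
qed

text \<open>The translating factor cancels, so translates of a set have its quotients; this reduces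
  statements about blocks to finite checks on the base sets.\<close>

lemma (in group) quotients_r_coset:
  assumes "D \<subseteq> carrier G" "x \<in> carrier G" "u \<in> D #> x" "v \<in> D #> x"
  shows "\<exists>a\<in>D. \<exists>b\<in>D. u \<otimes> inv v = a \<otimes> inv b \<and> u = a \<otimes> x \<and> v = b \<otimes> x"
proof -
  obtain a b where ab: "a \<in> D" "u = a \<otimes> x" "b \<in> D" "v = b \<otimes> x"
    using assms(3,4) unfolding r_coset_def by blast
  have c: "a \<in> carrier G" "b \<in> carrier G"
    using ab assms(1) by auto
  have "x \<otimes> (inv x \<otimes> w) = w" if "w \<in> carrier G" for w
    using assms(2) that by (simp flip: m_assoc)
  then have "u \<otimes> inv v = a \<otimes> inv b"
    unfolding ab(2,4) using c assms(2) by (simp add: m_assoc inv_mult_group)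
  then show ?thesis
    using ab by blast
qed

context gf8 begin

text \<open>The orbit closes after three steps because the Frobenius map on eight elements has order
  3.\<close>

lemma frob_orbit_frob:
  assumes "D \<in> frob_orbit X" "D \<subseteq> carrier SL2"
  shows "frob ` D \<in> frob_orbit (X :: ('a ^ 2 ^ 2) set)"
proof -
  have "frob ` D = frob_mat ` D"
    using assms(2) by (intro image_cong refl frob_apply) blast
  moreover have "frob_mat ` frob_mat ` frob_mat ` X = X"
    by (simp add: image_image frob_mat_cubed)
  ultimately show ?thesis
    using assms(1) unfolding frob_orbit_def by auto
qed

lemma conj_map_translate:
  assumes "\<forall>L\<in>set Ls. conj_translate8 h L" "det8 h = one8" "\<forall>L\<in>set Ls. \<forall>x\<in>set L. det8 x = one8"
    and "D \<in> (\<lambda>L. dec_mat ` set L) ` set Ls"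
  shows "\<exists>D'\<in>(\<lambda>L. dec_mat ` set L) ` set Ls. \<exists>y\<in>carrier SL2. conj_map SL2 (dec_mat h) ` D = D' #>\<^sub>S y"
proof -
  obtain L where L: "L \<in> set Ls" "D = dec_mat ` set L"
    using assms(4) by blast
  obtain y where "det y = 1" "conj_map SL2 (dec_mat h) ` dec_mat ` set L = dec_mat ` set L #>\<^sub>S y"
    using conj_translate[of h L] assms(1-3) L(1) by blast
  then show ?thesis
    using L assms(4) by (intro bexI[of _ D] bexI[of _ y]) simp_all
qed

end

context affine_unital begin

lemma frob_aut:
  assumes "\<And>D. D \<in> \<D> \<Longrightarrow> frob ` D \<in> \<D>"
  shows "frob \<in> aut_unital"
proof (rule auto_stab_aut[OF frob_auto_stab])
  fix D assume "D \<in> \<D>"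
  then have "frob ` D \<in> \<D>"
    by (rule assms)
  then show "\<exists>D'\<in>\<D>. \<exists>y\<in>carrier SL2. frob ` D = D' #>\<^sub>S y"
    using SL2.coset_mult_one[OF D_facts(1)] SL2.one_closed by metis
qed

end

theorem theorem3p2:
  fixes z :: "'a::field" and T :: "('a ^ 2 ^ 2) set"
  assumes "CARD('a) = 8"
    and "range (\<lambda>n::nat. z ^ n) = UNIV - {0}"
    and "z ^ 3 = z + 1"
    and "sylow_subgroup 2 SL2 T"
  shows "affine_unital_data (group_C z) T (system_D z) \<and>
    internal_direct Perm_SL2
      (group_F <#>\<^bsub>Perm_SL2\<^esub> group_L) group_F (group_L :: ('a ^ 2 ^ 2 \<Rightarrow> 'a ^ 2 ^ 2) set) \<and>
    internal_semidirect Perm_SL2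
      (Aut_stabilizer (WU z T) \<one>\<^bsub>SL2\<^esub>) (group_U z) (group_F <#>\<^bsub>Perm_SL2\<^esub> group_L) \<and>
    internal_semidirect Perm_SL2
      (Aut_stabilizer (WU z T) \<one>\<^bsub>SL2\<^esub>) (group_U z) group_FL \<and>
    perm_subgroup (group_U z) \<cong> integer_mod_group 3 \<and>
    perm_subgroup (group_FL :: ('a ^ 2 ^ 2 \<Rightarrow> 'a ^ 2 ^ 2) set) \<cong> integer_mod_group 6 \<and>
    (\<exists>\<theta> \<in> hom (integer_mod_group 6) (AutoGroup (integer_mod_group 3)).
       perm_subgroup (Aut_stabilizer (WU z T) \<one>\<^bsub>SL2\<^esub>)
         \<cong> semidirect_product (integer_mod_group 3) (integer_mod_group 6) \<theta>) \<and>
    internal_semidirect Perm_SL2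
      (aut_incidence (WU z T)) group_R (Aut_stabilizer (WU z T) \<one>\<^bsub>SL2\<^esub>) \<and>
    internal_semidirect Perm_SL2
      (aut_incidence (classical_unital z T)) group_R (auto_stab (group_C z)) \<and>
    subgroup (aut_incidence (WU z T)) (perm_subgroup (aut_incidence (classical_unital z T))) \<and>
    card (rcosets\<^bsub>perm_subgroup (aut_incidence (classical_unital z T))\<^esub>
      aut_incidence (WU z T)) = 3"
proof -
  interpret gf8 z
    using assms(1-3) by unfold_locales
  have data_D: "affine_unital_data (group_C z) T (system_D z)"
    unfolding system_D_eq by (rule affine_unital_data_of_system8[OF assms(4) difference_system_D8])
  have data_H: "affine_unital_data (group_C z) T (system_H z)"
    unfolding system_H_eq by (rule affine_unital_data_of_system8[OF assms(4) difference_system_H8])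
  interpret D: affine_unital z T "system_D z"
    using data_D by unfold_locales
  interpret H: affine_unital z T "system_H z"
    using data_H by unfold_locales

  \<comment> \<open>Which generators preserve the two systems\<close>
  have frob_D: "frob \<in> D.aut_unital"
  proof (rule D.frob_aut)
    fix X assume X: "X \<in> system_D z"
    then show "frob ` X \<in> system_D z"
      using D.D_facts(1)[OF X] frob_orbit_frob unfolding system_D_def by blast
  qed
  have frob_H: "frob \<in> H.aut_unital"
  proof (rule H.frob_aut)
    fix X assume X: "X \<in> system_H z"
    then show "frob ` X \<in> system_H z"
      using H.D_facts(1)[OF X] frob_orbit_frob unfolding system_H_def by blast
  qed
  have f_D: "conj_map SL2 mat_f \<in> D.aut_unital"
    by (rule D.auto_stab_aut[OF conj_f_auto_stab], unfold system_D_eq dec_mat_f[symmetric])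
      (rule conj_map_translate[OF conj_translate_D8(2) det_f8 det_D8])
  have f_H: "conj_map SL2 mat_f \<in> H.aut_unital"
    by (rule H.auto_stab_aut[OF conj_f_auto_stab], unfold system_H_eq dec_mat_f[symmetric])
      (rule conj_map_translate[OF conj_translate_H8(2) det_f8 det_H8])
  have g3_D: "conj_g 3 \<in> D.aut_unital"
    by (rule D.auto_stab_aut[OF conj_g_auto_stab], unfold system_D_eq dec_mpow[symmetric])
      (rule conj_map_translate[OF conj_translate_D8(1) det_g3_8 det_D8])
  have g_pow1: "mat_g z \<up> 1 = mat_g z"
    using g_carrier by simp
  have g_H: "conj_g 1 \<in> H.aut_unital"
    by (rule H.auto_stab_aut[OF conj_g_auto_stab], unfold g_pow1, unfold system_H_eq dec_mat_g[symmetric])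
      (rule conj_map_translate[OF conj_translate_H8(1) det_g8 det_H8])
  have FL_D: "frob_f \<in> D.aut_unital"
    by (rule subgroup.m_closed[OF D.subgroup_aut_unital frob_D f_D])
  have FL_H: "frob_f \<in> H.aut_unital"
    by (rule subgroup.m_closed[OF H.subgroup_aut_unital frob_H f_H])

  \<comment> \<open>The image of \<open>D1\<close> would be a block, hence a translate of C, of a
    root group, or of a member of the system. The first and the last are refuted by a computed
    quotient, the second by its size.\<close>
  have g_not_D: "conj_g 1 \<notin> D.aut_unital"
  proof
    assume g: "conj_g 1 \<in> D.aut_unital"
    let ?\<gamma> = "conj_map SL2 (mat_g z)"
    have \<gamma>: "?\<gamma> \<in> auto SL2"
      by (rule SL2.conj_map_auto[OF g_carrier])
    have D1: "D1 z \<in> system_D z"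
      by (simp add: system_D_def frob_orbit_def)
    have "D1 z = D1 z #>\<^sub>S \<one>\<^sub>S"
      using SL2.coset_mult_one[OF D.D_facts(1)[OF D1]] by simp
    then have "D1 z \<in> D.blocks"
      using D.block_D[OF D1 SL2.one_closed] by simp
    moreover have "\<forall>B\<in>D.blocks. ?\<gamma> ` B \<in> D.blocks"
      using g unfolding g_pow1 aut_incidence_def by blast
    ultimately have block: "?\<gamma> ` D1 z \<in> D.blocks"
      by blast
    have D1_8: "D1_8 \<in> set system_D8"
      by (simp add: system_D8_def frob_orbit8_def)
    have quot_D1: "quotients (D1 z) = dec_mat ` set (quotients8 D1_8)"
      unfolding D1_eq using det_D8 D1_8 by (intro quotients_eq) blast
    have quot: "dec_mat (conj8 mat_g8 q) \<in> {u \<cdot> inv\<^sub>S v | u v. u \<in> ?\<gamma> ` D1 z \<and> v \<in> ?\<gamma> ` D1 z \<and> u \<noteq> v}"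
      if q: "q \<in> set (quotients8 D1_8)" for q
    proof -
      have "dec_mat q \<in> quotients (D1 z)"
        unfolding quot_D1 using q by (rule imageI)
      then obtain x y where xy: "x \<in> D1 z" "y \<in> D1 z" "x \<noteq> y" "dec_mat q = x \<cdot> inv\<^sub>S y"
        unfolding quotients_def by blast
      have c: "x \<in> carrier SL2" "y \<in> carrier SL2"
        using xy D.D_facts(1)[OF D1] by auto
      have "dec_mat q \<in> carrier SL2"
        unfolding xy(4) by (intro SL2.m_closed SL2.inv_closed c)
      then have "det8 q = one8"
        by (simp add: det_dec_mat_eq_1_iff)
      then have "dec_mat (conj8 mat_g8 q) = ?\<gamma> (dec_mat q)"
        using conj_dec_mat[OF det_g8] dec_mat_g by simp
      also have "\<dots> = ?\<gamma> x \<cdot> inv\<^sub>S ?\<gamma> y"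
        unfolding xy(4) by (rule SL2.auto_quotients[OF \<gamma> c])
      finally have "dec_mat (conj8 mat_g8 q) = ?\<gamma> x \<cdot> inv\<^sub>S ?\<gamma> y" .
      moreover have "?\<gamma> x \<noteq> ?\<gamma> y"
        using inj_onD[OF Bij_inj[OF auto_Bij[OF \<gamma>]] _ c] xy(3) by blast
      ultimately show ?thesis
        using xy(1,2) by blast
    qed
    show False
      using block
    proof (cases rule: D.blockE)
      case (1 x)
      obtain q where q: "q \<in> set (quotients8 D1_8)" "conj8 mat_g8 q \<notin> set group_C8"
        using conj_g_D1_group_C8 by blast
      obtain u v where uv: "dec_mat (conj8 mat_g8 q) = u \<cdot> inv\<^sub>S v"
        "u \<in> group_C z #>\<^sub>S x" "v \<in> group_C z #>\<^sub>S x"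
        using quot[OF q(1)] unfolding 1(2) by blast
      obtain a b where "a \<in> group_C z" "b \<in> group_C z" "u \<cdot> inv\<^sub>S v = a \<cdot> inv\<^sub>S b"
        using SL2.quotients_r_coset[OF group_C_subset 1(1) uv(2,3)] by blast
      then have "dec_mat (conj8 mat_g8 q) \<in> group_C z"
        unfolding uv(1) by (simp add: subgroup.m_closed[OF subgroup_group_C] subgroup.m_inv_closed[OF subgroup_group_C])
      then show False
        using q(2) unfolding group_C_eq by (simp add: image_iff)
    next
      case (2 Q x)
      have "card (?\<gamma> ` D1 z) = 9"
        using card_image[OF inj_on_subset[OF Bij_inj[OF auto_Bij[OF \<gamma>]] D.D_facts(1)[OF D1]]] D.D_facts(2)[OF D1] by simp
      then show False
        using SL2.card_r_coset[OF root_groups_subset[OF 2(1)] 2(2)] card_root_groups[OF 2(1)] 2(3) by simp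
    next
      case (3 X x)
      obtain L where L: "L \<in> set system_D8" "X = dec_mat ` set L"
        using 3(1) unfolding system_D_eq by blast
      obtain q where q: "q \<in> set (quotients8 D1_8)" "conj8 mat_g8 q \<notin> set (quotients8 L)"
        using conj_g_D1_8 L(1) by blast
      obtain u v where uv: "dec_mat (conj8 mat_g8 q) = u \<cdot> inv\<^sub>S v"
        "u \<in> X #>\<^sub>S x" "v \<in> X #>\<^sub>S x" "u \<noteq> v"
        using quot[OF q(1)] unfolding 3(3) by blast
      obtain a b where ab: "a \<in> X" "b \<in> X" "u \<cdot> inv\<^sub>S v = a \<cdot> inv\<^sub>S b"
        "u = a \<cdot> x" "v = b \<cdot> x"
        using SL2.quotients_r_coset[OF D.D_facts(1)[OF 3(1)] 3(2) uv(2,3)] by blast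
      have "a \<noteq> b"
        using ab(4,5) uv(4) by blast
      then have "dec_mat (conj8 mat_g8 q) \<in> quotients X"
        unfolding quotients_def mem_Collect_eq uv(1) using ab(1-3) by (intro exI[of _ a] exI[of _ b] conjI)
      moreover have "quotients X = dec_mat ` set (quotients8 L)"
        unfolding L(2) using det_D8 L(1) by (intro quotients_eq) blast
      ultimately show False
        using q(2) by (simp add: image_iff)
    qed
  qed

  let ?S = "Aut_stabilizer (WU z T) \<one>\<^sub>S"
  have S_eq: "?S = D.aut_unital \<inter> auto_stab (group_C z)"
    unfolding WU_def by (rule D.Aut_stabilizer_eq_Int)
  have S: "subgroup ?S P" "?S \<subseteq> auto_stab (group_C z)"
    unfolding WU_def by (rule D.subgroup_Aut_stabilizer, rule D.Aut_stabilizer_subset)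
  have pow_S: "x [^]\<^bsub>P\<^esub> (n::nat) \<in> ?S" if "x \<in> ?S" for x n
    using that by (rule P.subgroup_nat_pow_closed[OF S(1)])
  have dvd3: "3 dvd i" if i: "conj_g i \<in> ?S" for i
  proof (rule ccontr)
    assume "\<not> 3 dvd i"
    then obtain k :: nat where k: "2 ^ k mod 9 = i mod 9"
      by (rule unit_mod_9)
    \<comment> \<open>The factor 2 ^ (5 * k) inverts i = 2 ^ k modulo 9, as 2 has order 6; so
      \<gamma>_g would be a power of \<gamma>_(g^i).\<close>
    have "i * 2 ^ (5 * k) mod 9 = (i mod 9) * 2 ^ (5 * k) mod 9"
      by (simp only: mod_mult_left_eq)
    also have "\<dots> = 2 ^ k * 2 ^ (5 * k) mod 9"
      unfolding k[symmetric] by (simp only: mod_mult_left_eq)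
    also have "\<dots> = (2 :: nat) ^ (6 * k) mod 9"
      by (simp flip: power_add)
    also have "\<dots> = 1 mod 9"
      unfolding two_power_mod_9[of "6 * k"] by simp
    finally have "mat_g z \<up> (i * 2 ^ (5 * k)) = mat_g z \<up> 1"
      unfolding g_pow_eq_iff .
    then have "conj_g 1 \<in> ?S"
      using pow_S[OF i, of "2 ^ (5 * k)"] unfolding conj_g_pow by simp
    then show False
      using g_not_D unfolding S_eq by blast
  qed

  \<comment> \<open>Structure of the stabilizers and the index\<close>
  have FL: "group_F <#>\<^bsub>P\<^esub> group_L = group_FL"
    unfolding group_F_def group_L_def group_FL_eq by (rule FL_facts(1))
  have U: "group_U z = generate P {conj_g 3}"
    unfolding group_U_def ..
  have sd_S: "internal_semidirect P ?S (group_U z) group_FL"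
    unfolding U
  proof (rule semidirect_conj_g_FL[OF S])
    show "conj_g 3 \<in> ?S" "frob_f \<in> ?S"
      using g3_D FL_D conj_g_auto_stab frob_f_auto_stab unfolding S_eq by blast+
  qed (use dvd3 in simp_all)
  have sd_C: "internal_semidirect P (auto_stab (group_C z)) (generate P {conj_g 1}) group_FL"
    by (rule semidirect_conj_g_FL[OF subgroup_auto_stab subset_refl])
      (simp_all only: conj_g_auto_stab frob_f_auto_stab one_dvd one_neq_zero not_False_eq_True)
  have ord3: "P.ord (conj_g 3) = 3"
    using ord_conj_g[of 3] by simp
  have ord9: "P.ord (conj_g 1) = 9"
    using ord_conj_g[of 1] by simp
  note iso_U = P.integer_mod_group_iso_generate[OF conj_g_carrier ord3]
  note iso_FL = P.integer_mod_group_iso_generate[OF frob_f_carrier FL_facts(3)]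

  have aut_D: "internal_semidirect P (aut_incidence (WU z T)) group_R ?S"
    unfolding WU_def by (rule D.aut_unital_semidirect)
  \<comment> \<open>By \<open>auto_stab_cases\<close> it suffices that \<gamma>_g and
    \<open>frob_f\<close> preserve the classical system.\<close>
  have "auto_stab (group_C z) \<subseteq> H.aut_unital"
  proof
    fix \<alpha> assume "\<alpha> \<in> auto_stab (group_C z)"
    then obtain i k where \<alpha>: "\<alpha> = conj_g i \<otimes>\<^bsub>P\<^esub> frob_f [^]\<^bsub>P\<^esub> (k::nat)"
      by (rule auto_stab_cases)
    note pow_H = P.subgroup_nat_pow_closed[OF H.subgroup_aut_unital]
    have "conj_g i \<in> H.aut_unital"
      using pow_H[OF g_H, of i] unfolding conj_g_pow by simp
    then show "\<alpha> \<in> H.aut_unital"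
      unfolding \<alpha> by (rule subgroup.m_closed[OF H.subgroup_aut_unital _ pow_H[OF FL_H]])
  qed
  then have stab_H: "Aut_stabilizer (classical_unital z T) \<one>\<^sub>S = auto_stab (group_C z)"
    unfolding classical_unital_def H.Aut_stabilizer_eq_Int by blast
  have aut_H: "internal_semidirect P (aut_incidence (classical_unital z T)) group_R (auto_stab (group_C z))"
    unfolding stab_H[symmetric] unfolding classical_unital_def by (rule H.aut_unital_semidirect)
  \<comment> \<open>Both groups contain the same translations, and the stabilizer in the new unital
    preserves C, hence lies in the classical stabilizer.\<close>
  have sub: "aut_incidence (WU z T) \<subseteq> aut_incidence (classical_unital z T)"
  proof
    fix \<alpha> assume "\<alpha> \<in> aut_incidence (WU z T)"
    then obtain \<rho> \<beta> where *: "\<rho> \<in> group_R" "\<beta> \<in> ?S" "\<alpha> = \<rho> \<otimes>\<^bsub>P\<^esub> \<beta>"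
      using P.internal_semidirectD(8)[OF aut_D] by blast
    have "\<rho> \<in> aut_incidence (classical_unital z T)" "\<beta> \<in> aut_incidence (classical_unital z T)"
      using P.internal_semidirectD(4,5)[OF aut_H] * S(2) by blast+
    then show "\<alpha> \<in> aut_incidence (classical_unital z T)"
      unfolding *(3) by (rule subgroup.m_closed[OF P.internal_semidirectD(1)[OF aut_H]])
  qed
  have card_S: "card ?S = 18"
    using P.card_internal_semidirect[OF sd_S] P.generate_pow_card[OF conj_g_carrier, of 3]
      P.generate_pow_card[OF frob_f_carrier] ord3 FL_facts(3) by (simp add: U group_FL_eq)
  have card_C: "card (auto_stab (group_C z)) = 54"
    using P.card_internal_semidirect[OF sd_C] P.generate_pow_card[OF conj_g_carrier, of 1]
      P.generate_pow_card[OF frob_f_carrier] ord9 FL_facts(3) by (simp add: group_FL_eq)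
  \<comment> \<open>The order of \<open>group_R\<close> cancels in the index 54 / 18; it only has to
    be nonzero.\<close>
  have R: "card (group_R :: ('a ^ 2 ^ 2 \<Rightarrow> 'a ^ 2 ^ 2) set) \<noteq> 0"
    using subgroup.one_closed[OF subgroup_group_R] by (auto simp: group_R_def)
  have index: "card (rcosets\<^bsub>perm_subgroup (aut_incidence (classical_unital z T))\<^esub> aut_incidence (WU z T)) = 3"
  proof (rule P.lagrange_index)
    show "subgroup (aut_incidence (classical_unital z T)) P" "subgroup (aut_incidence (WU z T)) P"
      by (rule P.internal_semidirectD(1)[OF aut_H], rule P.internal_semidirectD(1)[OF aut_D])
    show "card (aut_incidence (classical_unital z T)) = 3 * card (aut_incidence (WU z T))"
      using P.card_internal_semidirect[OF aut_H] P.card_internal_semidirect[OF aut_D] card_S card_C by simp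
    show "card (aut_incidence (WU z T)) \<noteq> 0"
      using P.card_internal_semidirect[OF aut_D] card_S R by simp
  qed (rule sub)
  have sub_H: "subgroup (aut_incidence (WU z T)) (perm_subgroup (aut_incidence (classical_unital z T)))"
    by (rule P.subgroup_incl[OF P.internal_semidirectD(1)[OF aut_D] P.internal_semidirectD(1)[OF aut_H] sub])
  have direct: "internal_direct P (group_F <#>\<^bsub>P\<^esub> group_L) group_F group_L"
    unfolding group_F_def group_L_def by (rule FL_facts(2))
  have iso_U': "perm_subgroup (group_U z) \<cong> integer_mod_group 3"
    unfolding U by (rule P.generate_iso_integer_mod_group[OF conj_g_carrier ord3]) simp
  have iso_FL': "perm_subgroup (group_FL :: ('a ^ 2 ^ 2 \<Rightarrow> 'a ^ 2 ^ 2) set) \<cong> integer_mod_group 6"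
    unfolding group_FL_eq by (rule P.generate_iso_integer_mod_group[OF frob_f_carrier FL_facts(3)]) simp
  have iso_S: "\<exists>\<theta> \<in> hom (integer_mod_group 6) (AutoGroup (integer_mod_group 3)).
       perm_subgroup ?S \<cong> semidirect_product (integer_mod_group 3) (integer_mod_group 6) \<theta>"
    by (rule P.internal_semidirect_iso[OF sd_S group_integer_mod_group group_integer_mod_group])
      (use iso_U iso_FL in \<open>simp_all add: U group_FL_eq\<close>)
  show ?thesis
    unfolding FL using data_D direct sd_S iso_U' iso_FL' iso_S aut_D aut_H sub_H index by (simp add: FL)
qed

end
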